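(* Let $\rho=\rho_{AB}$ be any state on a finite-dimensional bipartite quantum system. The entanglement cost under (asymptotically) dually non-entangling operations coincides with the corresponding entanglement cost under (asymptotically) non-entangling operations: $$E_{c,\mathrm{DNE}}(\rho)=E_{c,\mathrm{NE}}(\rho),\qquad E_{c,\mathrm{ADNE}}(\rho)=E_{c,\mathrm{ANE}}(\rho)=D^\infty(\rho\|\mathcal S).$$
   Context: All Hilbert spaces are finite-dimensional; states are density operators. $\mathcal S=\mathcal S(A\!:\!B)$ is the set of separable states on $AB$ (finite convex combinations of product states); $\mathrm{cone}(\mathcal S)=\{\lambda\sigma:\lambda\ge0,\sigma\in\mathcal S\}$; $\mathcal S_n=\mathcal S(A^n\!:\!B^n)$. $D(\rho\|\sigma)=\mathrm{Tr}[\rho(\log_2\rho-\log_2\sigma)]$ (equal to $+\infty$ unless $\mathrm{supp}\,\rho\subseteq\mathrm{supp}\,\sigma$), $D(\rho\|\mathcal S)=\min_{\sigma\in\mathcal S}D(\rho\|\sigma)$, and $D^\infty(\rho\|\mathcal S)=\lim_{n\to\infty}\frac1nD(\rho^{\otimes n}\|\mathcal S_n)$ (regularised relative entropy of entanglement; the limit exists by sub-additivity). Generalised robustness: $R^g_{\mathcal S}(\rho)=\min\{r\ge0:\exists\,\sigma\in\mathcal S,\ \rho\le(1+r)\sigma\}$. The adjoint $\Xi^\dagger$ is defined by $\mathrm{Tr}[X\,\Xi(Y)]=\mathrm{Tr}[\Xi^\dagger(X)Y]$. For $\delta\ge0$, $\mathrm{NE}^g_\delta(AB\to A'B')$ is the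 set of completely positive trace-preserving maps $\Xi$ with $R^g_{\mathcal S}(\Xi(\sigma))\le\delta$ for all $\sigma\in\mathcal S(A\!:\!B)$; $\mathrm{DNE}^g_\delta$ is the subset of those that additionally satisfy $\Xi^\dagger(\mathcal S(A'\!:\!B'))\subseteq\mathrm{cone}(\mathcal S(A\!:\!B))$. Let $\Phi_2=|\Phi_2\rangle\langle\Phi_2|$, $|\Phi_2\rangle=\frac1{\sqrt2}(|00\rangle+|11\rangle)$ on a two-qubit system $A_0B_0$; $\Phi_2^{\otimes m}$ is bipartite across $A_0^m:B_0^m$. For $\mathcal F\in\{\mathrm{NE},\mathrm{DNE}\}$ and $\varepsilon\in[0,1)$ the one-shot entanglement cost is $$E^{(1),\varepsilon}_{c,\mathcal F^g_\delta}(\rho)=\min\Big\{m\in\mathbb N:\ \inf_{\Lambda\in\mathcal F^g_\delta(A_0^mB_0^m\to AB)}\tfrac12\|\Lambda(\Phi_2^{\otimes m})-\rho\|_1\le\varepsilon\Big\}$$ (with $0\in\mathbb N$). For a sequence $\delta_n\ge0$, $E_{c,\mathcal F^g_{(\delta_n)}}(\rho)=\lim_{\varepsilon\to0^+}\limsup_{n\to\infty}\frac1nE^{(1),\varepsilon}_{c,\mathcal F^g_{\delta_n}}(\rho^{\otimes n})$. $E_{c,\mathcal F}$ is the case $\delta_n\equiv0$. $E_{c,\mathrm{ANE}}(\rho)$ and $E_{c,\mathrm{ADNE}}(\rho)$ (asymptotically (dually) non-entangling operations) are the infima of $E_{c,\mathrm{NE}^g_{(\delta_n)}}(\rho)$ and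 $E_{c,\mathrm{DNE}^g_{(\delta_n)}}(\rho)$, respectively, over all sequences with $\delta_n\ge 0$, $\delta_n\to0$. *)

theory Defs
  imports "HOL-Library.Extended_Real" "Jordan_Normal_Form.Schur_Decomposition"
begin

text \<open>
  Operators on a \<open>d\<close>-dimensional Hilbert space are the complex matrices in \<open>carrier_mat d d\<close>.
  A bipartite system \<open>A : B\<close> is given by its local dimensions \<open>a\<close>, \<open>b\<close>; the basis vector
  \<open>|i\<rangle> \<otimes> |j\<rangle>\<close> (\<open>i < a\<close>, \<open>j < b\<close>) has index \<open>i * b + j\<close>.
\<close>

section \<open>Matrices, states and channels\<close>

definition mat_trace :: "complex mat \<Rightarrow> complex" where
  "mat_trace A = (\<Sum>i<dim_row A. A $$ (i, i))"

definition kron :: "complex mat \<Rightarrow> complex mat \<Rightarrow> complex mat" where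
  "kron X Y = mat (dim_row X * dim_row Y) (dim_col X * dim_col Y)
     (\<lambda>(i, j). X $$ (i div dim_row Y, j div dim_col Y) * Y $$ (i mod dim_row Y, j mod dim_col Y))"

definition psd :: "nat \<Rightarrow> complex mat \<Rightarrow> bool" where
  "psd d A \<longleftrightarrow> A \<in> carrier_mat d d \<and>
     (\<forall>v \<in> carrier_vec d. Im ((A *\<^sub>v v) \<bullet>c v) = 0 \<and> Re ((A *\<^sub>v v) \<bullet>c v) \<ge> 0)"

definition density :: "nat \<Rightarrow> complex mat \<Rightarrow> bool" where
  "density d \<rho> \<longleftrightarrow> psd d \<rho> \<and> mat_trace \<rho> = 1"

definition unitary_mat :: "nat \<Rightarrow> complex mat \<Rightarrow> bool" where
  "unitary_mat d U \<longleftrightarrow> U \<in> carrier_mat d d \<and> U * mat_adjoint U = 1\<^sub>m d \<and> mat_adjoint U * U = 1\<^sub>m d"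

text \<open>
  Functional calculus \<open>f(A) = U diag(f(\<lambda>\<^sub>i)) U\<^sup>\<dagger>\<close> for Hermitian \<open>A = U diag(\<lambda>\<^sub>i) U\<^sup>\<dagger>\<close>;
  the result does not depend on the chosen diagonalisation.
\<close>

definition herm_fun :: "(real \<Rightarrow> real) \<Rightarrow> complex mat \<Rightarrow> complex mat" where
  "herm_fun f A = (THE B. \<exists>U l. unitary_mat (dim_row A) U \<and>
     A = U * mat_diag (dim_row A) (\<lambda>i. complex_of_real (l i)) * mat_adjoint U \<and>
     B = U * mat_diag (dim_row A) (\<lambda>i. complex_of_real (f (l i))) * mat_adjoint U)"

definition trace_norm :: "complex mat \<Rightarrow> real" where
  "trace_norm X = Re (mat_trace (herm_fun sqrt (mat_adjoint X * X)))"

definition linear_map :: "nat \<Rightarrow> nat \<Rightarrow> (complex mat \<Rightarrow> complex mat) \<Rightarrow> bool" where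
  "linear_map d d' \<Xi> \<longleftrightarrow>
     (\<forall>X \<in> carrier_mat d d. \<Xi> X \<in> carrier_mat d' d') \<and>
     (\<forall>X \<in> carrier_mat d d. \<forall>Y \<in> carrier_mat d d. \<Xi> (X + Y) = \<Xi> X + \<Xi> Y) \<and>
     (\<forall>c. \<forall>X \<in> carrier_mat d d. \<Xi> (c \<cdot>\<^sub>m X) = c \<cdot>\<^sub>m \<Xi> X)"

text \<open>\<open>ampliation k d d' \<Xi>\<close> is \<open>id\<^sub>k \<otimes> \<Xi>\<close>: it applies \<open>\<Xi>\<close> to each \<open>d \<times> d\<close> block.\<close>

definition ampliation ::
  "nat \<Rightarrow> nat \<Rightarrow> nat \<Rightarrow> (complex mat \<Rightarrow> complex mat) \<Rightarrow> complex mat \<Rightarrow> complex mat" where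
  "ampliation k d d' \<Xi> X = mat (k * d') (k * d')
     (\<lambda>(i, j). \<Xi> (mat d d (\<lambda>(p, q). X $$ ((i div d') * d + p, (j div d') * d + q)))
        $$ (i mod d', j mod d'))"

definition completely_positive :: "nat \<Rightarrow> nat \<Rightarrow> (complex mat \<Rightarrow> complex mat) \<Rightarrow> bool" where
  "completely_positive d d' \<Xi> \<longleftrightarrow>
     (\<forall>k X. psd (k * d) X \<longrightarrow> psd (k * d') (ampliation k d d' \<Xi> X))"

definition trace_preserving :: "nat \<Rightarrow> (complex mat \<Rightarrow> complex mat) \<Rightarrow> bool" where
  "trace_preserving d \<Xi> \<longleftrightarrow> (\<forall>X \<in> carrier_mat d d. mat_trace (\<Xi> X) = mat_trace X)"

definition cptp :: "nat \<Rightarrow> nat \<Rightarrow> (complex mat \<Rightarrow> complex mat) \<Rightarrow> bool" where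
  "cptp d d' \<Xi> \<longleftrightarrow> linear_map d d' \<Xi> \<and> completely_positive d d' \<Xi> \<and> trace_preserving d \<Xi>"

definition adjoint_map ::
  "nat \<Rightarrow> (complex mat \<Rightarrow> complex mat) \<Rightarrow> complex mat \<Rightarrow> complex mat" where
  "adjoint_map d \<Xi> X = (THE Z. Z \<in> carrier_mat d d \<and>
     (\<forall>Y \<in> carrier_mat d d. mat_trace (X * \<Xi> Y) = mat_trace (Z * Y)))"

section \<open>Bipartite systems\<close>

definition sep :: "nat \<Rightarrow> nat \<Rightarrow> complex mat set" where
  "sep a b = {\<sigma>. \<exists>(n :: nat) p \<alpha> \<beta>.
     (\<forall>k<n. p k \<ge> (0 :: real) \<and> density a (\<alpha> k) \<and> density b (\<beta> k)) \<and> (\<Sum>k<n. p k) = 1 \<and>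
     \<sigma> = mat (a * b) (a * b) (\<lambda>(i, j). \<Sum>k<n. complex_of_real (p k) * kron (\<alpha> k) (\<beta> k) $$ (i, j))}"

definition cone :: "complex mat set \<Rightarrow> complex mat set" where
  "cone S = {complex_of_real c \<cdot>\<^sub>m \<sigma> | c \<sigma>. c \<ge> 0 \<and> \<sigma> \<in> S}"

text \<open>
  \<open>bi_tensor a1 b1 a2 b2 X Y\<close> is \<open>X \<otimes> Y\<close> for \<open>X\<close> on \<open>A\<^sub>1 : B\<^sub>1\<close> and \<open>Y\<close> on \<open>A\<^sub>2 : B\<^sub>2\<close>, with the
  tensor factors reordered so that it acts on \<open>A\<^sub>1A\<^sub>2 : B\<^sub>1B\<^sub>2\<close>, that is, the basis vector
  \<open>|i\<^sub>1i\<^sub>2\<rangle> \<otimes> |j\<^sub>1j\<^sub>2\<rangle>\<close> has index \<open>(i\<^sub>1 * a\<^sub>2 + i\<^sub>2) * (b\<^sub>1 * b\<^sub>2) + (j\<^sub>1 * b\<^sub>2 + j\<^sub>2)\<close>.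
  The functions \<open>bi_idx1\<close>, \<open>bi_idx2\<close> recover \<open>i\<^sub>1 * b\<^sub>1 + j\<^sub>1\<close> and \<open>i\<^sub>2 * b\<^sub>2 + j\<^sub>2\<close> from it.
\<close>

definition bi_idx1 :: "nat \<Rightarrow> nat \<Rightarrow> nat \<Rightarrow> nat \<Rightarrow> nat" where
  "bi_idx1 b1 a2 b2 k = (k div (b1 * b2)) div a2 * b1 + (k mod (b1 * b2)) div b2"

definition bi_idx2 :: "nat \<Rightarrow> nat \<Rightarrow> nat \<Rightarrow> nat \<Rightarrow> nat" where
  "bi_idx2 b1 a2 b2 k = (k div (b1 * b2)) mod a2 * b2 + (k mod (b1 * b2)) mod b2"

definition bi_tensor ::
  "nat \<Rightarrow> nat \<Rightarrow> nat \<Rightarrow> nat \<Rightarrow> complex mat \<Rightarrow> complex mat \<Rightarrow> complex mat" where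
  "bi_tensor a1 b1 a2 b2 X Y = mat ((a1 * a2) * (b1 * b2)) ((a1 * a2) * (b1 * b2))
     (\<lambda>(k, l). X $$ (bi_idx1 b1 a2 b2 k, bi_idx1 b1 a2 b2 l) *
               Y $$ (bi_idx2 b1 a2 b2 k, bi_idx2 b1 a2 b2 l))"

text \<open>\<open>bi_power a b n \<rho>\<close> is \<open>\<rho>\<^sup>\<otimes>\<^sup>n\<close> as an operator on \<open>A\<^sup>n : B\<^sup>n\<close>.\<close>

fun bi_power :: "nat \<Rightarrow> nat \<Rightarrow> nat \<Rightarrow> complex mat \<Rightarrow> complex mat" where
  "bi_power a b 0 \<rho> = 1\<^sub>m 1"
| "bi_power a b (Suc n) \<rho> = bi_tensor (a ^ n) (b ^ n) a b (bi_power a b n \<rho>) \<rho>"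

definition phi2_vec :: "complex vec" where
  "phi2_vec = complex_of_real (1 / sqrt 2) \<cdot>\<^sub>v (unit_vec 4 0 + unit_vec 4 3)"

definition phi2 :: "complex mat" where
  "phi2 = mat 4 4 (\<lambda>(i, j). phi2_vec $ i * cnj (phi2_vec $ j))"

section \<open>Relative entropy of entanglement\<close>

text \<open>The support of a Hermitian operator is its range.\<close>

definition supp :: "complex mat \<Rightarrow> complex vec set" where
  "supp A = {A *\<^sub>v v | v. v \<in> carrier_vec (dim_col A)}"

text \<open>The logarithm of a positive semidefinite operator is taken on its support.\<close>

definition mat_log2 :: "complex mat \<Rightarrow> complex mat" where
  "mat_log2 = herm_fun (\<lambda>x. if x > 0 then log 2 x else 0)"

definition rel_entropy :: "complex mat \<Rightarrow> complex mat \<Rightarrow> ereal" where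
  "rel_entropy \<rho> \<sigma> = (if supp \<rho> \<subseteq> supp \<sigma>
     then ereal (Re (mat_trace (\<rho> * (mat_log2 \<rho> - mat_log2 \<sigma>)))) else \<infinity>)"

definition rel_entropy_set :: "complex mat \<Rightarrow> complex mat set \<Rightarrow> ereal" where
  "rel_entropy_set \<rho> S = (INF \<sigma> \<in> S. rel_entropy \<rho> \<sigma>)"

definition reg_rel_entropy :: "nat \<Rightarrow> nat \<Rightarrow> complex mat \<Rightarrow> ereal" where
  "reg_rel_entropy a b \<rho> =
     lim (\<lambda>n. rel_entropy_set (bi_power a b n \<rho>) (sep (a ^ n) (b ^ n)) / ereal (real n))"

section \<open>Free operations and entanglement cost\<close>

definition robustness :: "nat \<Rightarrow> nat \<Rightarrow> complex mat \<Rightarrow> ereal" where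
  "robustness a b \<rho> = Inf {ereal r | r. r \<ge> 0 \<and>
     (\<exists>\<sigma> \<in> sep a b. psd (a * b) (complex_of_real (1 + r) \<cdot>\<^sub>m \<sigma> - \<rho>))}"

text \<open>A class of operations gives for each \<open>a b a' b'\<close> a set of maps \<open>AB \<rightarrow> A'B'\<close>.\<close>

type_synonym op_class = "nat \<Rightarrow> nat \<Rightarrow> nat \<Rightarrow> nat \<Rightarrow> (complex mat \<Rightarrow> complex mat) set"

definition NE :: "real \<Rightarrow> op_class" where
  "NE \<delta> a b a' b' = {\<Xi>. cptp (a * b) (a' * b') \<Xi> \<and>
     (\<forall>\<sigma> \<in> sep a b. robustness a' b' (\<Xi> \<sigma>) \<le> ereal \<delta>)}"

definition DNE :: "real \<Rightarrow> op_class" where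
  "DNE \<delta> a b a' b' = {\<Xi> \<in> NE \<delta> a b a' b'.
     adjoint_map (a * b) \<Xi> ` sep a' b' \<subseteq> cone (sep a b)}"

text \<open>The infimum of the empty set of natural numbers is read as \<open>\<infinity>\<close>.\<close>

definition one_shot_cost :: "op_class \<Rightarrow> real \<Rightarrow> nat \<Rightarrow> nat \<Rightarrow> complex mat \<Rightarrow> ereal" where
  "one_shot_cost F \<epsilon> a b \<rho> =
     Inf {ereal (real m) | m :: nat.
       (INF \<Lambda> \<in> F (2 ^ m) (2 ^ m) a b.
          ereal (1 / 2 * trace_norm (\<Lambda> (bi_power 2 2 m phi2) - \<rho>))) \<le> ereal \<epsilon>}"

definition ent_cost_seq ::
  "(real \<Rightarrow> op_class) \<Rightarrow> (nat \<Rightarrow> real) \<Rightarrow> nat \<Rightarrow> nat \<Rightarrow> complex mat \<Rightarrow> ereal" where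
  "ent_cost_seq F \<delta> a b \<rho> = Lim (at_right 0) (\<lambda>\<epsilon>.
     limsup (\<lambda>n. one_shot_cost (F (\<delta> n)) \<epsilon> (a ^ n) (b ^ n) (bi_power a b n \<rho>) / ereal (real n)))"

definition ent_cost :: "(real \<Rightarrow> op_class) \<Rightarrow> nat \<Rightarrow> nat \<Rightarrow> complex mat \<Rightarrow> ereal" where
  "ent_cost F a b \<rho> = ent_cost_seq F (\<lambda>_. 0) a b \<rho>"

definition asymp_ent_cost :: "(real \<Rightarrow> op_class) \<Rightarrow> nat \<Rightarrow> nat \<Rightarrow> complex mat \<Rightarrow> ereal" where
  "asymp_ent_cost F a b \<rho> =
     (INF \<delta> \<in> {\<delta>. (\<forall>n. \<delta> n \<ge> 0) \<and> \<delta> \<longlonglongrightarrow> 0}. ent_cost_seq F \<delta> a b \<rho>)"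

end

theory Submission
  imports Defs "HOL-Real_Asymp.Real_Asymp"
begin

text \<open>
  Let \<open>\<Lambda>\<close> be non-entangling on \<open>m\<close> ebits, \<open>K = 2 ^ m\<close>, and let \<open>\<omega>\<close>, \<open>\<tau>\<close> be the images of the maximally entangled
  state \<open>\<Phi>\<close> and of the isotropic state with overlap \<open>(K + 2) / (K (2K + 1))\<close>. The channel on \<open>m + 2\<close> ebits that
  measures \<open>{\<Phi>, 1 - \<Phi>}\<close> and prepares \<open>\<omega>\<close> or \<open>\<tau>\<close> is dually non-entangling: on separable states it acts as
  \<open>\<Lambda>\<close> on a separable isotropic state, and its adjoint maps separable states to isotropic operators below the
  separability threshold. So dual non-entanglement costs two ebits, which is invisible in the rate.

  If \<open>\<Lambda>\<close> is non-entangling, then \<open>\<Phi> \<le> K s\<close> with \<open>s\<close> separable gives \<open>\<Lambda> \<Phi> \<le> K (1 + \<delta>) s'\<close> with \<open>s'\<close> separable,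
  and a Fannes-type estimate turns this into \<open>D(\<rho>\<^sup>n \<parallel> S\<^sub>n) \<le> m + O(1 + \<epsilon> n)\<close>. Conversely, cutting \<open>\<rho>\<close> down to the
  typical eigenspaces of \<open>\<rho>\<close> and \<open>\<sigma>\<close> shows that measuring \<open>\<Phi>\<close> and preparing an approximation of \<open>\<rho>\<^sup>n\<close> or the block
  state \<open>\<sigma>\<close> achieves the rate \<open>D(\<rho>\<^sup>k \<parallel> \<sigma>) / k\<close> for every block length \<open>k\<close> and every separable \<open>\<sigma>\<close>. Both bounds
  together also yield the convergence of the regularised relative entropy, without Fekete's lemma.
\<close>

section \<open>Forms and orthonormal bases\<close>

text \<open>The dual and the primal condition pull in opposite directions. If the measured maximally
  entangled state \<Phi> has local dimension K', the adjoint sends a positive Y to the isotropic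
  operator with eigenvalues Tr(Y \<omega>) and Tr(Y \<tau>). This lies in the cone when Tr(Y
  \<omega>) \<le> (K' + 1) Tr(Y \<tau>), which is guaranteed once \<tau> is the image of an
  isotropic state with overlap p \<ge> 1 / (K' + 1). On the primal side a separable input has
  overlap x \<le> 1 / K', and the mixture of \<Phi> and that isotropic state has overlap x + (1 - x)
  p, which must not exceed 1 / K. For K' = K > 1 no p meets both demands; for K' = 4 K there is
  room. In the asymptotic part the robustness on n copies is taken to be 1 / (n + 1): it tends to
  zero, yet costs only about log(n + 1) further ebits. The rate of a fixed block rests on Tr
  \<rho>^(1+t) and Tr \<rho> \<sigma>^(-t) being multiplicative under tensor products, so that
  Markov's inequality makes the atypical weights decay exponentially.\<close>

definition ip :: "nat \<Rightarrow> (nat \<Rightarrow> complex) \<Rightarrow> (nat \<Rightarrow> complex) \<Rightarrow> complex" where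
  "ip d x y = (\<Sum>i<d. cnj (x i) * y i)"

definition qf :: "nat \<Rightarrow> complex mat \<Rightarrow> (nat \<Rightarrow> complex) \<Rightarrow> complex" where
  "qf d A x = (\<Sum>i<d. \<Sum>j<d. cnj (x i) * A $$ (i, j) * x j)"

text \<open>Completeness is recorded next to orthonormality so that sums over the basis can be
  collapsed directly; \<open>onbI\<close> derives it from orthonormality.\<close>

definition onb :: "nat \<Rightarrow> (nat \<Rightarrow> nat \<Rightarrow> complex) \<Rightarrow> bool" where
  "onb d u \<longleftrightarrow> (\<forall>i<d. \<forall>j<d. ip d (u i) (u j) = of_bool (i = j)) \<and>
     (\<forall>p<d. \<forall>q<d. (\<Sum>i<d. u i p * cnj (u i q)) = of_bool (p = q))"

text \<open>\<open>u i\<close> is an eigenvector for \<open>l i\<close>, with repetition by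
  multiplicity. Nothing canonical is chosen: different decompositions of one matrix are compared by
  \<open>spec_fun_unique\<close>.\<close>

definition spec :: "nat \<Rightarrow> complex mat \<Rightarrow> (nat \<Rightarrow> nat \<Rightarrow> complex) \<Rightarrow> (nat \<Rightarrow> real) \<Rightarrow> bool" where
  "spec d A u l \<longleftrightarrow> A \<in> carrier_mat d d \<and> onb d u \<and>
     (\<forall>p<d. \<forall>q<d. A $$ (p, q) = (\<Sum>i<d. complex_of_real (l i) * u i p * cnj (u i q)))"

lemma sum_of_bool_mult:
  fixes f :: "nat \<Rightarrow> 'a :: semiring_1"
  assumes "p < d"
  shows "(\<Sum>i<d. f i * of_bool (i = p)) = f p" "(\<Sum>i<d. f i * of_bool (p = i)) = f p"
    "(\<Sum>i<d. of_bool (i = p) * f i) = f p" "(\<Sum>i<d. of_bool (p = i) * f i) = f p"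
proof -
  have e: "(\<Sum>i<d. if i = p then f i else 0) = f p" using assms by (subst sum.delta) auto
  have "(\<Sum>i<d. f i * of_bool (i = p)) = (\<Sum>i<d. if i = p then f i else 0)"
    "(\<Sum>i<d. f i * of_bool (p = i)) = (\<Sum>i<d. if i = p then f i else 0)"
    "(\<Sum>i<d. of_bool (i = p) * f i) = (\<Sum>i<d. if i = p then f i else 0)"
    "(\<Sum>i<d. of_bool (p = i) * f i) = (\<Sum>i<d. if i = p then f i else 0)"
    by (auto intro!: sum.cong)
  with e show "(\<Sum>i<d. f i * of_bool (i = p)) = f p" "(\<Sum>i<d. f i * of_bool (p = i)) = f p"
    "(\<Sum>i<d. of_bool (i = p) * f i) = f p" "(\<Sum>i<d. of_bool (p = i) * f i) = f p"
    by simp_all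
qed

lemma sum_swap3: "(\<Sum>a\<in>A. \<Sum>b\<in>B. \<Sum>c\<in>C. f a b c) = (\<Sum>b\<in>B. \<Sum>c\<in>C. \<Sum>a\<in>A. f a b c)"
proof -
  have "(\<Sum>a\<in>A. \<Sum>b\<in>B. \<Sum>c\<in>C. f a b c) = (\<Sum>b\<in>B. \<Sum>a\<in>A. \<Sum>c\<in>C. f a b c)"
    by (rule sum.swap)
  also have "\<dots> = (\<Sum>b\<in>B. \<Sum>c\<in>C. \<Sum>a\<in>A. f a b c)"
    by (rule sum.cong[OF refl], rule sum.swap)
  finally show ?thesis .
qed

lemma sum_swap4:
  "(\<Sum>a\<in>A. \<Sum>b\<in>B. \<Sum>c\<in>C. \<Sum>d\<in>D. f a b c d) = (\<Sum>c\<in>C. \<Sum>d\<in>D. \<Sum>a\<in>A. \<Sum>b\<in>B. f a b c d)"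
proof -
  have "(\<Sum>a\<in>A. \<Sum>b\<in>B. \<Sum>c\<in>C. \<Sum>d\<in>D. f a b c d) = (\<Sum>a\<in>A. \<Sum>c\<in>C. \<Sum>d\<in>D. \<Sum>b\<in>B. f a b c d)"
    by (rule sum.cong[OF refl], rule sum_swap3)
  also have "\<dots> = (\<Sum>c\<in>C. \<Sum>d\<in>D. \<Sum>a\<in>A. \<Sum>b\<in>B. f a b c d)" by (rule sum_swap3)
  finally show ?thesis .
qed

text \<open>With the vectors as columns of a square matrix, orthonormality gives a left inverse,
  which is then also a right inverse; the latter is completeness.\<close>

lemma onbI:
  assumes "\<And>i j. i < d \<Longrightarrow> j < d \<Longrightarrow> ip d (u i) (u j) = of_bool (i = j)"
  shows "onb d u"
proof -
  define U where "U = mat d d (\<lambda>(p, i). u i p)"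
  define V where "V = mat d d (\<lambda>(i, q). cnj (u i q))"
  have c: "U \<in> carrier_mat d d" "V \<in> carrier_mat d d" by (auto simp: U_def V_def)
  have "V * U = 1\<^sub>m d"
  proof (rule eq_matI)
    fix i j assume "i < dim_row (1\<^sub>m d :: complex mat)" "j < dim_col (1\<^sub>m d :: complex mat)"
    then have ij: "i < d" "j < d" by auto
    then have "(V * U) $$ (i, j) = (\<Sum>p<d. cnj (u i p) * u j p)"
      by (simp add: U_def V_def scalar_prod_def atLeast0LessThan)
    also have "\<dots> = of_bool (i = j)" using assms[OF ij] by (simp add: ip_def)
    finally show "(V * U) $$ (i, j) = 1\<^sub>m d $$ (i, j)" using ij by simp
  qed (auto simp: U_def V_def)
  then have UV: "U * V = 1\<^sub>m d" using c mat_mult_left_right_inverse by blast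
  have "(\<Sum>i<d. u i p * cnj (u i q)) = of_bool (p = q)" if "p < d" "q < d" for p q
  proof -
    have "(U * V) $$ (p, q) = (\<Sum>i<d. u i p * cnj (u i q))"
      using that by (simp add: U_def V_def scalar_prod_def atLeast0LessThan)
    then show ?thesis using UV that by (simp add: of_bool_def)
  qed
  then show ?thesis using assms by (simp add: onb_def)
qed

lemma ip_cnj: "cnj (ip d x y) = ip d y x"
  by (simp add: ip_def mult.commute)

lemma ip_self: "ip d x x = complex_of_real (\<Sum>i<d. (cmod (x i))\<^sup>2)"
  unfolding ip_def of_real_sum
  by (intro sum.cong refl) (metis complex_norm_square mult.commute)

section \<open>Spectral theorem\<close>

text \<open>An eigenvalue exists by the fundamental theorem of algebra applied to the characteristic
  polynomial. The extra normalisation of the first coordinate prepares the reflection in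
  \<open>householder\<close>.\<close>

lemma hermitian_eigenvector:
  fixes a :: "nat \<Rightarrow> nat \<Rightarrow> complex"
  assumes "n > 0" "\<And>p q. p < n \<Longrightarrow> q < n \<Longrightarrow> a p q = cnj (a q p)"
  obtains w e t where "\<And>p. p < n \<Longrightarrow> (\<Sum>q<n. a p q * w q) = complex_of_real e * w p"
    "ip n w w = 1" "w 0 = complex_of_real t" "t \<le> 0"
proof -
  define A where "A = mat n n (\<lambda>(p, q). a p q)"
  have ac: "cnj (a p q) = a q p" if "p < n" "q < n" for p q using assms(2)[OF that(2,1)] by simp
  have A: "A \<in> carrier_mat n n" by (simp add: A_def)
  have "degree (char_poly A) = n" using degree_monic_char_poly[OF A] by simp
  then have "\<not> constant (poly (char_poly A))" using assms(1)
    by (simp add: constant_degree)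
  then obtain e where "poly (char_poly A) e = 0"
    using fundamental_theorem_of_algebra by blast
  then have "eigenvalue A e" using eigenvalue_root_char_poly[OF A] by simp
  then obtain v where v: "v \<in> carrier_vec n" "v \<noteq> 0\<^sub>v n" "A *\<^sub>v v = e \<cdot>\<^sub>v v"
    using A by (auto simp: eigenvalue_def eigenvector_def)
  define N where "N = (\<Sum>i<n. (cmod (v $ i))\<^sup>2)"
  have Av: "(\<Sum>q<n. a p q * v $ q) = e * v $ p" if "p < n" for p
  proof -
    have "(A *\<^sub>v v) $ p = (\<Sum>q<n. a p q * v $ q)"
      using that v(1) by (simp add: A_def scalar_prod_def atLeast0LessThan)
    moreover have "(A *\<^sub>v v) $ p = e * v $ p" unfolding v(3) using v(1) that by simp
    ultimately show ?thesis by metis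
  qed
  have "N > 0"
  proof (rule ccontr)
    assume "\<not> N > 0"
    moreover have "N \<ge> 0" unfolding N_def by (rule sum_nonneg) auto
    ultimately have "N = 0" by simp
    then have "\<forall>i\<in>{..<n}. (cmod (v $ i))\<^sup>2 = 0"
      unfolding N_def by (subst (asm) sum_nonneg_eq_0_iff) auto
    then have "v = 0\<^sub>v n" using v(1) by (intro eq_vecI) auto
    with v show False by simp
  qed
  \<comment> \<open>The phase turns \<open>v $ 0\<close> into minus its modulus, so that the number
    \<open>1 - t\<close> used later is at least 1.\<close>
  define ph where "ph = (if v $ 0 = 0 then 1 else - cnj (v $ 0) / of_real (cmod (v $ 0)))"
  have ph: "cmod ph = 1" by (simp add: ph_def norm_divide)
  have ph0: "ph * v $ 0 = complex_of_real (- cmod (v $ 0))"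
  proof (cases "v $ 0 = 0")
    case False
    have "cnj (v $ 0) * v $ 0 = (complex_of_real (cmod (v $ 0)))\<^sup>2"
      by (metis complex_norm_square mult.commute of_real_power)
    then show ?thesis using False by (simp add: ph_def power2_eq_square)
  qed (simp add: ph_def)
  define w where "w p = ph / sqrt N * v $ p" for p
  have w1: "(\<Sum>q<n. a p q * w q) = e * w p" if "p < n" for p
  proof -
    have "(\<Sum>q<n. a p q * w q) = ph / sqrt N * (\<Sum>q<n. a p q * v $ q)"
      unfolding w_def sum_distrib_left by (intro sum.cong refl) (simp only: mult_ac)
    then show ?thesis unfolding Av[OF that] by (simp add: w_def)
  qed
  have "(cmod (w i))\<^sup>2 = (cmod (v $ i))\<^sup>2 / N" for i
    using \<open>N > 0\<close> by (simp add: w_def norm_mult norm_divide ph power_mult_distrib power_divide)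
  then have "(\<Sum>i<n. (cmod (w i))\<^sup>2) = 1"
    using \<open>N > 0\<close> by (simp add: sum_divide_distrib[symmetric] N_def[symmetric])
  then have w2: "ip n w w = 1" by (simp add: ip_self)
  have w3: "w 0 = complex_of_real (- cmod (v $ 0) / sqrt N)"
    using ph0 by (simp add: w_def)
  \<comment> \<open>The eigenvalue equals the quadratic form of \<open>a\<close> at the unit vector
    \<open>w\<close>, which is invariant under conjugation; hence \<open>e\<close> is real.\<close>
  have "e = (\<Sum>p<n. cnj (w p) * (\<Sum>q<n. a p q * w q))"
  proof -
    have "(\<Sum>p<n. cnj (w p) * (\<Sum>q<n. a p q * w q)) = (\<Sum>p<n. e * (cnj (w p) * w p))"
      by (intro sum.cong refl, subst w1) (simp_all only: lessThan_iff mult_ac)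
    also have "\<dots> = e * ip n w w" by (simp only: sum_distrib_left[symmetric] ip_def)
    finally show ?thesis by (simp add: w2)
  qed
  then have e1: "e = (\<Sum>p<n. \<Sum>q<n. cnj (w p) * a p q * w q)"
    by (simp add: sum_distrib_left mult.assoc)
  then have "cnj e = (\<Sum>p<n. \<Sum>q<n. w p * cnj (a p q) * cnj (w q))" by simp
  also have "\<dots> = (\<Sum>p<n. \<Sum>q<n. w p * a q p * cnj (w q))"
    by (intro sum.cong refl) (simp add: ac)
  also have "\<dots> = e" unfolding e1
    by (subst sum.swap, intro sum.cong refl) (simp only: mult_ac)
  finally have "Im e = 0" by (simp add: complex_eq_iff)
  then have "e = complex_of_real (Re e)" by (simp add: complex_eq_iff)
  then show ?thesis using that[of w "Re e" "- cmod (v $ 0) / sqrt N"] w1 w2 w3 \<open>N > 0\<close> by simp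
qed

text \<open>This is the Householder reflection \<open>1 - 2 z z^* / |z|^2\<close> along
  \<open>z = e_0 - w\<close>. Both vectors are unit and \<open>w 0\<close> is real, so it exchanges
  them; \<open>t \<le> 0\<close> keeps \<open>z\<close> nonzero.\<close>

lemma householder:
  assumes "n > 0" "ip n w w = 1" "w 0 = complex_of_real t" "t \<le> 0"
  obtains H where "\<And>p q. H p q = cnj (H q p)" "\<And>p. p < n \<Longrightarrow> H p 0 = w p"
    "\<And>p q. p < n \<Longrightarrow> q < n \<Longrightarrow> (\<Sum>r<n. H p r * H r q) = of_bool (p = q)"
proof -
  define z where "z p = of_bool (p = 0) - w p" for p :: nat
  \<comment> \<open>\<open>c = 2 / |z|^2\<close>, because \<open>|z|^2 = 2 (1 - t)\<close>, shown
    below as \<open>zz\<close>.\<close>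
  define c where "c = complex_of_real (1 / (1 - t))"
  have t: "1 - t > 0" using assms(4) by simp
  have c: "c * (1 - complex_of_real t) = 1"
  proof -
    have "c * (1 - complex_of_real t) = complex_of_real (1 / (1 - t) * (1 - t))"
      unfolding c_def of_real_mult of_real_diff of_real_1 ..
    then show ?thesis using t by simp
  qed
  have z0: "z 0 = 1 - complex_of_real t" by (simp add: z_def assms(3))
  have "ip n z z = (\<Sum>p<n. of_bool (p = 0) - of_bool (p = 0) * w p - cnj (w p) * of_bool (p = 0) + cnj (w p) * w p)"
    unfolding ip_def z_def by (intro sum.cong refl) (simp add: algebra_simps)
  also have "\<dots> = (\<Sum>p<n. of_bool (p = 0)) - w 0 - cnj (w 0) + ip n w w"
    by (simp add: sum.distrib sum_subtractf ip_def sum_of_bool_mult[OF assms(1)])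
  also have "(\<Sum>p<n. of_bool (p = 0)) = (1 :: complex)"
    using sum_of_bool_mult(1)[OF assms(1), of "\<lambda>_. 1 :: complex"] by simp
  finally have zz: "ip n z z = 2 * (1 - complex_of_real t)" using assms(2,3) by simp
  define H where "H p q = of_bool (p = q) - c * z p * cnj (z q)" for p q
  show ?thesis
  proof
    show "H p q = cnj (H q p)" for p q by (cases "p = q") (auto simp: H_def c_def)
    show "H p 0 = w p" if "p < n" for p
    proof -
      have "H p 0 = of_bool (p = 0) - (c * (1 - complex_of_real t)) * z p"
        by (simp add: H_def z0 mult_ac)
      then show ?thesis unfolding c by (simp add: z_def)
    qed
    show "(\<Sum>r<n. H p r * H r q) = of_bool (p = q)" if "p < n" "q < n" for p q
    proof -
      have "(\<Sum>r<n. H p r * H r q) = (\<Sum>r<n. of_bool (p = r) * of_bool (r = q)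
           - of_bool (p = r) * (c * z r * cnj (z q)) - (c * z p * cnj (z r)) * of_bool (r = q)
           + c * c * z p * cnj (z q) * (cnj (z r) * z r))"
      proof (intro sum.cong refl)
        fix r
        have "(x - y) * (x' - y') = x * x' - x * y' - y * x' + y * y'" for x y x' y' :: complex
          by (simp add: algebra_simps)
        then show "H p r * H r q = of_bool (p = r) * of_bool (r = q)
           - of_bool (p = r) * (c * z r * cnj (z q)) - (c * z p * cnj (z r)) * of_bool (r = q)
           + c * c * z p * cnj (z q) * (cnj (z r) * z r)"
          unfolding H_def by (simp only: mult_ac)
      qed
      also have "\<dots> = of_bool (p = q) - c * z p * cnj (z q) - c * z p * cnj (z q)
           + c * c * z p * cnj (z q) * ip n z z"
        using that by (simp only: sum.distrib sum_subtractf sum_of_bool_mult ip_def sum_distrib_left)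
      also have "\<dots> = of_bool (p = q) - 2 * c * z p * cnj (z q)
           + 2 * (c * (1 - complex_of_real t)) * c * z p * cnj (z q)" 
      proof -
        have "c * c * z p * cnj (z q) * (2 * (1 - complex_of_real t))
            = 2 * (c * (1 - complex_of_real t)) * c * z p * cnj (z q)"
          by (simp only: mult_ac)
        then show ?thesis unfolding zz by simp
      qed
      finally show ?thesis unfolding c by simp
    qed
  qed
qed

text \<open>Deflation: conjugating by a reflection that sends the first basis vector to an
  eigenvector splits off a one-dimensional block, and the induction hypothesis diagonalises the
  rest.\<close>

lemma spectral_theorem_fun:
  fixes a :: "nat \<Rightarrow> nat \<Rightarrow> complex"
  assumes "\<And>p q. p < n \<Longrightarrow> q < n \<Longrightarrow> a p q = cnj (a q p)"
  shows "\<exists>u l. onb n u \<and> (\<forall>p<n. \<forall>q<n. a p q = (\<Sum>i<n. complex_of_real (l i) * u i p * cnj (u i q)))"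
  using assms
proof (induction n arbitrary: a)
  case 0
  show ?case by (auto simp: onb_def)
next
  case (Suc n a)
  let ?N = "Suc n"
  obtain w e t where w: "\<And>p. p < ?N \<Longrightarrow> (\<Sum>q<?N. a p q * w q) = complex_of_real e * w p"
    "ip ?N w w = 1" "w 0 = complex_of_real t" "t \<le> 0"
    using hermitian_eigenvector[of ?N a] Suc.prems by blast
  obtain H where H: "\<And>p q. H p q = cnj (H q p)" "\<And>p. p < ?N \<Longrightarrow> H p 0 = w p"
    "\<And>p q. p < ?N \<Longrightarrow> q < ?N \<Longrightarrow> (\<Sum>r<?N. H p r * H r q) = of_bool (p = q)"
    using householder[OF zero_less_Suc w(2-4)] by blast
  have Hc: "cnj (H p q) = H q p" for p q using H(1)[of q p] by simp
  have ac: "cnj (a p q) = a q p" if "p < ?N" "q < ?N" for p q using Suc.prems[OF that(2,1)] by simp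
  define B where "B p q = (\<Sum>r<?N. \<Sum>s<?N. H p r * a r s * H s q)" for p q
  have Bh: "B p q = cnj (B q p)" if "p < ?N" "q < ?N" for p q
  proof -
    have "cnj (B q p) = (\<Sum>r<?N. \<Sum>s<?N. H r q * cnj (a r s) * H p s)"
      unfolding B_def cnj_sum complex_cnj_mult Hc ..
    also have "\<dots> = (\<Sum>r<?N. \<Sum>s<?N. H r q * a s r * H p s)"
      by (intro sum.cong refl) (simp add: ac)
    also have "\<dots> = B p q" unfolding B_def by (subst sum.swap, intro sum.cong refl) (simp only: mult_ac)
    finally show ?thesis by simp
  qed
  have B0: "B p 0 = of_bool (p = 0) * complex_of_real e" if "p < ?N" for p
  proof -
    have "B p 0 = (\<Sum>r<?N. H p r * (\<Sum>s<?N. a r s * w s))"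
      unfolding B_def sum_distrib_left by (intro sum.cong refl) (simp add: H(2) mult.assoc)
    also have "\<dots> = (\<Sum>r<?N. H p r * H r 0) * complex_of_real e"
      unfolding sum_distrib_right
      by (intro sum.cong refl) (simp only: H(2) w(1) lessThan_iff, simp only: mult_ac)
    finally show ?thesis using H(3)[OF that zero_less_Suc] by simp
  qed
  have "\<exists>u l. onb n u \<and> (\<forall>p<n. \<forall>q<n. B (Suc p) (Suc q) = (\<Sum>i<n. complex_of_real (l i) * u i p * cnj (u i q)))"
    by (rule Suc.IH, rule Bh) simp_all
  then obtain u l where u: "onb n u"
    "\<And>p q. p < n \<Longrightarrow> q < n \<Longrightarrow> B (Suc p) (Suc q) = (\<Sum>i<n. complex_of_real (l i) * u i p * cnj (u i q))"
    by blast
  \<comment> \<open>The eigenvectors of the lower block are shifted by one index and padded with 0;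
    the split block contributes the first unit vector.\<close>
  define y where "y i p = (case i of 0 \<Rightarrow> of_bool (p = 0) | Suc j \<Rightarrow> (case p of 0 \<Rightarrow> 0 | Suc r \<Rightarrow> u j r))"
    for i p :: nat
  define m where "m i = (case i of 0 \<Rightarrow> e | Suc j \<Rightarrow> l j)" for i :: nat
  have y[simp]: "y 0 p = of_bool (p = 0)" "y (Suc j) 0 = 0" "y (Suc j) (Suc r) = u j r"
    "m 0 = e" "m (Suc j) = l j" for p j r
    by (auto simp: y_def m_def)
  have y1: "ip ?N (y i) (y j) = of_bool (i = j)" if "i < ?N" "j < ?N" for i j
  proof -
    have e: "ip ?N (y i) (y j) = cnj (y i 0) * y j 0 + (\<Sum>p<n. cnj (y i (Suc p)) * y j (Suc p))"
      unfolding ip_def by (rule sum.lessThan_Suc_shift)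
    show ?thesis unfolding e using that u(1)
      by (cases i; cases j; simp add: onb_def ip_def)
  qed
  have y2: "B p q = (\<Sum>i<?N. complex_of_real (m i) * y i p * cnj (y i q))" if "p < ?N" "q < ?N" for p q
  proof -
    have e: "(\<Sum>i<?N. complex_of_real (m i) * y i p * cnj (y i q)) = complex_of_real e * of_bool (p = 0) * of_bool (q = 0)
      + (\<Sum>i<n. complex_of_real (l i) * y (Suc i) p * cnj (y (Suc i) q))"
      by (subst sum.lessThan_Suc_shift) simp
    show ?thesis
  proof (cases p)
    case 0
    then have "B p q = cnj (B q 0)" using Bh[of p q] that by simp
    then show ?thesis unfolding e B0[OF that(2)] using 0 by (cases q) simp_all
  next
    case (Suc p')
    show ?thesis
    proof (cases q)
      case 0
      then show ?thesis unfolding e using Suc B0[OF that(1)] by simp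
    next
      case (Suc q')
      then show ?thesis unfolding e using \<open>p = Suc p'\<close> u(2)[of p' q'] that by simp
    qed
  qed
  qed
  \<comment> \<open>The reflection is its own inverse, so applying \<open>H\<close> carries the
    eigenbasis of \<open>B\<close> back to one of \<open>a\<close>.\<close>
  define x where "x i p = (\<Sum>r<?N. H p r * y i r)" for i p
  have x1: "ip ?N (x i) (x j) = of_bool (i = j)" if "i < ?N" "j < ?N" for i j
  proof -
    have "ip ?N (x i) (x j) = (\<Sum>p<?N. (\<Sum>r<?N. H r p * cnj (y i r)) * (\<Sum>s<?N. H p s * y j s))"
      unfolding ip_def x_def cnj_sum complex_cnj_mult Hc ..
    also have "\<dots> = (\<Sum>p<?N. \<Sum>r<?N. \<Sum>s<?N. cnj (y i r) * y j s * (H r p * H p s))"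
      unfolding sum_product by (intro sum.cong refl) (simp only: mult_ac)
    also have "\<dots> = (\<Sum>r<?N. \<Sum>s<?N. \<Sum>p<?N. cnj (y i r) * y j s * (H r p * H p s))"
      by (rule sum_swap3)
    also have "\<dots> = (\<Sum>r<?N. \<Sum>s<?N. cnj (y i r) * y j s * of_bool (r = s))"
      unfolding sum_distrib_left[symmetric] by (intro sum.cong refl) (simp add: H(3) del: sum.lessThan_Suc)
    also have "\<dots> = (\<Sum>r<?N. cnj (y i r) * y j r)"
      by (intro sum.cong refl sum_of_bool_mult(2)) auto
    finally show ?thesis using y1[OF that] by (simp add: ip_def del: sum.lessThan_Suc)
  qed
  have x2: "a p q = (\<Sum>i<?N. complex_of_real (m i) * x i p * cnj (x i q))" if pq: "p < ?N" "q < ?N" for p q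
  proof -
    have "(\<Sum>i<?N. complex_of_real (m i) * x i p * cnj (x i q))
      = (\<Sum>i<?N. complex_of_real (m i) * ((\<Sum>r<?N. H p r * y i r) * (\<Sum>s<?N. H s q * cnj (y i s))))"
      unfolding x_def cnj_sum complex_cnj_mult Hc mult.assoc ..
    also have "\<dots> = (\<Sum>i<?N. \<Sum>r<?N. \<Sum>s<?N. H p r * H s q * (complex_of_real (m i) * y i r * cnj (y i s)))"
      unfolding sum_product unfolding sum_distrib_left by (intro sum.cong refl) (simp only: mult_ac)
    also have "\<dots> = (\<Sum>r<?N. \<Sum>s<?N. \<Sum>i<?N. H p r * H s q * (complex_of_real (m i) * y i r * cnj (y i s)))"
      by (rule sum_swap3)
    also have "\<dots> = (\<Sum>r<?N. \<Sum>s<?N. H p r * H s q * B r s)"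
      unfolding sum_distrib_left[symmetric] by (intro sum.cong refl) (simp add: y2 del: sum.lessThan_Suc)
    also have "\<dots> = (\<Sum>r<?N. \<Sum>s<?N. \<Sum>k<?N. \<Sum>j<?N. a k j * (H p r * H r k) * (H j s * H s q))"
      unfolding B_def sum_distrib_left by (intro sum.cong refl) (simp only: mult_ac)
    also have "\<dots> = (\<Sum>k<?N. \<Sum>j<?N. \<Sum>r<?N. \<Sum>s<?N. a k j * (H p r * H r k) * (H j s * H s q))"
      by (rule sum_swap4)
    also have "\<dots> = (\<Sum>k<?N. \<Sum>j<?N. a k j * ((\<Sum>r<?N. H p r * H r k) * (\<Sum>s<?N. H j s * H s q)))"
      unfolding sum_product unfolding sum_distrib_left by (intro sum.cong refl) (simp only: mult_ac)
    also have "\<dots> = (\<Sum>k<?N. \<Sum>j<?N. a k j * of_bool (p = k) * of_bool (j = q))"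
      by (intro sum.cong refl) (simp add: H(3) pq del: sum.lessThan_Suc)
    also have "\<dots> = (\<Sum>k<?N. a k q * of_bool (p = k))"
      using pq by (intro sum.cong refl sum_of_bool_mult(1))
    also have "\<dots> = a p q" by (rule sum_of_bool_mult(2)[OF pq(1), of "\<lambda>k. a k q"])
    finally show ?thesis by simp
  qed
  show ?case by (intro exI[of _ x] exI[of _ m] conjI allI impI onbI x1 x2)
qed

lemma spectral_theorem:
  assumes "A \<in> carrier_mat d d" "\<And>p q. p < d \<Longrightarrow> q < d \<Longrightarrow> A $$ (p, q) = cnj (A $$ (q, p))"
  obtains u l where "spec d A u l"
proof -
  have "\<exists>u l. onb d u \<and> (\<forall>p<d. \<forall>q<d. A $$ (p, q) = (\<Sum>i<d. complex_of_real (l i) * u i p * cnj (u i q)))"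
    by (rule spectral_theorem_fun) (rule assms(2))
  then obtain u l where "onb d u" "\<forall>p<d. \<forall>q<d. A $$ (p, q) = (\<Sum>i<d. complex_of_real (l i) * u i p * cnj (u i q))"
    by (elim exE conjE)
  then have "spec d A u l" using assms(1) by (simp add: spec_def)
  then show ?thesis by (rule that)
qed

section \<open>Spectral calculus\<close>

definition bf :: "nat \<Rightarrow> complex mat \<Rightarrow> (nat \<Rightarrow> complex) \<Rightarrow> (nat \<Rightarrow> complex) \<Rightarrow> complex" where
  "bf d A x y = (\<Sum>i<d. \<Sum>j<d. cnj (x i) * A $$ (i, j) * y j)"

lemma qf_bf: "qf d A x = bf d A x x"
  by (simp add: qf_def bf_def)

lemma bf_add_left: "bf d A (\<lambda>i. x i + y i) z = bf d A x z + bf d A y z"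
  by (simp add: bf_def algebra_simps sum.distrib)

lemma bf_add_right: "bf d A z (\<lambda>i. x i + y i) = bf d A z x + bf d A z y"
  by (simp add: bf_def algebra_simps sum.distrib)

lemma bf_scale_left: "bf d A (\<lambda>i. c * x i) y = cnj c * bf d A x y"
  by (simp add: bf_def sum_distrib_left mult_ac)

lemma bf_scale_right: "bf d A x (\<lambda>i. c * y i) = c * bf d A x y"
  by (simp add: bf_def sum_distrib_left mult_ac)

lemma bf_unit:
  assumes "p < d" "q < d"
  shows "bf d A (\<lambda>i. of_bool (i = p)) (\<lambda>i. of_bool (i = q)) = A $$ (p, q)"
proof -
  have "bf d A (\<lambda>i. of_bool (i = p)) (\<lambda>i. of_bool (i = q))
      = (\<Sum>i<d. of_bool (i = p) * (\<Sum>j<d. A $$ (i, j) * of_bool (j = q)))"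
    unfolding bf_def sum_distrib_left by (intro sum.cong refl) (simp add: of_bool_def)
  then show ?thesis using assms by (simp only: sum_of_bool_mult)
qed

lemma qf_add:
  assumes "A \<in> carrier_mat d d" "B \<in> carrier_mat d d"
  shows "qf d (A + B) x = qf d A x + qf d B x"
proof -
  have "qf d (A + B) x = (\<Sum>i<d. \<Sum>j<d. cnj (x i) * A $$ (i, j) * x j + cnj (x i) * B $$ (i, j) * x j)"
    unfolding qf_def using assms by (intro sum.cong refl) (simp add: algebra_simps)
  then show ?thesis by (simp add: qf_def sum.distrib)
qed

lemma qf_minus:
  assumes "A \<in> carrier_mat d d" "B \<in> carrier_mat d d"
  shows "qf d (A - B) x = qf d A x - qf d B x"
proof -
  have "qf d (A - B) x = (\<Sum>i<d. \<Sum>j<d. cnj (x i) * A $$ (i, j) * x j - cnj (x i) * B $$ (i, j) * x j)"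
    unfolding qf_def using assms by (intro sum.cong refl) (simp add: algebra_simps)
  then show ?thesis by (simp add: qf_def sum_subtractf)
qed

lemma qf_smult:
  assumes "A \<in> carrier_mat d d"
  shows "qf d (c \<cdot>\<^sub>m A) x = c * qf d A x"
proof -
  have "qf d (c \<cdot>\<^sub>m A) x = (\<Sum>i<d. \<Sum>j<d. c * (cnj (x i) * A $$ (i, j) * x j))"
    unfolding qf_def using assms by (intro sum.cong refl) (simp add: algebra_simps)
  then show ?thesis by (simp add: qf_def sum_distrib_left)
qed

lemma qf_mat_sum:
  "qf d (mat d d (\<lambda>(i, j). \<Sum>k\<in>K. c k * B k $$ (i, j))) x = (\<Sum>k\<in>K. c k * qf d (B k) x)"
proof -
  have "qf d (mat d d (\<lambda>(i, j). \<Sum>k\<in>K. c k * B k $$ (i, j))) x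
    = (\<Sum>i<d. \<Sum>j<d. \<Sum>k\<in>K. c k * (cnj (x i) * B k $$ (i, j) * x j))"
    unfolding qf_def by (intro sum.cong refl) (simp add: sum_distrib_left sum_distrib_right mult_ac)
  also have "\<dots> = (\<Sum>k\<in>K. \<Sum>i<d. \<Sum>j<d. c k * (cnj (x i) * B k $$ (i, j) * x j))"
    by (rule sum_swap3[symmetric])
  finally show ?thesis by (simp add: qf_def sum_distrib_left)
qed

lemma qf_one: "qf d (1\<^sub>m d) x = complex_of_real (\<Sum>i<d. (cmod (x i))\<^sup>2)"
proof -
  have "qf d (1\<^sub>m d) x = (\<Sum>i<d. cnj (x i) * (\<Sum>j<d. of_bool (i = j) * x j))"
    unfolding qf_def sum_distrib_left by (intro sum.cong refl) (simp add: of_bool_def)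
  also have "\<dots> = ip d x x" by (simp add: sum_of_bool_mult ip_def)
  finally show ?thesis by (simp add: ip_self)
qed

text \<open>\<open>qf\<close> reads only the first \<open>d\<close> values of a function, so
  functions can stand in for vectors of fixed dimension in most of what follows.\<close>

lemma psd_iff:
  "psd d A \<longleftrightarrow> A \<in> carrier_mat d d \<and> (\<forall>x. Im (qf d A x) = 0 \<and> 0 \<le> Re (qf d A x))"
proof -
  have e: "(A *\<^sub>v v) \<bullet>c v = qf d A (\<lambda>i. v $ i)" if "A \<in> carrier_mat d d" "v \<in> carrier_vec d" for v
  proof -
    have "(A *\<^sub>v v) \<bullet>c v = (\<Sum>i<d. (\<Sum>j<d. A $$ (i, j) * v $ j) * cnj (v $ i))"
      using that by (simp add: scalar_prod_def atLeast0LessThan)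
    then show ?thesis by (simp add: qf_def sum_distrib_left sum_distrib_right mult_ac)
  qed
  have "qf d A x = qf d A (\<lambda>i. vec d x $ i)" for x by (simp add: qf_def)
  then have "(\<forall>v\<in>carrier_vec d. P (qf d A (\<lambda>i. v $ i))) \<longleftrightarrow> (\<forall>x. P (qf d A x))" for P
    by (metis vec_carrier)
  from this[of "\<lambda>c. Im c = 0 \<and> 0 \<le> Re c"] show ?thesis
    unfolding psd_def using e by auto
qed

lemma psdI:
  assumes "A \<in> carrier_mat d d" "\<And>x. \<exists>r\<ge>0. qf d A x = complex_of_real r"
  shows "psd d A"
  unfolding psd_iff using assms by (metis Im_complex_of_real Re_complex_of_real)

lemma psd_carrier: "psd d A \<Longrightarrow> A \<in> carrier_mat d d" by (simp add: psd_def)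

lemma psd_qf: "psd d A \<Longrightarrow> qf d A x = complex_of_real (Re (qf d A x))" "psd d A \<Longrightarrow> 0 \<le> Re (qf d A x)"
  by (auto simp: psd_iff complex_eq_iff)

text \<open>Polarisation: the forms at \<open>e p + e q\<close> and \<open>e p + \<i> * e q\<close>
  control the imaginary and the real parts of the off-diagonal entries. Positivity is defined
  through the form alone, so Hermiticity has to be extracted in this way.\<close>

lemma real_qf_hermitian:
  assumes "\<And>x. Im (qf d A x) = 0" "p < d" "q < d"
  shows "A $$ (p, q) = cnj (A $$ (q, p))"
proof -
  define e where "e r = (\<lambda>i::nat. of_bool (i = r) :: complex)" for r
  have b: "bf d A (e r) (e s) = A $$ (r, s)" if "r < d" "s < d" for r s
    unfolding e_def using bf_unit[OF that] .
  have *: "qf d A (\<lambda>i. e p i + c * e q i) = A $$ (p, p) + c * A $$ (p, q) + cnj c * A $$ (q, p) + cnj c * c * A $$ (q, q)" for c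
    using assms(2,3) by (simp add: qf_bf bf_add_left bf_add_right bf_scale_left bf_scale_right b algebra_simps)
  have d: "Im (A $$ (r, r)) = 0" if "r < d" for r
    using assms(1)[of "e r"] b[OF that that] by (simp add: qf_bf)
  have "Im (A $$ (p, q)) + Im (A $$ (q, p)) = 0"
    using assms(1)[of "\<lambda>i. e p i + 1 * e q i"] d assms(2,3) unfolding * by simp
  moreover have "Re (A $$ (p, q)) - Re (A $$ (q, p)) = 0"
    using assms(1)[of "\<lambda>i. e p i + \<i> * e q i"] d assms(2,3) unfolding * by simp
  ultimately show ?thesis by (simp add: complex_eq_iff)
qed

lemma real_qf_spec:
  assumes "A \<in> carrier_mat d d" "\<And>x. Im (qf d A x) = 0"
  obtains u l where "spec d A u l"
  by (rule spectral_theorem[OF assms(1)], rule real_qf_hermitian[OF assms(2)])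

lemma spec_bf:
  assumes "spec d A u l"
  shows "bf d A x y = (\<Sum>i<d. complex_of_real (l i) * ip d x (u i) * ip d (u i) y)"
proof -
  have "bf d A x y = (\<Sum>p<d. \<Sum>q<d. \<Sum>i<d. complex_of_real (l i) * ((cnj (x p) * u i p) * (cnj (u i q) * y q)))"
    unfolding bf_def using assms
    by (intro sum.cong refl) (simp add: spec_def sum_distrib_left sum_distrib_right mult_ac)
  also have "\<dots> = (\<Sum>i<d. \<Sum>p<d. \<Sum>q<d. complex_of_real (l i) * ((cnj (x p) * u i p) * (cnj (u i q) * y q)))"
    by (rule sum_swap3[symmetric])
  also have "\<dots> = (\<Sum>i<d. complex_of_real (l i) * (ip d x (u i) * ip d (u i) y))"
    unfolding ip_def sum_product unfolding sum_distrib_left ..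
  finally show ?thesis by (simp add: mult.assoc)
qed

lemma ip_mult_cnj: "ip d x y * ip d y x = complex_of_real ((cmod (ip d y x))\<^sup>2)"
  by (metis complex_norm_square ip_cnj mult.commute)

lemma spec_qf:
  assumes "spec d A u l"
  shows "qf d A x = complex_of_real (\<Sum>i<d. l i * (cmod (ip d (u i) x))\<^sup>2)"
  unfolding qf_bf spec_bf[OF assms] of_real_sum
  by (intro sum.cong refl) (simp only: mult.assoc ip_mult_cnj of_real_mult)

lemma cmod_ip_commute: "cmod (ip d x y) = cmod (ip d y x)"
  by (metis complex_mod_cnj ip_cnj)

lemma mat_mult_index:
  assumes "A \<in> carrier_mat n m" "B \<in> carrier_mat m k" "i < n" "j < k"
  shows "(A * B) $$ (i, j) = (\<Sum>r<m. A $$ (i, r) * B $$ (r, j))"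
  using assms by (simp add: scalar_prod_def atLeast0LessThan)

lemma onb_ip: "onb d u \<Longrightarrow> i < d \<Longrightarrow> j < d \<Longrightarrow> ip d (u i) (u j) = of_bool (i = j)"
  by (simp add: onb_def)

lemma onb_expand:
  assumes "onb d u" "p < d"
  shows "(\<Sum>i<d. u i p * ip d (u i) x) = x p"
proof -
  have "(\<Sum>i<d. u i p * ip d (u i) x) = (\<Sum>q<d. (\<Sum>i<d. u i p * cnj (u i q)) * x q)"
    unfolding ip_def sum_distrib_left sum_distrib_right
    by (subst sum.swap) (simp only: mult.assoc)
  also have "\<dots> = (\<Sum>q<d. of_bool (p = q) * x q)"
    using assms by (intro sum.cong refl) (simp add: onb_def)
  finally show ?thesis using assms by (simp add: sum_of_bool_mult)
qed

lemma parseval: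
  assumes "onb d u"
  shows "(\<Sum>i<d. (cmod (ip d (u i) x))\<^sup>2) = (\<Sum>p<d. (cmod (x p))\<^sup>2)"
proof -
  have "complex_of_real (\<Sum>i<d. (cmod (ip d (u i) x))\<^sup>2) = (\<Sum>i<d. \<Sum>p<d. cnj (x p) * (u i p * ip d (u i) x))"
    unfolding of_real_sum ip_mult_cnj[symmetric]
    by (intro sum.cong refl) (simp add: ip_def[of d x] sum_distrib_right mult.assoc)
  also have "\<dots> = (\<Sum>p<d. cnj (x p) * (\<Sum>i<d. u i p * ip d (u i) x))"
    unfolding sum_distrib_left by (rule sum.swap)
  also have "\<dots> = ip d x x" using onb_expand[OF assms] by (simp add: ip_def[of d x])
  finally show ?thesis by (simp only: ip_self of_real_eq_iff)
qed

lemma parseval_unit: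
  assumes "onb d u" "onb d v" "j < d"
  shows "(\<Sum>i<d. (cmod (ip d (u i) (v j)))\<^sup>2) = 1" "(\<Sum>i<d. (cmod (ip d (v j) (u i)))\<^sup>2) = 1"
proof -
  have "complex_of_real (\<Sum>p<d. (cmod (v j p))\<^sup>2) = 1"
    using onb_ip[OF assms(2,3,3)] by (simp only: ip_self[symmetric]) simp
  then have "(\<Sum>p<d. (cmod (v j p))\<^sup>2) = 1" by (metis of_real_eq_1_iff)
  then show "(\<Sum>i<d. (cmod (ip d (u i) (v j)))\<^sup>2) = 1" by (simp only: parseval[OF assms(1)])
  then show "(\<Sum>i<d. (cmod (ip d (v j) (u i)))\<^sup>2) = 1"
    by (simp only: cmod_ip_commute[of d "v j"])
qed

lemma onb_norm:
  assumes "onb d u" "i < d" shows "(\<Sum>p<d. (cmod (u i p))\<^sup>2) = 1"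
  using parseval_unit(1)[OF assms(1,1,2)] by (simp only: parseval[OF assms(1)])

lemma spec_carrier: "spec d A u l \<Longrightarrow> A \<in> carrier_mat d d" by (simp add: spec_def)
lemma spec_onb: "spec d A u l \<Longrightarrow> onb d u" by (simp add: spec_def)

lemma spec_eigenvalue:
  assumes "spec d A u l" "i < d"
  shows "qf d A (u i) = complex_of_real (l i)"
proof -
  have "(\<Sum>j<d. l j * (cmod (ip d (u j) (u i)))\<^sup>2) = (\<Sum>j<d. l j * of_bool (j = i))"
    using assms by (intro sum.cong refl) (simp add: onb_ip[OF spec_onb])
  then show ?thesis unfolding spec_qf[OF assms(1)] using assms(2) by (simp add: sum_of_bool_mult)
qed

lemma psd_spec_nonneg: "psd d A \<Longrightarrow> spec d A u l \<Longrightarrow> i < d \<Longrightarrow> 0 \<le> l i"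
  using spec_eigenvalue psd_qf(2) by (metis Re_complex_of_real)

lemma psd_obtain_spec:
  assumes "psd d A" obtains u l where "spec d A u l" "\<And>i. i < d \<Longrightarrow> 0 \<le> l i"
proof -
  obtain u l where ul: "spec d A u l"
    using real_qf_spec[OF psd_carrier[OF assms]] assms by (auto simp: psd_iff)
  then show ?thesis using that psd_spec_nonneg[OF assms ul] by blast
qed

lemma spec_psd:
  assumes "spec d A u l" "\<And>i. i < d \<Longrightarrow> 0 \<le> l i" shows "psd d A"
proof (rule psdI)
  fix x
  have "0 \<le> (\<Sum>i<d. l i * (cmod (ip d (u i) x))\<^sup>2)" using assms(2) by (intro sum_nonneg) auto
  then show "\<exists>r\<ge>0. qf d A x = complex_of_real r" using spec_qf[OF assms(1)] by blast
qed (rule spec_carrier[OF assms(1)])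

lemma trace_onb:
  assumes "A \<in> carrier_mat d d" "onb d u"
  shows "mat_trace A = (\<Sum>i<d. qf d A (u i))"
proof -
  have "(\<Sum>i<d. qf d A (u i)) = (\<Sum>p<d. \<Sum>q<d. \<Sum>i<d. A $$ (p, q) * (u i q * cnj (u i p)))"
    unfolding qf_def by (subst sum_swap3, intro sum.cong refl) (simp only: mult_ac)
  also have "\<dots> = (\<Sum>p<d. \<Sum>q<d. A $$ (p, q) * of_bool (q = p))"
    unfolding sum_distrib_left[symmetric] using assms(2) by (intro sum.cong refl) (simp add: onb_def)
  finally show ?thesis using assms(1) by (simp add: mat_trace_def sum_of_bool_mult)
qed

lemma trace_spec:
  assumes "spec d A u l" shows "mat_trace A = complex_of_real (\<Sum>i<d. l i)"
  using trace_onb[OF spec_carrier[OF assms] spec_onb[OF assms]] by (simp add: spec_eigenvalue[OF assms])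

lemma trace_mult_spec:
  assumes "A \<in> carrier_mat d d" "spec d B v m"
  shows "mat_trace (A * B) = (\<Sum>j<d. complex_of_real (m j) * qf d A (v j))"
proof -
  have B: "B \<in> carrier_mat d d" by (rule spec_carrier[OF assms(2)])
  have "mat_trace (A * B) = (\<Sum>p<d. \<Sum>q<d. A $$ (p, q) * B $$ (q, p))"
    using assms(1) B by (simp add: mat_trace_def scalar_prod_def atLeast0LessThan)
  also have "\<dots> = (\<Sum>p<d. \<Sum>q<d. \<Sum>j<d. complex_of_real (m j) * (cnj (v j p) * A $$ (p, q) * v j q))"
    using assms(2) by (intro sum.cong refl) (simp add: spec_def sum_distrib_left mult_ac)
  also have "\<dots> = (\<Sum>j<d. \<Sum>p<d. \<Sum>q<d. complex_of_real (m j) * (cnj (v j p) * A $$ (p, q) * v j q))"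
    by (rule sum_swap3[symmetric])
  finally show ?thesis by (simp add: qf_def sum_distrib_left)
qed

text \<open>The form of \<open>A\<close> between \<open>v j\<close> and \<open>u i\<close> is
  \<open>l i\<close> times their overlap in one decomposition and \<open>m j\<close> times it in the
  other, so a nonzero overlap forces equal eigenvalues.\<close>

lemma spec_ip_eq:
  assumes "spec d A u l" "spec d A v m" "i < d" "j < d"
  shows "complex_of_real (f (l i)) * ip d (v j) (u i) = complex_of_real (f (m j)) * ip d (v j) (u i)"
proof -
  have "bf d A (v j) (u i) = (\<Sum>k<d. (complex_of_real (l k) * ip d (v j) (u k)) * of_bool (k = i))"
    unfolding spec_bf[OF assms(1)] using assms by (intro sum.cong refl) (simp add: onb_ip[OF spec_onb])
  then have 1: "bf d A (v j) (u i) = complex_of_real (l i) * ip d (v j) (u i)"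
    using assms(3) by (simp add: sum_of_bool_mult)
  have "bf d A (v j) (u i) = (\<Sum>k<d. of_bool (j = k) * (complex_of_real (m k) * ip d (v k) (u i)))"
    unfolding spec_bf[OF assms(2)] using assms by (intro sum.cong refl) (simp add: onb_ip[OF spec_onb])
  then have 2: "bf d A (v j) (u i) = complex_of_real (m j) * ip d (v j) (u i)"
    using assms(4) by (simp only: sum_of_bool_mult)
  from 1 2 show ?thesis by (cases "ip d (v j) (u i) = 0") auto
qed

text \<open>Expanding one eigenbasis in the other lets \<open>spec_ip_eq\<close> trade
  \<open>f (l i)\<close> for \<open>f (m j)\<close> term by term: the functional calculus does not
  depend on the diagonalisation.\<close>

lemma spec_fun_unique:
  assumes "spec d A u l" "spec d A v m" "p < d" "q < d"
  shows "(\<Sum>i<d. complex_of_real (f (l i)) * u i p * cnj (u i q)) = (\<Sum>j<d. complex_of_real (f (m j)) * v j p * cnj (v j q))"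
proof -
  have ou: "onb d u" and ov: "onb d v" using assms spec_onb by auto
  have "(\<Sum>i<d. complex_of_real (f (l i)) * u i p * cnj (u i q))
    = (\<Sum>i<d. complex_of_real (f (l i)) * (\<Sum>j<d. v j p * ip d (v j) (u i)) * cnj (u i q))"
    unfolding onb_expand[OF ov assms(3)] ..
  also have "\<dots> = (\<Sum>i<d. \<Sum>j<d. v j p * cnj (u i q) * (complex_of_real (f (l i)) * ip d (v j) (u i)))"
    unfolding sum_distrib_left sum_distrib_right by (intro sum.cong refl) (simp only: mult_ac)
  also have "\<dots> = (\<Sum>i<d. \<Sum>j<d. v j p * cnj (u i q) * (complex_of_real (f (m j)) * ip d (v j) (u i)))"
    using spec_ip_eq[OF assms(1,2)] by (intro sum.cong refl) simp
  also have "\<dots> = (\<Sum>j<d. \<Sum>i<d. v j p * cnj (u i q) * (complex_of_real (f (m j)) * ip d (v j) (u i)))"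
    by (rule sum.swap)
  also have "\<dots> = (\<Sum>j<d. complex_of_real (f (m j)) * v j p * cnj (\<Sum>i<d. u i q * ip d (u i) (v j)))"
    unfolding cnj_sum complex_cnj_mult ip_cnj sum_distrib_left by (intro sum.cong refl) (simp only: mult_ac)
  finally show ?thesis unfolding onb_expand[OF ou assms(4)] .
qed

section \<open>Functional calculus and trace norm of matrices\<close>

lemma mat_adjoint_index:
  assumes "A \<in> carrier_mat n m" "i < m" "j < n"
  shows "mat_adjoint A $$ (i, j) = cnj (A $$ (j, i))" "mat_adjoint A \<in> carrier_mat m n"
  using assms by (auto simp: mat_adjoint_def mat_of_rows_index)

lemma mat_adjoint_carrier: "A \<in> carrier_mat n m \<Longrightarrow> mat_adjoint A \<in> carrier_mat m n"
  by (auto simp: mat_adjoint_def)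

lemma diag_form_index:
  assumes "U \<in> carrier_mat d d" "p < d" "q < d"
  shows "(U * mat_diag d g * mat_adjoint U) $$ (p, q) = (\<Sum>i<d. g i * U $$ (p, i) * cnj (U $$ (q, i)))"
proof -
  have ad: "mat_adjoint U \<in> carrier_mat d d" by (rule mat_adjoint_carrier[OF assms(1)])
  have "(U * mat_diag d g) \<in> carrier_mat d d" using assms by (auto simp: mat_diag_def)
  then have "(U * mat_diag d g * mat_adjoint U) $$ (p, q) = (\<Sum>i<d. (U * mat_diag d g) $$ (p, i) * mat_adjoint U $$ (i, q))"
    by (rule mat_mult_index[OF _ ad assms(2,3)])
  also have "\<dots> = (\<Sum>i<d. g i * U $$ (p, i) * cnj (U $$ (q, i)))"
    using assms by (intro sum.cong refl) (simp add: mat_diag_mult_right mat_adjoint_index)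
  finally show ?thesis .
qed

lemma unitary_onb:
  assumes "U \<in> carrier_mat d d"
  shows "unitary_mat d U \<longleftrightarrow> onb d (\<lambda>i p. U $$ (p, i))"
proof -
  have ad: "mat_adjoint U \<in> carrier_mat d d" by (rule mat_adjoint_carrier[OF assms])
  have 1: "mat_adjoint U * U = 1\<^sub>m d \<longleftrightarrow> (\<forall>i<d. \<forall>j<d. ip d (\<lambda>p. U $$ (p, i)) (\<lambda>p. U $$ (p, j)) = of_bool (i = j))"
  proof -
    have e: "(mat_adjoint U * U) $$ (i, j) = ip d (\<lambda>p. U $$ (p, i)) (\<lambda>p. U $$ (p, j))" if "i < d" "j < d" for i j
      unfolding mat_mult_index[OF ad assms that] ip_def using that assms by (intro sum.cong refl) (simp add: mat_adjoint_index)
    show ?thesis using assms ad e by (auto simp: mat_eq_iff of_bool_def)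
  qed
  have 2: "U * mat_adjoint U = 1\<^sub>m d \<longleftrightarrow> (\<forall>p<d. \<forall>q<d. (\<Sum>i<d. U $$ (p, i) * cnj (U $$ (q, i))) = of_bool (p = q))"
  proof -
    have e: "(U * mat_adjoint U) $$ (p, q) = (\<Sum>i<d. U $$ (p, i) * cnj (U $$ (q, i)))" if "p < d" "q < d" for p q
      unfolding mat_mult_index[OF assms ad that] using that assms by (intro sum.cong refl) (simp add: mat_adjoint_index)
    show ?thesis using assms ad e by (auto simp: mat_eq_iff of_bool_def)
  qed
  show ?thesis unfolding unitary_mat_def onb_def 1 2 using assms by blast
qed

text \<open>Existence and uniqueness for the definite description in \<open>herm_fun\<close>.
  Logarithm and square root of matrices are reached only through this lemma.\<close>

lemma spec_herm_fun:
  assumes "spec d A u l"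
  shows "spec d (herm_fun f A) u (\<lambda>i. f (l i))"
proof -
  have d: "dim_row A = d" using spec_carrier[OF assms] by auto
  define B where "B = mat d d (\<lambda>(p, q). \<Sum>i<d. complex_of_real (f (l i)) * u i p * cnj (u i q))"
  define P where "P B = (\<exists>U l. unitary_mat (dim_row A) U \<and>
     A = U * mat_diag (dim_row A) (\<lambda>i. complex_of_real (l i)) * mat_adjoint U \<and>
     B = U * mat_diag (dim_row A) (\<lambda>i. complex_of_real (f (l i))) * mat_adjoint U)" for B
  have "P B"
  proof -
    define U where "U = mat d d (\<lambda>(p, i). u i p)"
    have U: "U \<in> carrier_mat d d" by (simp add: U_def)
    have "ip d (\<lambda>p. U $$ (p, i)) (\<lambda>p. U $$ (p, j)) = of_bool (i = j)" if "i < d" "j < d" for i j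
      using that onb_ip[OF spec_onb[OF assms] that] by (simp add: ip_def U_def)
    then have "unitary_mat d U" unfolding unitary_onb[OF U] by (rule onbI)
    moreover have "C = U * mat_diag d g * mat_adjoint U"
      if "C \<in> carrier_mat d d" "\<And>p q. p < d \<Longrightarrow> q < d \<Longrightarrow> C $$ (p, q) = (\<Sum>i<d. g i * u i p * cnj (u i q))" for C g
    proof (rule eq_matI)
      fix p q assume "p < dim_row (U * mat_diag d g * mat_adjoint U)" "q < dim_col (U * mat_diag d g * mat_adjoint U)"
      then have pq: "p < d" "q < d" using U mat_adjoint_carrier[OF U] by auto
      show "C $$ (p, q) = (U * mat_diag d g * mat_adjoint U) $$ (p, q)"
        unfolding diag_form_index[OF U pq] that(2)[OF pq] using pq by (simp add: U_def)
    qed (use that U mat_adjoint_carrier[OF U] in auto)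
    ultimately show ?thesis unfolding P_def d
      by (intro exI[of _ U] exI[of _ l]) (use assms in \<open>auto simp: spec_def B_def\<close>)
  qed
  moreover have "C = B" if "P C" for C
  proof -
    obtain U m where U: "unitary_mat d U" "A = U * mat_diag d (\<lambda>i. complex_of_real (m i)) * mat_adjoint U"
      "C = U * mat_diag d (\<lambda>i. complex_of_real (f (m i))) * mat_adjoint U"
      using \<open>P C\<close> unfolding P_def d by blast
    have Uc: "U \<in> carrier_mat d d" using U(1) by (simp add: unitary_mat_def)
    have sv: "spec d A (\<lambda>i p. U $$ (p, i)) m"
      unfolding spec_def
    proof (intro conjI allI impI)
      show "A \<in> carrier_mat d d" by (rule spec_carrier[OF assms])
      show "onb d (\<lambda>i p. U $$ (p, i))" using U(1) unitary_onb[OF Uc] by simp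
      fix p q assume "p < d" "q < d"
      then show "A $$ (p, q) = (\<Sum>i<d. complex_of_real (m i) * U $$ (p, i) * cnj (U $$ (q, i)))"
        by (subst U(2)) (rule diag_form_index[OF Uc])
    qed
    show ?thesis
    proof (rule eq_matI)
      fix p q assume "p < dim_row B" "q < dim_col B"
      then have pq: "p < d" "q < d" by (auto simp: B_def)
      show "C $$ (p, q) = B $$ (p, q)"
        unfolding U(3) diag_form_index[OF Uc pq] using spec_fun_unique[OF sv assms pq, of f] pq by (simp add: B_def)
    qed (use U(3) Uc mat_adjoint_carrier[OF Uc] in \<open>auto simp: B_def\<close>)
  qed
  ultimately have "herm_fun f A = B"
    unfolding herm_fun_def P_def[symmetric] by (rule the_equality)
  then show ?thesis using spec_onb[OF assms] by (simp add: spec_def B_def)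
qed

text \<open>The product of the adjoint with \<open>X\<close> has the eigenbasis of \<open>X\<close>
  and squared eigenvalues, whose roots are the absolute values. \<open>spec\<close> makes
  \<open>X\<close> Hermitian, which covers differences of states.\<close>

lemma trace_norm_spec:
  assumes "spec d X u l" shows "trace_norm X = (\<Sum>i<d. \<bar>l i\<bar>)"
proof -
  have X: "X \<in> carrier_mat d d" and ou: "onb d u" using assms by (auto simp: spec_def)
  have ad: "mat_adjoint X \<in> carrier_mat d d" by (rule mat_adjoint_carrier[OF X])
  have "(mat_adjoint X * X) $$ (p, q) = (\<Sum>i<d. complex_of_real ((l i)\<^sup>2) * u i p * cnj (u i q))" if pq: "p < d" "q < d" for p q
  proof -
    have "(mat_adjoint X * X) $$ (p, q) = (\<Sum>r<d. cnj (X $$ (r, p)) * X $$ (r, q))"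
      unfolding mat_mult_index[OF ad X pq] using pq X by (intro sum.cong refl) (simp add: mat_adjoint_index)
    also have "\<dots> = (\<Sum>r<d. (\<Sum>i<d. complex_of_real (l i) * cnj (u i r) * u i p) * (\<Sum>j<d. complex_of_real (l j) * u j r * cnj (u j q)))"
      using assms pq by (intro sum.cong refl) (simp add: spec_def)
    also have "\<dots> = (\<Sum>r<d. \<Sum>i<d. \<Sum>j<d. complex_of_real (l i) * u i p * complex_of_real (l j) * cnj (u j q) * (cnj (u i r) * u j r))"
      unfolding sum_product by (intro sum.cong refl) (simp only: mult_ac)
    also have "\<dots> = (\<Sum>i<d. \<Sum>j<d. complex_of_real (l i) * u i p * complex_of_real (l j) * cnj (u j q) * ip d (u i) (u j))"
      unfolding ip_def sum_distrib_left by (rule sum_swap3)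
    also have "\<dots> = (\<Sum>i<d. \<Sum>j<d. complex_of_real (l i) * u i p * complex_of_real (l j) * cnj (u j q) * of_bool (i = j))"
      using onb_ip[OF ou] by (intro sum.cong refl) simp
    also have "\<dots> = (\<Sum>i<d. complex_of_real ((l i)\<^sup>2) * u i p * cnj (u i q))"
      by (intro sum.cong refl, subst sum_of_bool_mult) (auto simp: power2_eq_square mult_ac)
    finally show ?thesis .
  qed
  then have "spec d (mat_adjoint X * X) u (\<lambda>i. (l i)\<^sup>2)"
    using ou ad X by (simp add: spec_def)
  from spec_herm_fun[OF this, of sqrt] have "spec d (herm_fun sqrt (mat_adjoint X * X)) u (\<lambda>i. \<bar>l i\<bar>)" by simp
  from trace_spec[OF this] show ?thesis by (simp add: trace_norm_def del: of_real_sum)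
qed

section \<open>Entropy inequalities\<close>

definition smat :: "nat \<Rightarrow> (nat \<Rightarrow> nat \<Rightarrow> complex) \<Rightarrow> (nat \<Rightarrow> real) \<Rightarrow> complex mat" where
  "smat d u l = mat d d (\<lambda>(p, q). \<Sum>i<d. complex_of_real (l i) * u i p * cnj (u i q))"

lemma spec_smat: "onb d u \<Longrightarrow> spec d (smat d u l) u l"
  by (simp add: spec_def smat_def)

lemma ip_sum_right: "ip d y (\<lambda>p. \<Sum>j\<in>J. c j * v j p) = (\<Sum>j\<in>J. c j * ip d y (v j))"
proof -
  have "ip d y (\<lambda>p. \<Sum>j\<in>J. c j * v j p) = (\<Sum>p<d. \<Sum>j\<in>J. c j * (cnj (y p) * v j p))"
    unfolding ip_def sum_distrib_left by (intro sum.cong refl) (simp only: mult_ac)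
  also have "\<dots> = (\<Sum>j\<in>J. \<Sum>p<d. c j * (cnj (y p) * v j p))" by (rule sum.swap)
  finally show ?thesis by (simp add: ip_def sum_distrib_left)
qed

lemma spec_Re_qf:
  assumes "spec d A u l" shows "Re (qf d A x) = (\<Sum>i<d. l i * (cmod (ip d (u i) x))\<^sup>2)"
  unfolding spec_qf[OF assms] by simp

lemma trace_qf_real:
  assumes "A \<in> carrier_mat d d" "onb d v"
  shows "(\<Sum>j<d. Re (qf d A (v j))) = Re (mat_trace A)"
  unfolding trace_onb[OF assms] by simp

text \<open>Since \<open>ln 0 = 0\<close>, logarithms below are implicitly restricted to the support.\<close>

definition ent :: "nat \<Rightarrow> (nat \<Rightarrow> real) \<Rightarrow> real" where
  "ent d g = (\<Sum>i<d. g i * ln (g i))"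

text \<open>For \<open>spec d M v m\<close> this is \<open>Tr (G ln M)\<close>, so
  \<open>ent\<close> minus \<open>cross\<close> is a relative entropy in natural units.\<close>

definition cross :: "nat \<Rightarrow> complex mat \<Rightarrow> (nat \<Rightarrow> nat \<Rightarrow> complex) \<Rightarrow> (nat \<Rightarrow> real) \<Rightarrow> real" where
  "cross d G v m = (\<Sum>j<d. Re (qf d G (v j)) * ln (m j))"

lemma cross_overlap:
  assumes "spec d G u g"
  shows "cross d G v m = (\<Sum>i<d. \<Sum>j<d. g i * (cmod (ip d (u i) (v j)))\<^sup>2 * ln (m j))"
  unfolding cross_def spec_Re_qf[OF assms] sum_distrib_right by (rule sum.swap)

lemma ent_overlap:
  assumes "onb d u" "onb d v"
  shows "ent d g = (\<Sum>i<d. \<Sum>j<d. g i * (cmod (ip d (u i) (v j)))\<^sup>2 * ln (g i))"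
proof -
  have "(\<Sum>j<d. g i * (cmod (ip d (u i) (v j)))\<^sup>2 * ln (g i)) = g i * ln (g i)" if "i < d" for i
  proof -
    have "(\<Sum>j<d. g i * (cmod (ip d (u i) (v j)))\<^sup>2 * ln (g i)) = g i * ln (g i) * (\<Sum>j<d. (cmod (ip d (u i) (v j)))\<^sup>2)"
      unfolding sum_distrib_left by (intro sum.cong refl) (simp only: mult_ac)
    then show ?thesis using parseval_unit(2)[OF assms(2,1) that] by simp
  qed
  then show ?thesis by (simp add: ent_def)
qed

text \<open>Testing \<open>G \<le> M\<close> on the vector \<open>x = M^-1 (u i)\<close> gives
  \<open>g i * z^2 \<le> z\<close> for \<open>z = <u i, M^-1 (u i)>\<close>. Since
  \<open>1 / 0 = 0\<close>, \<open>M^-1\<close> is the pseudo-inverse. The bound disposes of the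
  linear term left over in \<open>ent_le_cross\<close>.\<close>

lemma rank_one_inverse_bound:
  assumes G: "psd d G" "spec d G u g" and M: "spec d M v m" and le: "psd d (M - G)" and i: "i < d"
  shows "g i * (\<Sum>j<d. (cmod (ip d (u i) (v j)))\<^sup>2 / m j) \<le> 1"
proof -
  define z where "z = (\<Sum>j<d. (cmod (ip d (u i) (v j)))\<^sup>2 / m j)"
  define x where "x = (\<lambda>p. \<Sum>j<d. (complex_of_real (1 / m j) * ip d (v j) (u i)) * v j p)"
  have ov: "onb d v" using M by (rule spec_onb)
  have g: "\<And>k. k < d \<Longrightarrow> 0 \<le> g k" using psd_spec_nonneg[OF G] .
  have Gc: "G \<in> carrier_mat d d" and Mc: "M \<in> carrier_mat d d" using G M spec_carrier by auto
  have 1: "ip d (v k) x = complex_of_real (1 / m k) * ip d (v k) (u i)" if "k < d" for k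
  proof -
    have "ip d (v k) x = (\<Sum>j<d. (complex_of_real (1 / m j) * ip d (v j) (u i)) * of_bool (k = j))"
      unfolding x_def ip_sum_right using onb_ip[OF ov that] by (intro sum.cong refl) simp
    then show ?thesis using that by (simp only: sum_of_bool_mult)
  qed
  have "Re (qf d M x) = (\<Sum>k<d. m k * ((1 / m k)\<^sup>2 * (cmod (ip d (u i) (v k)))\<^sup>2))"
    unfolding spec_Re_qf[OF M]
    by (intro sum.cong refl) (simp add: 1 norm_mult norm_divide power_mult_distrib power_divide cmod_ip_commute[of d "u i"])
  also have "\<dots> = z" unfolding z_def by (intro sum.cong refl) (auto simp: field_simps power2_eq_square)
  finally have qM: "Re (qf d M x) = z" .
  have "ip d (u i) x = (\<Sum>j<d. complex_of_real (1 / m j) * (ip d (v j) (u i) * ip d (u i) (v j)))"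
    unfolding x_def ip_sum_right by (simp only: mult.assoc)
  also have "\<dots> = complex_of_real z"
    unfolding ip_mult_cnj z_def by simp
  finally have iz: "ip d (u i) x = complex_of_real z" .
  have "g i * z\<^sup>2 = g i * (cmod (ip d (u i) x))\<^sup>2" unfolding iz by simp
  also have "\<dots> \<le> (\<Sum>k<d. g k * (cmod (ip d (u k) x))\<^sup>2)"
    by (rule member_le_sum) (use i g in auto)
  also have "\<dots> = Re (qf d G x)" by (rule spec_Re_qf[OF G(2), symmetric])
  also have "\<dots> \<le> Re (qf d M x)"
    using psd_qf(2)[OF le, of x] by (simp add: qf_minus[OF Mc Gc])
  finally have h: "g i * z * z \<le> z" by (simp add: qM power2_eq_square mult.assoc)
  have "z \<ge> 0"
  proof -
    have "Re (qf d M x) \<ge> 0" using \<open>Re (qf d G x) \<le> Re (qf d M x)\<close> psd_qf(2)[OF G(1), of x] by linarith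
    then show ?thesis by (simp add: qM)
  qed
  then show ?thesis using h g[OF i] unfolding z_def[symmetric]
    by (cases "z = 0") (auto simp: mult_le_cancel_right1)
qed

lemma overlap_kernel:
  assumes G: "spec d G u g" "\<And>i. i < d \<Longrightarrow> 0 \<le> g i" and "Re (qf d G x) \<le> 0" "i < d"
  shows "g i * (cmod (ip d (u i) x))\<^sup>2 = 0"
proof -
  have nn: "\<And>k. k < d \<Longrightarrow> 0 \<le> g k * (cmod (ip d (u k) x))\<^sup>2" using G by simp
  have "g i * (cmod (ip d (u i) x))\<^sup>2 \<le> (\<Sum>k<d. g k * (cmod (ip d (u k) x))\<^sup>2)"
    by (rule member_le_sum) (use assms nn in auto)
  then show ?thesis using assms(3) nn[OF assms(4)] unfolding spec_Re_qf[OF G(1)] by linarith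
qed

text \<open>
  Written with the overlaps of the two eigenbases, a relative entropy is the classical relative
  entropy of the two distributions \<open>g\<^sub>i w\<^sub>i\<^sub>j\<close> and \<open>m\<^sub>j w\<^sub>i\<^sub>j\<close>, so \<open>ln x \<le> x - 1\<close> suffices
  and no operator monotonicity of the logarithm is needed.
\<close>

lemma ent_le_cross:
  assumes G: "psd d G" "spec d G u g" and M: "spec d M v m" and le: "psd d (M - G)"
  shows "ent d g \<le> cross d G v m"
proof -
  define w where "w i j = (cmod (ip d (u i) (v j)))\<^sup>2" for i j
  have ou: "onb d u" and ov: "onb d v" using G M spec_onb by auto
  have g: "\<And>k. k < d \<Longrightarrow> 0 \<le> g k" using psd_spec_nonneg[OF G] .
  have Gc: "G \<in> carrier_mat d d" and Mc: "M \<in> carrier_mat d d" using G M spec_carrier by auto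
  have GM: "Re (qf d G x) \<le> Re (qf d M x)" for x
    using psd_qf(2)[OF le, of x] by (simp add: qf_minus[OF Mc Gc])
  have m: "0 \<le> m j" if "j < d" for j
    using GM[of "v j"] psd_qf(2)[OF G(1), of "v j"] by (simp add: spec_eigenvalue[OF M that])
  have tb: "g i * w i j * ln (g i) - g i * w i j * ln (m j) \<le> g i * (g i * (w i j / m j)) - g i * w i j"
    if "i < d" "j < d" for i j
  proof (cases "g i * w i j = 0")
    case True then show ?thesis by auto
  next
    case False
    then have gi: "g i > 0" using g[OF that(1)] by (auto simp: less_le)
    have "m j \<noteq> 0"
      using False overlap_kernel[OF G(2) g, of "v j" i] GM[of "v j"] that spec_eigenvalue[OF M that(2)]
      by (auto simp: w_def)
    then have mj: "m j > 0" using m[OF that(2)] by simp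
    have "ln (g i / m j) \<le> g i / m j - 1" using gi mj by (intro ln_le_minus_one) simp
    then have "ln (g i) - ln (m j) \<le> g i / m j - 1" using gi mj by (simp add: ln_div)
    then have "g i * w i j * (ln (g i) - ln (m j)) \<le> g i * w i j * (g i / m j - 1)"
      using gi by (intro mult_left_mono) (auto simp: w_def)
    then show ?thesis by (simp add: algebra_simps)
  qed
  have "ent d g - cross d G v m = (\<Sum>i<d. \<Sum>j<d. g i * w i j * ln (g i) - g i * w i j * ln (m j))"
    unfolding ent_overlap[OF ou ov] cross_overlap[OF G(2)] w_def sum_subtractf ..
  also have "\<dots> \<le> (\<Sum>i<d. \<Sum>j<d. g i * (g i * (w i j / m j)) - g i * w i j)"
    using tb by (intro sum_mono) auto
  also have "\<dots> = (\<Sum>i<d. g i * (g i * (\<Sum>j<d. w i j / m j)) - g i * (\<Sum>j<d. w i j))"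
    unfolding sum_subtractf sum_distrib_left ..
  \<comment> \<open>What remains for fixed \<open>i\<close> is \<open>g i\<close> times the
    difference of \<open>g i * <u i, M^-1 (u i)>\<close> and 1.\<close>
  also have "\<dots> \<le> (\<Sum>i<d. 0)"
  proof (rule sum_mono)
    fix i assume "i \<in> {..<d}"
    then have i: "i < d" by simp
    have "(\<Sum>j<d. w i j) = 1" unfolding w_def by (rule parseval_unit(2)[OF ov ou i])
    moreover have "g i * (g i * (\<Sum>j<d. w i j / m j)) \<le> g i * 1"
      using rank_one_inverse_bound[OF G M le i] g[OF i] unfolding w_def by (intro mult_left_mono)
    ultimately show "g i * (g i * (\<Sum>j<d. w i j / m j)) - g i * (\<Sum>j<d. w i j) \<le> 0" by simp
  qed
  finally show ?thesis by simp
qed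

text \<open>Klein's inequality for unnormalised operators, with the two distributions in
  \<open>ln x \<le> x - 1\<close> exchanged. The traces are what the linear terms sum to;
  \<open>ker\<close> says that the support of \<open>G\<close> lies in that of
  \<open>M\<close>.\<close>

lemma cross_le_ent:
  assumes G: "psd d G" "spec d G u g" and M: "psd d M" "spec d M v m"
    and ker: "\<And>j. j < d \<Longrightarrow> m j = 0 \<Longrightarrow> Re (qf d G (v j)) = 0"
  shows "cross d G v m \<le> ent d g + Re (mat_trace M) - Re (mat_trace G)"
proof -
  define w where "w i j = (cmod (ip d (u i) (v j)))\<^sup>2" for i j
  have ou: "onb d u" and ov: "onb d v" using G M spec_onb by auto
  have g: "\<And>k. k < d \<Longrightarrow> 0 \<le> g k" using psd_spec_nonneg[OF G] .
  have m: "\<And>k. k < d \<Longrightarrow> 0 \<le> m k" using psd_spec_nonneg[OF M] .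
  have tb: "g i * w i j * ln (m j) - g i * w i j * ln (g i) \<le> w i j * m j - g i * w i j"
    if "i < d" "j < d" for i j
  proof (cases "g i * w i j = 0")
    case True then show ?thesis using m[OF that(2)] by (auto simp: w_def)
  next
    case False
    then have gi: "g i > 0" using g[OF that(1)] by (auto simp: less_le)
    have "m j \<noteq> 0"
      using False overlap_kernel[OF G(2) g, of "v j" i] ker[OF that(2)] that
      by (auto simp: w_def)
    then have mj: "m j > 0" using m[OF that(2)] by simp
    have "ln (m j / g i) \<le> m j / g i - 1" using gi mj by (intro ln_le_minus_one) simp
    then have "ln (m j) - ln (g i) \<le> m j / g i - 1" using gi mj by (simp add: ln_div)
    then have "g i * w i j * (ln (m j) - ln (g i)) \<le> g i * w i j * (m j / g i - 1)"
      using gi by (intro mult_left_mono) (auto simp: w_def)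
    then show ?thesis using gi by (simp add: algebra_simps)
  qed
  have "cross d G v m - ent d g = (\<Sum>i<d. \<Sum>j<d. g i * w i j * ln (m j) - g i * w i j * ln (g i))"
    unfolding ent_overlap[OF ou ov] cross_overlap[OF G(2)] w_def sum_subtractf ..
  also have "\<dots> \<le> (\<Sum>i<d. \<Sum>j<d. w i j * m j - g i * w i j)"
    using tb by (intro sum_mono) auto
  also have "\<dots> = (\<Sum>j<d. (\<Sum>i<d. w i j) * m j) - (\<Sum>i<d. g i * (\<Sum>j<d. w i j))"
    unfolding sum_subtractf sum_distrib_left sum_distrib_right by (simp only: sum.swap[of "\<lambda>i j. w i j * m j"])
  also have "\<dots> = (\<Sum>j<d. m j) - (\<Sum>i<d. g i)"
    unfolding w_def by (simp add: parseval_unit(1)[OF ou ov] parseval_unit(2)[OF ov ou])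
  finally show ?thesis by (simp add: trace_spec[OF G(2)] trace_spec[OF M(2)])
qed

section \<open>Relative entropy and supports in eigenbases\<close>

lemma trace_minus:
  assumes "A \<in> carrier_mat d d" "B \<in> carrier_mat d d"
  shows "mat_trace (A - B) = mat_trace A - mat_trace B"
  using assms by (simp add: mat_trace_def sum_subtractf)

lemma trace_add:
  assumes "A \<in> carrier_mat d d" "B \<in> carrier_mat d d"
  shows "mat_trace (A + B) = mat_trace A + mat_trace B"
  using assms by (simp add: mat_trace_def sum.distrib)

lemma trace_smult:
  assumes "A \<in> carrier_mat d d"
  shows "mat_trace (c \<cdot>\<^sub>m A) = c * mat_trace A"
  using assms by (simp add: mat_trace_def sum_distrib_left)

lemma rel_entropy_spec:
  assumes "psd d \<rho>" "spec d \<rho> u r" "psd d \<sigma>" "spec d \<sigma> v s" "supp \<rho> \<subseteq> supp \<sigma>"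
  shows "rel_entropy \<rho> \<sigma> = ereal ((ent d r - cross d \<rho> v s) / ln 2)"
proof -
  let ?f = "\<lambda>x::real. if x > 0 then log 2 x else 0"
  have f: "?f x = ln x / ln 2" if "x \<ge> 0" for x using that by (simp add: log_def)
  have rho: "\<rho> \<in> carrier_mat d d" by (rule psd_carrier[OF assms(1)])
  have lr: "spec d (mat_log2 \<rho>) u (\<lambda>i. ?f (r i))" unfolding mat_log2_def by (rule spec_herm_fun[OF assms(2)])
  have ls: "spec d (mat_log2 \<sigma>) v (\<lambda>i. ?f (s i))" unfolding mat_log2_def by (rule spec_herm_fun[OF assms(4)])
  note c = spec_carrier[OF lr] spec_carrier[OF ls]
  have "mat_trace (\<rho> * (mat_log2 \<rho> - mat_log2 \<sigma>)) = mat_trace (\<rho> * mat_log2 \<rho>) - mat_trace (\<rho> * mat_log2 \<sigma>)"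
    unfolding mult_minus_distrib_mat[OF rho c] using rho c by (intro trace_minus[of _ d]) auto
  also have "mat_trace (\<rho> * mat_log2 \<rho>) = complex_of_real (\<Sum>i<d. ?f (r i) * r i)"
    unfolding trace_mult_spec[OF rho lr] by (simp add: spec_eigenvalue[OF assms(2)])
  also have "(\<Sum>i<d. ?f (r i) * r i) = ent d r / ln 2"
    unfolding ent_def sum_divide_distrib
    by (intro sum.cong refl, subst f) (use psd_spec_nonneg[OF assms(1,2)] in auto)
  also have "mat_trace (\<rho> * mat_log2 \<sigma>) = (\<Sum>j<d. complex_of_real (?f (s j)) * complex_of_real (Re (qf d \<rho> (v j))))"
    unfolding trace_mult_spec[OF rho ls] by (subst psd_qf(1)[OF assms(1)]) (rule refl)
  also have "\<dots> = complex_of_real (\<Sum>j<d. ?f (s j) * Re (qf d \<rho> (v j)))" by (simp only: of_real_sum of_real_mult)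
  also have "(\<Sum>j<d. ?f (s j) * Re (qf d \<rho> (v j))) = cross d \<rho> v s / ln 2"
    unfolding cross_def sum_divide_distrib
    by (intro sum.cong refl, subst f) (use psd_spec_nonneg[OF assms(3,4)] in auto)
  finally show ?thesis using assms(5) by (simp add: rel_entropy_def diff_divide_distrib)
qed

lemma mult_vec_index:
  assumes "A \<in> carrier_mat d d" "x \<in> carrier_vec d" "p < d"
  shows "(A *\<^sub>v x) $ p = (\<Sum>q<d. A $$ (p, q) * x $ q)"
  using assms by (simp add: scalar_prod_def atLeast0LessThan)

text \<open>\<open>v j\<close> is orthogonal to the range of \<open>\<sigma>\<close>, and
  \<open>\<rho>\<close> maps \<open>v j\<close> into that range. The inclusion of supports thereby
  takes the form that \<open>cross_le_ent\<close> asks for.\<close>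

lemma supp_kernel:
  assumes "\<rho> \<in> carrier_mat d d" "spec d \<sigma> v s" "supp \<rho> \<subseteq> supp \<sigma>" "j < d" "s j = 0"
  shows "qf d \<rho> (v j) = 0"
proof -
  note sc = spec_carrier[OF assms(2)]
  have "\<rho> *\<^sub>v vec d (v j) \<in> supp \<rho>" using assms(1) by (auto simp: supp_def)
  then obtain y where y: "y \<in> carrier_vec d" "\<rho> *\<^sub>v vec d (v j) = \<sigma> *\<^sub>v y"
    using assms(3) sc by (auto simp: supp_def)
  have "qf d \<rho> (v j) = (\<Sum>p<d. cnj (v j p) * (\<rho> *\<^sub>v vec d (v j)) $ p)"
    unfolding qf_def by (intro sum.cong refl, subst mult_vec_index[OF assms(1)]) (simp_all add: sum_distrib_left mult.assoc)
  also have "\<dots> = bf d \<sigma> (v j) (\<lambda>q. y $ q)"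
    unfolding bf_def y(2)
    by (intro sum.cong refl, subst mult_vec_index[OF sc y(1)]) (simp_all add: sum_distrib_left mult.assoc)
  also have "\<dots> = (\<Sum>i<d. complex_of_real (s i) * of_bool (j = i) * ip d (v i) (\<lambda>q. y $ q))"
    unfolding spec_bf[OF assms(2)] using assms(4) by (intro sum.cong refl) (simp add: onb_ip[OF spec_onb[OF assms(2)]])
  also have "\<dots> = 0" using assms(5) by (intro sum.neutral) auto
  finally show ?thesis .
qed

lemma supp_full:
  assumes "spec d \<sigma> v s" "\<And>j. j < d \<Longrightarrow> s j \<noteq> 0"
  shows "carrier_vec d \<subseteq> supp \<sigma>"
proof
  fix y :: "complex vec" assume y: "y \<in> carrier_vec d"
  note sc = spec_carrier[OF assms(1)] and ov = spec_onb[OF assms(1)]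
  define x where "x = (\<lambda>p. \<Sum>k<d. (complex_of_real (1 / s k) * ip d (v k) (\<lambda>q. y $ q)) * v k p)"
  have 1: "ip d (v k) x = complex_of_real (1 / s k) * ip d (v k) (\<lambda>q. y $ q)" if "k < d" for k
  proof -
    have "ip d (v k) x = (\<Sum>j<d. (complex_of_real (1 / s j) * ip d (v j) (\<lambda>q. y $ q)) * of_bool (k = j))"
      unfolding x_def ip_sum_right using onb_ip[OF ov that] by (intro sum.cong refl) simp
    then show ?thesis using that by (simp only: sum_of_bool_mult)
  qed
  have "\<sigma> *\<^sub>v vec d x = y"
  proof (rule eq_vecI)
    fix p assume "p < dim_vec y"
    then have p: "p < d" using y by simp
    have "(\<sigma> *\<^sub>v vec d x) $ p = (\<Sum>q<d. \<Sum>k<d. complex_of_real (s k) * v k p * (cnj (v k q) * x q))"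
      using assms(1) p unfolding mult_vec_index[OF sc vec_carrier p]
      by (intro sum.cong refl) (simp add: spec_def sum_distrib_right mult.assoc)
    also have "\<dots> = (\<Sum>k<d. complex_of_real (s k) * v k p * ip d (v k) x)"
      unfolding ip_def sum_distrib_left by (rule sum.swap)
    also have "\<dots> = (\<Sum>k<d. v k p * ip d (v k) (\<lambda>q. y $ q))"
      by (intro sum.cong refl) (simp add: 1 assms(2))
    also have "\<dots> = y $ p" by (rule onb_expand[OF ov p])
    finally show "(\<sigma> *\<^sub>v vec d x) $ p = y $ p" .
  qed (use y sc in auto)
  then show "y \<in> supp \<sigma>" using sc unfolding supp_def by (intro CollectI exI[of _ "vec d x"]) auto
qed

lemma supp_subset_carrier: "A \<in> carrier_mat d d \<Longrightarrow> supp A \<subseteq> carrier_vec d"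
  by (auto simp: supp_def)

text \<open>A crude Fannes estimate. If \<open>P\<close> and \<open>N\<close> are the positive and
  negative parts of \<open>\<omega> - \<rho>\<close>, then
  \<open>M = \<rho> + P = \<omega> + N\<close> dominates all four operators. The entropy term of
  \<open>M\<close>, split along the first sum, is bounded below by \<open>ent_le_cross\<close>;
  split along the second, it is bounded above by \<open>cross_le_ent\<close>. The second claim
  concerns a logarithm between \<open>ln c\<close> and 0, so only \<open>N\<close> can
  contribute.\<close>

lemma entropy_continuity:
  assumes w: "density d \<omega>" "spec d \<omega> uw w" and r: "density d \<rho>" "spec d \<rho> ur r"
    and X: "spec d (\<omega> - \<rho>) x l" and t: "(\<Sum>i<d. \<bar>l i\<bar>) \<le> 2 * \<epsilon>" "\<epsilon> \<le> 1"
  shows "ent d r \<le> ent d w + 2 + \<epsilon> * ln (real d)"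
    "\<And>v s c. onb d v \<Longrightarrow> 0 < c \<Longrightarrow> (\<And>j. j < d \<Longrightarrow> c \<le> s j \<and> s j \<le> 1) \<Longrightarrow>
       cross d \<omega> v s - cross d \<rho> v s \<le> \<epsilon> * ln (1 / c)"
proof -
  have wp: "psd d \<omega>" "mat_trace \<omega> = 1" and rp: "psd d \<rho>" "mat_trace \<rho> = 1"
    using w r by (auto simp: density_def)
  note wc = psd_carrier[OF wp(1)] and rc = psd_carrier[OF rp(1)]
  have ox: "onb d x" by (rule spec_onb[OF X])
  define lp where "lp i = max (l i) 0" for i
  define ln' where "ln' i = max (- l i) 0" for i
  define P where "P = smat d x lp"
  define N where "N = smat d x ln'"
  have sP: "spec d P x lp" and sN: "spec d N x ln'" unfolding P_def N_def by (rule spec_smat[OF ox])+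
  have pP: "psd d P" by (rule spec_psd[OF sP]) (simp add: lp_def)
  have pN: "psd d N" by (rule spec_psd[OF sN]) (simp add: ln'_def)
  note Pc = psd_carrier[OF pP] and Nc = psd_carrier[OF pN]
  have qPN: "Re (qf d \<omega> y) - Re (qf d \<rho> y) = Re (qf d P y) - Re (qf d N y)" for y
  proof -
    have "Re (qf d \<omega> y) - Re (qf d \<rho> y) = Re (qf d (\<omega> - \<rho>) y)" by (simp add: qf_minus[OF wc rc])
    also have "\<dots> = (\<Sum>i<d. lp i * (cmod (ip d (x i) y))\<^sup>2 - ln' i * (cmod (ip d (x i) y))\<^sup>2)"
      unfolding spec_Re_qf[OF X] by (intro sum.cong refl) (auto simp: lp_def ln'_def max_def algebra_simps)
    finally show ?thesis unfolding spec_Re_qf[OF sP] spec_Re_qf[OF sN] sum_subtractf .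
  qed
  have l0: "(\<Sum>i<d. l i) = 0"
  proof -
    have "mat_trace (\<omega> - \<rho>) = 0" by (simp add: trace_minus[OF wc rc] wp rp)
    then have "complex_of_real (\<Sum>i<d. l i) = 0" by (simp only: trace_spec[OF X])
    then show ?thesis by (simp only: of_real_eq_0_iff)
  qed
  \<comment> \<open>Both states have trace one, so the two parts have the same trace
    \<open>\<tau>\<close>, the trace distance.\<close>
  define \<tau> where "\<tau> = (\<Sum>i<d. lp i)"
  have "(\<Sum>i<d. lp i) - (\<Sum>i<d. ln' i) = (\<Sum>i<d. l i)"
    unfolding sum_subtractf[symmetric] by (intro sum.cong refl) (auto simp: lp_def ln'_def max_def)
  then have tn: "(\<Sum>i<d. ln' i) = \<tau>" by (simp add: l0 \<tau>_def)
  have "(\<Sum>i<d. lp i) + (\<Sum>i<d. ln' i) = (\<Sum>i<d. \<bar>l i\<bar>)"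
    unfolding sum.distrib[symmetric] by (intro sum.cong refl) (auto simp: lp_def ln'_def max_def)
  then have te: "\<tau> \<le> \<epsilon>" using t by (simp add: tn \<tau>_def[symmetric])
  have d0: "d > 0"
  proof (rule ccontr)
    assume "\<not> d > 0"
    then have "mat_trace \<rho> = 0" using rc by (simp add: mat_trace_def)
    then show False using rp by simp
  qed
  show "ent d r \<le> ent d w + 2 + \<epsilon> * ln (real d)"
  proof -
    define M where "M = \<rho> + P"
    have Mc: "M \<in> carrier_mat d d" using rc Pc by (simp add: M_def)
    have qM: "Re (qf d M y) = Re (qf d \<rho> y) + Re (qf d P y)" "Re (qf d M y) = Re (qf d \<omega> y) + Re (qf d N y)" for y
      using qPN[of y] by (simp_all add: M_def qf_add[OF rc Pc])
    have iM: "Im (qf d M y) = 0" for y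
      using rp(1) pP by (simp add: M_def qf_add[OF rc Pc] psd_iff)
    have pM: "psd d M"
      unfolding psd_iff using Mc iM qM(1) psd_qf(2)[OF rp(1)] psd_qf(2)[OF pP] by simp
    obtain v m where sM: "spec d M v m" "\<And>i. i < d \<Longrightarrow> 0 \<le> m i" using psd_obtain_spec[OF pM] by blast
    have le: "psd d (M - \<rho>)" "psd d (M - P)" 
      unfolding psd_iff using Mc rc Pc iM qM(1) rp(1) pP psd_qf(2)[OF rp(1)] psd_qf(2)[OF pP]
      by (auto simp: qf_minus[OF Mc rc] qf_minus[OF Mc Pc] psd_iff)
    have mv: "Re (qf d M (v j)) = m j" if "j < d" for j using spec_eigenvalue[OF sM(1) that] by simp
    have em: "ent d m = cross d M v m" unfolding ent_def cross_def by (intro sum.cong refl) (simp add: mv)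
    have em1: "ent d m = cross d \<rho> v m + cross d P v m"
      unfolding em cross_def by (simp only: qM(1) distrib_right sum.distrib)
    have em2: "ent d m = cross d \<omega> v m + cross d N v m"
      unfolding em cross_def by (simp only: qM(2) distrib_right sum.distrib)
    have trM: "Re (mat_trace M) = 1 + \<tau>"
      by (simp add: M_def trace_add[OF rc Pc] rp trace_spec[OF sP] \<tau>_def)
    have "cross d \<omega> v m \<le> ent d w + Re (mat_trace M) - Re (mat_trace \<omega>)"
    proof (rule cross_le_ent[OF wp(1) w(2) pM sM(1)])
      fix j assume "j < d" "m j = 0"
      then show "Re (qf d \<omega> (v j)) = 0"
        using mv[of j] qM(2)[of "v j"] psd_qf(2)[OF wp(1), of "v j"] psd_qf(2)[OF pN, of "v j"] by linarith
    qed
    moreover have "cross d N v m \<le> ent d ln' + Re (mat_trace M) - Re (mat_trace N)"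
    proof (rule cross_le_ent[OF pN sN pM sM(1)])
      fix j assume "j < d" "m j = 0"
      then show "Re (qf d N (v j)) = 0"
        using mv[of j] qM(2)[of "v j"] psd_qf(2)[OF wp(1), of "v j"] psd_qf(2)[OF pN, of "v j"] by linarith
    qed
    moreover have "Re (mat_trace N) = \<tau>" by (simp add: trace_spec[OF sN] tn)
    \<comment> \<open>The eigenvalues of \<open>N\<close> lie between 0 and 1, so its entropy term
      has the helpful sign.\<close>
    moreover have "ent d ln' \<le> 0"
      unfolding ent_def
    proof (rule sum_nonpos)
      fix i assume "i \<in> {..<d}"
      then have "ln' i \<le> (\<Sum>i<d. ln' i)" by (intro member_le_sum) (auto simp: ln'_def)
      then have "ln' i \<le> 1" using te t(2) tn by linarith
      moreover have "0 \<le> ln' i" by (simp add: ln'_def)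
      ultimately show "ln' i * ln (ln' i) \<le> 0"
        by (cases "ln' i = 0") (auto simp: mult_le_0_iff)
    qed
    moreover have "ent d r \<le> cross d \<rho> v m" by (rule ent_le_cross[OF rp(1) r(2) sM(1) le(1)])
    moreover have "ent d lp \<le> cross d P v m" by (rule ent_le_cross[OF pP sP sM(1) le(2)])
    \<comment> \<open>Comparison with the uniform distribution, that is
      \<open>ln y \<le> y - 1\<close> at \<open>y = 1 / (lp i * d)\<close>. The 1 lost here and the
      1 lost in the Klein bound for \<open>N\<close> make up the constant 2.\<close>
    moreover have "ent d lp \<ge> \<tau> - 1 - \<tau> * ln (real d)"
    proof -
      have "lp i * ln (lp i) \<ge> lp i - 1 / real d - lp i * ln (real d)" for i
      proof (cases "lp i = 0")
        case False
        then have li: "lp i > 0" by (auto simp: lp_def max_def split: if_splits)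
        have "ln (1 / (lp i * real d)) \<le> 1 / (lp i * real d) - 1" using li d0 by (intro ln_le_minus_one) simp
        then have "lp i * ln (1 / (lp i * real d)) \<le> lp i * (1 / (lp i * real d) - 1)" using li by (intro mult_left_mono) auto
        then show ?thesis using li d0 by (simp add: ln_div ln_mult algebra_simps)
      qed (simp add: d0)
      then have "(\<Sum>i<d. lp i - 1 / real d - lp i * ln (real d)) \<le> ent d lp" unfolding ent_def by (intro sum_mono)
      moreover have "(\<Sum>i<d. lp i - 1 / real d - lp i * ln (real d)) = \<tau> - 1 - \<tau> * ln (real d)"
        using d0 by (simp add: sum_subtractf \<tau>_def sum_distrib_right)
      ultimately show ?thesis by simp
    qed
    moreover have "\<tau> * ln (real d) \<le> \<epsilon> * ln (real d)" using te d0 by (intro mult_right_mono) auto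
    ultimately show ?thesis using em1 em2 trM wp(2) by simp
  qed
  fix v s c assume ov: "onb d v" and c: "0 < c" and s: "\<And>j. j < d \<Longrightarrow> c \<le> s j \<and> s j \<le> (1::real)"
  have "cross d \<omega> v s - cross d \<rho> v s = (\<Sum>j<d. (Re (qf d P (v j)) - Re (qf d N (v j))) * ln (s j))"
    unfolding cross_def sum_subtractf[symmetric] left_diff_distrib[symmetric] qPN ..
  also have "\<dots> \<le> (\<Sum>j<d. Re (qf d N (v j)) * ln (1 / c))"
  proof (rule sum_mono)
    fix j assume "j \<in> {..<d}"
    then have j: "c \<le> s j" "s j \<le> 1" using s by auto
    have "Re (qf d P (v j)) * ln (s j) \<le> 0" using psd_qf(2)[OF pP] j c by (intro mult_nonneg_nonpos) auto
    moreover have "Re (qf d N (v j)) * (- ln (s j)) \<le> Re (qf d N (v j)) * ln (1 / c)"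
      using psd_qf(2)[OF pN] j c by (intro mult_left_mono) (auto simp: ln_div)
    ultimately show "(Re (qf d P (v j)) - Re (qf d N (v j))) * ln (s j) \<le> Re (qf d N (v j)) * ln (1 / c)"
      by (simp add: left_diff_distrib)
  qed
  also have "\<dots> = \<tau> * ln (1 / c)"
    unfolding sum_distrib_right[symmetric] trace_qf_real[OF Nc ov] by (simp add: trace_spec[OF sN] tn)
  also have "\<dots> \<le> \<epsilon> * ln (1 / c)"
  proof -
    have "c \<le> 1" using s[OF d0] by linarith
    then show ?thesis using te c by (intro mult_right_mono) auto
  qed
  finally show "cross d \<omega> v s - cross d \<rho> v s \<le> \<epsilon> * ln (1 / c)" .
qed

text \<open>Mixing \<open>s\<close> equally with the maximally mixed state costs a factor 2 in
  \<open>lam\<close> but bounds all eigenvalues below by \<open>1 / (2 d)\<close>. The support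
  becomes full, so the relative entropy is finite, and passing from \<open>\<omega>\<close> to
  \<open>\<rho>\<close> lowers the cross term by at most
  \<open>\<epsilon> * ln (2 d)\<close>.\<close>

lemma rel_entropy_upper_bound:
  assumes w: "density d \<omega>" and r: "density d \<rho>" and t: "1 / 2 * trace_norm (\<omega> - \<rho>) \<le> \<epsilon>" "\<epsilon> \<le> 1"
    and s: "density d s" and L: "lam > 0" "psd d (complex_of_real lam \<cdot>\<^sub>m s - \<omega>)"
  shows "rel_entropy \<rho> (complex_of_real (1 / 2) \<cdot>\<^sub>m s + complex_of_real (1 / (2 * real d)) \<cdot>\<^sub>m 1\<^sub>m d)
    \<le> ereal ((ln (2 * lam) + 2 + \<epsilon> * ln (real d) + \<epsilon> * ln (2 * real d)) / ln 2)"
proof -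
  define \<sigma> where "\<sigma> = complex_of_real (1 / 2) \<cdot>\<^sub>m s + complex_of_real (1 / (2 * real d)) \<cdot>\<^sub>m 1\<^sub>m d"
  have wp: "psd d \<omega>" "mat_trace \<omega> = 1" and rp: "psd d \<rho>" "mat_trace \<rho> = 1" and sp: "psd d s" "mat_trace s = 1"
    using w r s by (auto simp: density_def)
  note wc = psd_carrier[OF wp(1)] and rc = psd_carrier[OF rp(1)] and sc = psd_carrier[OF sp(1)]
  have \<sigma>c: "\<sigma> \<in> carrier_mat d d" using sc by (simp add: \<sigma>_def)
  have d0: "d > 0"
  proof (rule ccontr)
    assume "\<not> d > 0"
    then have "mat_trace \<rho> = 0" using rc by (simp add: mat_trace_def)
    then show False using rp by simp
  qed
  have q\<sigma>: "qf d \<sigma> y = complex_of_real (1 / 2 * Re (qf d s y) + 1 / (2 * real d) * (\<Sum>i<d. (cmod (y i))\<^sup>2))" for y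
  proof -
    have "qf d \<sigma> y = complex_of_real (1 / 2) * qf d s y + complex_of_real (1 / (2 * real d)) * qf d (1\<^sub>m d) y"
      unfolding \<sigma>_def using sc by (simp add: qf_add[of _ d] qf_smult)
    then show ?thesis unfolding qf_one by (subst (asm) psd_qf(1)[OF sp(1)]) simp
  qed
  have ps: "psd d \<sigma>"
  proof (rule psdI[OF \<sigma>c])
    fix y
    have "0 \<le> 1 / 2 * Re (qf d s y) + 1 / (2 * real d) * (\<Sum>i<d. (cmod (y i))\<^sup>2)"
      using psd_qf(2)[OF sp(1), of y] by (intro add_nonneg_nonneg mult_nonneg_nonneg sum_nonneg) auto
    then show "\<exists>r\<ge>0. qf d \<sigma> y = complex_of_real r" using q\<sigma> by blast
  qed
  obtain v m where sv: "spec d \<sigma> v m" "\<And>i. i < d \<Longrightarrow> 0 \<le> m i" using psd_obtain_spec[OF ps] by blast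
  have ov: "onb d v" by (rule spec_onb[OF sv(1)])
  have m: "1 / (2 * real d) \<le> m j \<and> m j \<le> 1" if "j < d" for j
  proof -
    have "complex_of_real (m j) = complex_of_real (1 / 2 * Re (qf d s (v j)) + 1 / (2 * real d) * 1)"
      using q\<sigma>[of "v j"] unfolding spec_eigenvalue[OF sv(1) that] onb_norm[OF ov that] .
    then have mj: "m j = 1 / 2 * Re (qf d s (v j)) + 1 / (2 * real d)" by (simp only: of_real_eq_iff mult_1_right)
    have "Re (qf d s (v j)) \<le> (\<Sum>j<d. Re (qf d s (v j)))"
      using that psd_qf(2)[OF sp(1)] by (intro member_le_sum) auto
    also have "\<dots> = 1" by (simp add: trace_qf_real[OF sc ov] sp)
    finally have "Re (qf d s (v j)) \<le> 1" .
    moreover have "0 \<le> Re (qf d s (v j))" by (rule psd_qf(2)[OF sp(1)])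
    moreover have "1 / (2 * real d) \<le> 1 / 2" using d0 by (simp add: field_simps)
    ultimately show ?thesis unfolding mj by simp
  qed
  have mpos: "m j > 0" if "j < d" for j
  proof -
    have "0 < 1 / (2 * real d)" using d0 by simp
    then show ?thesis using m[OF that] by linarith
  qed
  obtain uw ww where sw: "spec d \<omega> uw ww" using psd_obtain_spec[OF wp(1)] by blast
  obtain ur rr where sr: "spec d \<rho> ur rr" using psd_obtain_spec[OF rp(1)] by blast
  have "Im (qf d (\<omega> - \<rho>) y) = 0" for y
    using wp(1) rp(1) by (simp add: qf_minus[OF wc rc] psd_iff)
  then obtain x l where X: "spec d (\<omega> - \<rho>) x l"
    using real_qf_spec[of "\<omega> - \<rho>" d, OF minus_carrier_mat[OF rc]] by blast
  have tl: "(\<Sum>i<d. \<bar>l i\<bar>) \<le> 2 * \<epsilon>" using t(1) by (simp add: trace_norm_spec[OF X])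
  note ec = entropy_continuity[OF w sw r sr X tl t(2)]
  have c2: "cross d \<omega> v m - cross d \<rho> v m \<le> \<epsilon> * ln (1 / (1 / (2 * real d)))"
    by (rule ec(2)[OF ov _ m]) (use d0 in simp)
  have s2: "spec d (complex_of_real (2 * lam) \<cdot>\<^sub>m \<sigma>) v (\<lambda>j. 2 * lam * m j)"
    using sv(1) \<sigma>c by (auto simp: spec_def sum_distrib_left mult.assoc)
  have "psd d (complex_of_real (2 * lam) \<cdot>\<^sub>m \<sigma> - \<omega>)"
  proof (rule psdI)
    fix y
    have 1: "Re (qf d \<omega> y) \<le> lam * Re (qf d s y)"
      using psd_qf(2)[OF L(2), of y] sc by (simp add: qf_minus[OF _ wc] qf_smult)
    have "qf d (complex_of_real (2 * lam) \<cdot>\<^sub>m \<sigma> - \<omega>) y = complex_of_real (2 * lam) * qf d \<sigma> y - qf d \<omega> y"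
      using \<sigma>c by (simp add: qf_minus[OF _ wc] qf_smult)
    also have "\<dots> = complex_of_real (2 * lam * (1 / 2 * Re (qf d s y) + 1 / (2 * real d) * (\<Sum>i<d. (cmod (y i))\<^sup>2)) - Re (qf d \<omega> y))"
      unfolding q\<sigma> by (subst psd_qf(1)[OF wp(1)]) (simp only: of_real_mult of_real_diff)
    finally have "qf d (complex_of_real (2 * lam) \<cdot>\<^sub>m \<sigma> - \<omega>) y
      = complex_of_real (2 * lam * (1 / 2 * Re (qf d s y) + 1 / (2 * real d) * (\<Sum>i<d. (cmod (y i))\<^sup>2)) - Re (qf d \<omega> y))" .
    moreover have "0 \<le> 2 * lam * (1 / 2 * Re (qf d s y) + 1 / (2 * real d) * (\<Sum>i<d. (cmod (y i))\<^sup>2)) - Re (qf d \<omega> y)"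
    proof -
      have "0 \<le> 2 * lam * (1 / (2 * real d) * (\<Sum>i<d. (cmod (y i))\<^sup>2))"
        using L(1) by (intro mult_nonneg_nonneg sum_nonneg) auto
      then show ?thesis using 1 by (simp only: distrib_left)
    qed
    ultimately show "\<exists>r\<ge>0. qf d (complex_of_real (2 * lam) \<cdot>\<^sub>m \<sigma> - \<omega>) y = complex_of_real r" by blast
  qed (use \<sigma>c wc in auto)
  from ent_le_cross[OF wp(1) sw s2 this] have "ent d ww \<le> cross d \<omega> v (\<lambda>j. 2 * lam * m j)" .
  also have "\<dots> = (\<Sum>j<d. Re (qf d \<omega> (v j)) * ln (m j) + Re (qf d \<omega> (v j)) * ln (2 * lam))"
    unfolding cross_def
  proof (intro sum.cong refl)
    fix j assume "j \<in> {..<d}"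
    then have "ln (2 * lam * m j) = ln (2 * lam) + ln (m j)" using L(1) mpos[of j] by (intro ln_mult_pos) auto
    then show "Re (qf d \<omega> (v j)) * ln (2 * lam * m j) = Re (qf d \<omega> (v j)) * ln (m j) + Re (qf d \<omega> (v j)) * ln (2 * lam)"
      by (simp add: distrib_left)
  qed
  also have "\<dots> = cross d \<omega> v m + ln (2 * lam)"
    unfolding sum.distrib sum_distrib_right[symmetric] trace_qf_real[OF wc ov] by (simp add: cross_def wp)
  finally have e1: "ent d ww \<le> cross d \<omega> v m + ln (2 * lam)" .
  have "supp \<rho> \<subseteq> supp \<sigma>"
    using supp_full[OF sv(1)] supp_subset_carrier[OF rc] mpos by (metis less_irrefl subset_trans)
  then have "rel_entropy \<rho> \<sigma> = ereal ((ent d rr - cross d \<rho> v m) / ln 2)"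
    by (rule rel_entropy_spec[OF rp(1) sr ps sv(1)])
  also have "\<dots> \<le> ereal ((ln (2 * lam) + 2 + \<epsilon> * ln (real d) + \<epsilon> * ln (2 * real d)) / ln 2)"
    using e1 ec(1) c2 by (simp add: divide_le_cancel)
  finally show ?thesis unfolding \<sigma>_def .
qed

section \<open>Tensor products\<close>

text \<open>\<open>f\<close> and \<open>g\<close> read off the two component indices of a composite
  index. Keeping them abstract serves both \<open>kron\<close> and the reordered
  \<open>bi_tensor\<close>.\<close>

definition pidx :: "nat \<Rightarrow> (nat \<Rightarrow> nat) \<Rightarrow> (nat \<Rightarrow> nat) \<Rightarrow> nat \<Rightarrow> nat \<Rightarrow> bool" where
  "pidx N f g d1 d2 \<longleftrightarrow> bij_betw (\<lambda>k. (f k, g k)) {..<N} ({..<d1} \<times> {..<d2})"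

definition tens :: "nat \<Rightarrow> (nat \<Rightarrow> nat) \<Rightarrow> (nat \<Rightarrow> nat) \<Rightarrow> complex mat \<Rightarrow> complex mat \<Rightarrow> complex mat" where
  "tens N f g A B = mat N N (\<lambda>(k, l). A $$ (f k, f l) * B $$ (g k, g l))"

lemma sum_pidx:
  assumes "pidx N f g d1 d2"
  shows "(\<Sum>k<N. F (f k) (g k)) = (\<Sum>i<d1. \<Sum>j<d2. F i j)"
proof -
  have "(\<Sum>k<N. (\<lambda>(i, j). F i j) ((\<lambda>k. (f k, g k)) k)) = sum (\<lambda>(i, j). F i j) ({..<d1} \<times> {..<d2})"
    by (rule sum.reindex_bij_betw[OF assms[unfolded pidx_def]])
  then show ?thesis by (simp add: sum.cartesian_product)
qed

lemma pidx_less: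
  assumes "pidx N f g d1 d2" "k < N" shows "f k < d1" "g k < d2"
  using assms by (auto simp: pidx_def bij_betw_def)

lemma pidx_inj:
  assumes "pidx N f g d1 d2" "k < N" "l < N" shows "f k = f l \<and> g k = g l \<longleftrightarrow> k = l"
  using assms by (auto simp: pidx_def bij_betw_def inj_on_def)

text \<open>Injectivity suffices, as both finite sets have the same size.\<close>

lemma pidxI:
  assumes "\<And>k. k < N \<Longrightarrow> f k < d1 \<and> g k < d2"
    and "\<And>k l. k < N \<Longrightarrow> l < N \<Longrightarrow> f k = f l \<Longrightarrow> g k = g l \<Longrightarrow> k = l" and "N = d1 * d2"
  shows "pidx N f g d1 d2"
proof -
  have inj: "inj_on (\<lambda>k. (f k, g k)) {..<N}" using assms(2) by (auto simp: inj_on_def)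
  have sub: "(\<lambda>k. (f k, g k)) ` {..<N} \<subseteq> {..<d1} \<times> {..<d2}" using assms(1) by auto
  have "card ((\<lambda>k. (f k, g k)) ` {..<N}) = card ({..<d1} \<times> {..<d2})"
    unfolding card_image[OF inj] using assms(3) by (simp add: card_cartesian_product)
  then have "(\<lambda>k. (f k, g k)) ` {..<N} = {..<d1} \<times> {..<d2}" using sub by (intro card_subset_eq) auto
  then show ?thesis using inj by (simp add: pidx_def bij_betw_def)
qed

section \<open>Index arithmetic of the two concrete tensor products\<close>

lemma pidx_kron: "pidx (a * b) (\<lambda>k. k div b) (\<lambda>k. k mod b) a b"
proof (rule pidxI)
  fix k assume k: "k < a * b"
  then have "b > 0" by (cases b) auto
  then show "k div b < a \<and> k mod b < b" using k by (simp add: less_mult_imp_div_less)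
next
  fix k l :: nat assume "k div b = l div b" "k mod b = l mod b"
  then show "k = l" by (metis div_mod_decomp)
qed simp

lemma bi_idx_digits:
  assumes "k < (a1 * a2) * (b1 * b2)"
  shows "bi_idx1 b1 a2 b2 k div b1 = (k div (b1 * b2)) div a2" "bi_idx1 b1 a2 b2 k mod b1 = (k mod (b1 * b2)) div b2"
    "bi_idx2 b1 a2 b2 k div b2 = (k div (b1 * b2)) mod a2" "bi_idx2 b1 a2 b2 k mod b2 = (k mod (b1 * b2)) mod b2"
    "k div (b1 * b2) < a1 * a2" "(k div (b1 * b2)) div a2 < a1" "(k mod (b1 * b2)) div b2 < b1"
    "(k div (b1 * b2)) mod a2 < a2" "(k mod (b1 * b2)) mod b2 < b2"
proof -
  have pos: "a1 > 0" "a2 > 0" "b1 > 0" "b2 > 0"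
    using assms by (auto intro: Nat.gr0I)
  show k1: "k div (b1 * b2) < a1 * a2" using assms by (simp add: less_mult_imp_div_less)
  then show "(k div (b1 * b2)) div a2 < a1" by (simp add: less_mult_imp_div_less)
  have "k mod (b1 * b2) < b1 * b2" using pos by simp
  then show j1: "(k mod (b1 * b2)) div b2 < b1" by (simp add: less_mult_imp_div_less)
  show "(k div (b1 * b2)) mod a2 < a2" "(k mod (b1 * b2)) mod b2 < b2" using pos by auto
  show "bi_idx1 b1 a2 b2 k div b1 = (k div (b1 * b2)) div a2" "bi_idx1 b1 a2 b2 k mod b1 = (k mod (b1 * b2)) div b2"
    using j1 pos by (simp_all add: bi_idx1_def div_mult_self3)
  show "bi_idx2 b1 a2 b2 k div b2 = (k div (b1 * b2)) mod a2" "bi_idx2 b1 a2 b2 k mod b2 = (k mod (b1 * b2)) mod b2"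
    using pos by (simp_all add: bi_idx2_def)
qed

lemma digits_less: "i < a \<Longrightarrow> j < b \<Longrightarrow> i * b + j < a * (b::nat)"
proof -
  assume "i < a" "j < b"
  then have "i * b + j < Suc i * b" by simp
  also have "\<dots> \<le> a * b" using \<open>i < a\<close> by (intro mult_le_mono1) simp
  finally show ?thesis .
qed

lemma pidx_bi: "pidx ((a1 * a2) * (b1 * b2)) (bi_idx1 b1 a2 b2) (bi_idx2 b1 a2 b2) (a1 * b1) (a2 * b2)"
proof (rule pidxI)
  fix k assume k: "k < (a1 * a2) * (b1 * b2)"
  show "bi_idx1 b1 a2 b2 k < a1 * b1 \<and> bi_idx2 b1 a2 b2 k < a2 * b2"
    unfolding bi_idx1_def bi_idx2_def using bi_idx_digits[OF k] by (auto intro!: digits_less)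
next
  fix k l assume k: "k < (a1 * a2) * (b1 * b2)" and l: "l < (a1 * a2) * (b1 * b2)"
    and e: "bi_idx1 b1 a2 b2 k = bi_idx1 b1 a2 b2 l" "bi_idx2 b1 a2 b2 k = bi_idx2 b1 a2 b2 l"
  have "k div (b1 * b2) = l div (b1 * b2)" "k mod (b1 * b2) = l mod (b1 * b2)"
    using bi_idx_digits(1,3)[OF k] bi_idx_digits(1,3)[OF l] bi_idx_digits(2,4)[OF k] bi_idx_digits(2,4)[OF l] e
    by (metis div_mod_decomp)+
  then show "k = l" by (metis div_mod_decomp)
qed (simp add: mult_ac)

lemma ip_pidx:
  assumes "pidx N f g d1 d2"
  shows "ip N (\<lambda>k. x (f k) * y (g k)) (\<lambda>k. x' (f k) * y' (g k)) = ip d1 x x' * ip d2 y y'"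
proof -
  have "ip N (\<lambda>k. x (f k) * y (g k)) (\<lambda>k. x' (f k) * y' (g k)) = (\<Sum>i<d1. \<Sum>j<d2. (cnj (x i) * x' i) * (cnj (y j) * y' j))"
    unfolding ip_def by (subst sum_pidx[OF assms, symmetric]) (simp add: mult_ac)
  then show ?thesis by (simp add: ip_def sum_product)
qed

lemma spec_tens:
  assumes p: "pidx N f g d1 d2" and "spec d1 A u l" "spec d2 B v m"
  shows "spec N (tens N f g A B) (\<lambda>n k. u (f n) (f k) * v (g n) (g k)) (\<lambda>n. l (f n) * m (g n))"
  unfolding spec_def
proof (intro conjI allI impI)
  show "tens N f g A B \<in> carrier_mat N N" by (simp add: tens_def)
  show "onb N (\<lambda>n k. u (f n) (f k) * v (g n) (g k))"
  proof (rule onbI)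
    fix i j assume ij: "i < N" "j < N"
    have "ip N (\<lambda>k. u (f i) (f k) * v (g i) (g k)) (\<lambda>k. u (f j) (f k) * v (g j) (g k)) = of_bool (f i = f j) * of_bool (g i = g j)"
      unfolding ip_pidx[OF p] using pidx_less[OF p ij(1)] pidx_less[OF p ij(2)]
        onb_ip[OF spec_onb[OF assms(2)]] onb_ip[OF spec_onb[OF assms(3)]] by simp
    then show "ip N (\<lambda>k. u (f i) (f k) * v (g i) (g k)) (\<lambda>k. u (f j) (f k) * v (g j) (g k)) = of_bool (i = j)"
      using pidx_inj[OF p ij] by (auto simp: of_bool_def split: if_splits)
  qed
  fix k n assume kn: "k < N" "n < N"
  have "tens N f g A B $$ (k, n) = (\<Sum>i<d1. complex_of_real (l i) * u i (f k) * cnj (u i (f n))) * (\<Sum>j<d2. complex_of_real (m j) * v j (g k) * cnj (v j (g n)))"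
    using assms kn pidx_less[OF p kn(1)] pidx_less[OF p kn(2)] by (simp add: tens_def spec_def)
  also have "\<dots> = (\<Sum>i<d1. \<Sum>j<d2. complex_of_real (l i * m j) * (u i (f k) * v j (g k)) * cnj (u i (f n) * v j (g n)))"
    unfolding sum_product by (intro sum.cong refl) (simp add: mult_ac)
  also have "\<dots> = (\<Sum>i<N. complex_of_real (l (f i) * m (g i)) * (u (f i) (f k) * v (g i) (g k)) * cnj (u (f i) (f n) * v (g i) (g n)))"
    by (rule sum_pidx[OF p, symmetric])
  finally show "tens N f g A B $$ (k, n) = (\<Sum>i<N. complex_of_real (l (f i) * m (g i)) * (u (f i) (f k) * v (g i) (g k)) * cnj (u (f i) (f n) * v (g i) (g n)))" .
qed

lemma qf_tens:
  assumes p: "pidx N f g d1 d2"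
  shows "qf N (tens N f g A B) (\<lambda>k. x (f k) * y (g k)) = qf d1 A x * qf d2 B y"
proof -
  have "qf N (tens N f g A B) (\<lambda>k. x (f k) * y (g k))
    = (\<Sum>k<N. \<Sum>n<N. (cnj (x (f k)) * A $$ (f k, f n) * x (f n)) * (cnj (y (g k)) * B $$ (g k, g n) * y (g n)))"
    unfolding qf_def by (intro sum.cong refl) (simp add: tens_def mult_ac)
  also have "\<dots> = (\<Sum>k<N. \<Sum>i'<d1. \<Sum>j'<d2. (cnj (x (f k)) * A $$ (f k, i') * x i') * (cnj (y (g k)) * B $$ (g k, j') * y j'))"
    by (intro sum.cong refl sum_pidx[OF p])
  also have "\<dots> = (\<Sum>i<d1. \<Sum>j<d2. \<Sum>i'<d1. \<Sum>j'<d2. (cnj (x i) * A $$ (i, i') * x i') * (cnj (y j) * B $$ (j, j') * y j'))"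
    by (rule sum_pidx[OF p])
  also have "\<dots> = (\<Sum>i<d1. \<Sum>i'<d1. cnj (x i) * A $$ (i, i') * x i') * (\<Sum>j<d2. \<Sum>j'<d2. cnj (y j) * B $$ (j, j') * y j')"
    unfolding sum_product by simp
  finally show ?thesis by (simp add: qf_def)
qed

lemma psd_tens:
  assumes p: "pidx N f g d1 d2" and "psd d1 A" "psd d2 B"
  shows "psd N (tens N f g A B)"
proof -
  obtain u l where u: "spec d1 A u l" "\<And>i. i < d1 \<Longrightarrow> 0 \<le> l i" using psd_obtain_spec[OF assms(2)] by blast
  obtain v m where v: "spec d2 B v m" "\<And>i. i < d2 \<Longrightarrow> 0 \<le> m i" using psd_obtain_spec[OF assms(3)] by blast
  show ?thesis
    by (rule spec_psd[OF spec_tens[OF p u(1) v(1)]]) (use u v pidx_less[OF p] in auto)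
qed

lemma trace_tens:
  assumes p: "pidx N f g d1 d2" and "A \<in> carrier_mat d1 d1" "B \<in> carrier_mat d2 d2"
  shows "mat_trace (tens N f g A B) = mat_trace A * mat_trace B"
proof -
  have "mat_trace (tens N f g A B) = (\<Sum>k<N. A $$ (f k, f k) * B $$ (g k, g k))"
    by (simp add: mat_trace_def tens_def)
  also have "\<dots> = (\<Sum>i<d1. \<Sum>j<d2. A $$ (i, i) * B $$ (j, j))" by (rule sum_pidx[OF p])
  finally show ?thesis using assms(2,3) by (simp add: mat_trace_def sum_product)
qed

lemma kron_tens:
  assumes "A \<in> carrier_mat a a" "B \<in> carrier_mat b b"
  shows "kron A B = tens (a * b) (\<lambda>k. k div b) (\<lambda>k. k mod b) A B"
  using assms by (simp add: kron_def tens_def)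

lemma bi_tensor_tens:
  "bi_tensor a1 b1 a2 b2 X Y = tens ((a1 * a2) * (b1 * b2)) (bi_idx1 b1 a2 b2) (bi_idx2 b1 a2 b2) X Y"
  by (simp add: bi_tensor_def tens_def)

lemma psd_kron: "psd a A \<Longrightarrow> psd b B \<Longrightarrow> psd (a * b) (kron A B)"
  by (simp add: kron_tens[OF psd_carrier psd_carrier] psd_tens[OF pidx_kron])

lemma trace_kron: "psd a A \<Longrightarrow> psd b B \<Longrightarrow> mat_trace (kron A B) = mat_trace A * mat_trace B"
  by (simp add: kron_tens[OF psd_carrier psd_carrier] trace_tens[OF pidx_kron] psd_carrier)

lemma density_bi_tensor:
  "density (a1 * b1) X \<Longrightarrow> density (a2 * b2) Y \<Longrightarrow> density ((a1 * a2) * (b1 * b2)) (bi_tensor a1 b1 a2 b2 X Y)"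
  by (auto simp: bi_tensor_tens density_def trace_tens[OF pidx_bi] psd_carrier intro: psd_tens[OF pidx_bi])

lemma psd_one: "psd d (1\<^sub>m d)"
proof (rule psdI)
  show "\<exists>r\<ge>0. qf d (1\<^sub>m d) x = complex_of_real r" for x
    by (intro exI[of _ "\<Sum>i<d. (cmod (x i))\<^sup>2"] conjI sum_nonneg qf_one) simp
qed simp

lemma density_bi_power: "density (a * b) \<rho> \<Longrightarrow> density (a ^ n * b ^ n) (bi_power a b n \<rho>)"
proof (induction n)
  case 0
  show ?case using psd_one[of 1] by (simp add: density_def mat_trace_def)
next
  case (Suc n)
  show ?case using density_bi_tensor[OF Suc.IH[OF Suc.prems] Suc.prems] by (simp add: mult_ac)
qed

section \<open>The separable cone\<close>

text \<open>The cone over product operators, kept free of weights and normalisation so that sums and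
  scalings need no bookkeeping. Its elements of trace one are exactly \<open>sep a b\<close>, by
  \<open>sep_scone\<close> and \<open>scone_sep\<close>.\<close>

definition scone :: "nat \<Rightarrow> nat \<Rightarrow> complex mat set" where
  "scone a b = {X. X \<in> carrier_mat (a * b) (a * b) \<and> (\<exists>(n :: nat) \<alpha> \<beta>.
     (\<forall>k<n. psd a (\<alpha> k) \<and> psd b (\<beta> k)) \<and>
     (\<forall>i<a * b. \<forall>j<a * b. X $$ (i, j) = (\<Sum>k<n. kron (\<alpha> k) (\<beta> k) $$ (i, j))))}"

lemma psd_smult: "psd d A \<Longrightarrow> 0 \<le> c \<Longrightarrow> psd d (complex_of_real c \<cdot>\<^sub>m A)"
  by (auto simp: psd_iff qf_smult)

lemma kron_carrier: "psd a A \<Longrightarrow> psd b B \<Longrightarrow> kron A B \<in> carrier_mat (a * b) (a * b)"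
  using psd_kron psd_carrier by blast

lemma scone_carrier: "X \<in> scone a b \<Longrightarrow> X \<in> carrier_mat (a * b) (a * b)"
  by (simp add: scone_def)

lemma scone_kron:
  assumes "psd a A" "psd b B" shows "kron A B \<in> scone a b"
  unfolding scone_def using assms kron_carrier[OF assms]
  by (intro CollectI conjI exI[of _ "1 :: nat"] exI[of _ "\<lambda>_. A"] exI[of _ "\<lambda>_. B"]) auto

lemma smult_index: "A \<in> carrier_mat n m \<Longrightarrow> i < n \<Longrightarrow> j < m \<Longrightarrow> (c \<cdot>\<^sub>m A) $$ (i, j) = c * A $$ (i, j)"
  by simp

lemma mat_trace_carrier: "A \<in> carrier_mat d d \<Longrightarrow> mat_trace A = (\<Sum>i<d. A $$ (i, i))"
  by (simp add: mat_trace_def)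

lemma scone_zero: "0\<^sub>m (a * b) (a * b) \<in> scone a b"
  unfolding scone_def by (auto intro!: exI[of _ "0 :: nat"])

lemma sum_lessThan_add: "(\<Sum>k<n + m. f k) = (\<Sum>k<n. f k) + (\<Sum>k<m. f (n + k))" for n m :: nat
  by (induction m) (simp_all add: add.assoc)

lemma scone_add:
  assumes "X \<in> scone a b" "Y \<in> scone a b" shows "X + Y \<in> scone a b"
proof -
  obtain n \<alpha> \<beta> where X: "X \<in> carrier_mat (a * b) (a * b)" "\<And>k. k < n \<Longrightarrow> psd a (\<alpha> k) \<and> psd b (\<beta> k)"
    "\<And>i j. i < a * b \<Longrightarrow> j < a * b \<Longrightarrow> X $$ (i, j) = (\<Sum>k<(n::nat). kron (\<alpha> k) (\<beta> k) $$ (i, j))"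
    using assms(1) unfolding scone_def by blast
  obtain m \<alpha>' \<beta>' where Y: "Y \<in> carrier_mat (a * b) (a * b)" "\<And>k. k < m \<Longrightarrow> psd a (\<alpha>' k) \<and> psd b (\<beta>' k)"
    "\<And>i j. i < a * b \<Longrightarrow> j < a * b \<Longrightarrow> Y $$ (i, j) = (\<Sum>k<(m::nat). kron (\<alpha>' k) (\<beta>' k) $$ (i, j))"
    using assms(2) unfolding scone_def by blast
  define A where "A k = (if k < n then \<alpha> k else \<alpha>' (k - n))" for k
  define B where "B k = (if k < n then \<beta> k else \<beta>' (k - n))" for k
  have "psd a (A k) \<and> psd b (B k)" if "k < n + m" for k
    using that X(2)[of k] Y(2)[of "k - n"] by (auto simp: A_def B_def)
  moreover have "(X + Y) $$ (i, j) = (\<Sum>k<n + m. kron (A k) (B k) $$ (i, j))" if "i < a * b" "j < a * b" for i j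
    using that X Y by (simp add: sum_lessThan_add A_def B_def)
  ultimately show ?thesis unfolding scone_def using X(1) Y(1)
    by (intro CollectI conjI exI[of _ "n + m"] exI[of _ A] exI[of _ B]) auto
qed

lemma scone_smult:
  assumes "X \<in> scone a b" "0 \<le> c" shows "complex_of_real c \<cdot>\<^sub>m X \<in> scone a b"
proof -
  obtain n \<alpha> \<beta> where X: "X \<in> carrier_mat (a * b) (a * b)" "\<And>k. k < n \<Longrightarrow> psd a (\<alpha> k) \<and> psd b (\<beta> k)"
    "\<And>i j. i < a * b \<Longrightarrow> j < a * b \<Longrightarrow> X $$ (i, j) = (\<Sum>k<(n::nat). kron (\<alpha> k) (\<beta> k) $$ (i, j))"
    using assms(1) unfolding scone_def by blast
  have "psd a (complex_of_real c \<cdot>\<^sub>m \<alpha> k) \<and> psd b (\<beta> k)" if "k < n" for k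
    using X(2)[OF that] psd_smult assms(2) by blast
  moreover have "(complex_of_real c \<cdot>\<^sub>m X) $$ (i, j) = (\<Sum>k<n. kron (complex_of_real c \<cdot>\<^sub>m \<alpha> k) (\<beta> k) $$ (i, j))"
    if ij: "i < a * b" "j < a * b" for i j
  proof -
    have "kron (complex_of_real c \<cdot>\<^sub>m \<alpha> k) (\<beta> k) $$ (i, j) = complex_of_real c * kron (\<alpha> k) (\<beta> k) $$ (i, j)" if "k < n" for k
    proof -
      have c: "\<alpha> k \<in> carrier_mat a a" "\<beta> k \<in> carrier_mat b b" using X(2)[OF that] psd_carrier by auto
      show ?thesis using c ij pidx_less[OF pidx_kron ij(1)] pidx_less[OF pidx_kron ij(2)] by (simp add: kron_def)
    qed
    then show ?thesis using X(1,3) ij by (simp add: sum_distrib_left)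
  qed
  ultimately show ?thesis unfolding scone_def using X(1)
    by (intro CollectI conjI exI[of _ n] exI[of _ "\<lambda>k. complex_of_real c \<cdot>\<^sub>m \<alpha> k"] exI[of _ \<beta>]) auto
qed

lemma scone_sum:
  assumes "finite I" "\<And>k. k \<in> I \<Longrightarrow> X k \<in> scone a b"
  shows "mat (a * b) (a * b) (\<lambda>(i, j). \<Sum>k\<in>I. X k $$ (i, j)) \<in> scone a b"
  using assms
proof (induction I rule: finite_induct)
  case empty
  have "mat (a * b) (a * b) (\<lambda>(i, j). \<Sum>k\<in>{}. X k $$ (i, j)) = 0\<^sub>m (a * b) (a * b)" by auto
  then show ?case using scone_zero by metis
next
  case (insert k I)
  have "X k \<in> carrier_mat (a * b) (a * b)" using insert by (intro scone_carrier) simp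
  then have e: "mat (a * b) (a * b) (\<lambda>(i, j). \<Sum>k\<in>insert k I. X k $$ (i, j)) = X k + mat (a * b) (a * b) (\<lambda>(i, j). \<Sum>k\<in>I. X k $$ (i, j))"
    using insert(1,2) by (intro eq_matI) auto
  show ?case unfolding e by (intro scone_add insert.IH insert.prems) auto
qed

lemma scone_mat_sum:
  assumes "X \<in> scone a b"
  obtains n \<alpha> \<beta> where "\<And>k. k < n \<Longrightarrow> psd a (\<alpha> k) \<and> psd b (\<beta> k)"
    "X = mat (a * b) (a * b) (\<lambda>(i, j). \<Sum>k<(n::nat). 1 * kron (\<alpha> k) (\<beta> k) $$ (i, j))"
proof -
  obtain n \<alpha> \<beta> where X: "X \<in> carrier_mat (a * b) (a * b)" "\<And>k. k < n \<Longrightarrow> psd a (\<alpha> k) \<and> psd b (\<beta> k)"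
    "\<And>i j. i < a * b \<Longrightarrow> j < a * b \<Longrightarrow> X $$ (i, j) = (\<Sum>k<(n::nat). kron (\<alpha> k) (\<beta> k) $$ (i, j))"
    using assms unfolding scone_def by blast
  have "X = mat (a * b) (a * b) (\<lambda>(i, j). \<Sum>k<(n::nat). 1 * kron (\<alpha> k) (\<beta> k) $$ (i, j))"
    using X(1,3) by (intro eq_matI) auto
  then show ?thesis using that X(2) by blast
qed

lemma scone_psd:
  assumes "X \<in> scone a b" shows "psd (a * b) X"
proof (rule scone_mat_sum[OF assms])
  fix n :: nat and \<alpha> \<beta>
  assume ab: "\<And>k. k < n \<Longrightarrow> psd a (\<alpha> k) \<and> psd b (\<beta> k)"
    and X: "X = mat (a * b) (a * b) (\<lambda>(i, j). \<Sum>k<n. 1 * kron (\<alpha> k) (\<beta> k) $$ (i, j))"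
  have p: "psd (a * b) (kron (\<alpha> k) (\<beta> k))" if "k < n" for k using ab[OF that] psd_kron by blast
  show ?thesis
    unfolding psd_iff X qf_mat_sum using p by (auto simp: psd_iff intro!: sum_nonneg)
qed

lemma trace_mat_sum:
  "mat_trace (mat d d (\<lambda>(i, j). \<Sum>k\<in>I. B k $$ (i, j))) = (\<Sum>k\<in>I. \<Sum>i<d. B k $$ (i, i))"
  unfolding mat_trace_def by (subst sum.swap) simp

lemma psd_trace_nonneg: "psd d A \<Longrightarrow> mat_trace A = complex_of_real (Re (mat_trace A)) \<and> 0 \<le> Re (mat_trace A)"
  by (rule psd_obtain_spec, assumption) (auto simp: trace_spec intro!: sum_nonneg)

lemma psd_trace_zero:
  assumes "psd d A" "mat_trace A = 0" shows "A = 0\<^sub>m d d"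
proof -
  obtain u l where u: "spec d A u l" "\<And>i. i < d \<Longrightarrow> 0 \<le> l i" using psd_obtain_spec[OF assms(1)] by blast
  have "complex_of_real (\<Sum>i<d. l i) = 0" using assms(2) by (simp only: trace_spec[OF u(1)])
  then have "(\<Sum>i<d. l i) = 0" by (simp only: of_real_eq_0_iff)
  then have "l i = 0" if "i < d" for i using u(2) that by (subst (asm) sum_nonneg_eq_0_iff) auto
  then show ?thesis using u(1) by (intro eq_matI) (auto simp: spec_def)
qed

lemma sep_scone:
  assumes "\<sigma> \<in> sep a b" shows "\<sigma> \<in> scone a b" "density (a * b) \<sigma>"
proof -
  obtain n :: nat and p \<alpha> \<beta> where s: "\<And>k. k < n \<Longrightarrow> p k \<ge> (0 :: real) \<and> density a (\<alpha> k) \<and> density b (\<beta> k)"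
    "(\<Sum>k<n. p k) = 1"
    "\<sigma> = mat (a * b) (a * b) (\<lambda>(i, j). \<Sum>k<n. complex_of_real (p k) * kron (\<alpha> k) (\<beta> k) $$ (i, j))"
    using assms unfolding sep_def by blast
  have k: "kron (\<alpha> k) (\<beta> k) \<in> scone a b" "mat_trace (kron (\<alpha> k) (\<beta> k)) = 1" "kron (\<alpha> k) (\<beta> k) \<in> carrier_mat (a * b) (a * b)" if "k < n" for k
    using s(1)[OF that] by (auto simp: density_def trace_kron intro: scone_kron kron_carrier)
  have e: "\<sigma> = mat (a * b) (a * b) (\<lambda>(i, j). \<Sum>k<n. (complex_of_real (p k) \<cdot>\<^sub>m kron (\<alpha> k) (\<beta> k)) $$ (i, j))"
    unfolding s(3) by (intro eq_matI) (auto intro!: sum.cong simp: smult_index[OF k(3)])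
  show sc: "\<sigma> \<in> scone a b"
    unfolding e by (rule scone_sum) (use k s in \<open>auto intro!: scone_smult\<close>)
  have "mat_trace \<sigma> = (\<Sum>k<n. complex_of_real (p k) * mat_trace (kron (\<alpha> k) (\<beta> k)))"
    unfolding e trace_mat_sum by (intro sum.cong refl) (auto simp: mat_trace_carrier[OF k(3)] smult_index[OF k(3)] sum_distrib_left)
  also have "\<dots> = complex_of_real (\<Sum>k<n. p k)" by (simp add: k(2))
  finally show "density (a * b) \<sigma>" using scone_psd[OF sc] s(2) by (simp add: density_def)
qed

lemma scone_sep:
  assumes "X \<in> scone a b" "mat_trace X = 1" shows "X \<in> sep a b"
proof (rule scone_mat_sum[OF assms(1)])
  fix n :: nat and \<alpha> \<beta>
  assume ab: "\<And>k. k < n \<Longrightarrow> psd a (\<alpha> k) \<and> psd b (\<beta> k)"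
    and X: "X = mat (a * b) (a * b) (\<lambda>(i, j). \<Sum>k<n. 1 * kron (\<alpha> k) (\<beta> k) $$ (i, j))"
  define s where "s k = Re (mat_trace (\<alpha> k))" for k
  define t where "t k = Re (mat_trace (\<beta> k))" for k
  have st: "mat_trace (\<alpha> k) = complex_of_real (s k)" "mat_trace (\<beta> k) = complex_of_real (t k)" "0 \<le> s k" "0 \<le> t k" if "k < n" for k
    using ab[OF that] psd_trace_nonneg by (auto simp: s_def t_def)
  have kc: "kron (\<alpha> k) (\<beta> k) \<in> carrier_mat (a * b) (a * b)" if "k < n" for k using ab[OF that] kron_carrier by blast
  have "mat_trace X = (\<Sum>k<n. mat_trace (kron (\<alpha> k) (\<beta> k)))"
    unfolding X mult_1 trace_mat_sum by (intro sum.cong refl) (auto simp: mat_trace_carrier[OF kc])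
  also have "\<dots> = (\<Sum>k<n. complex_of_real (s k * t k))" 
  proof (intro sum.cong refl)
    fix k assume "k \<in> {..<n}"
    then show "mat_trace (kron (\<alpha> k) (\<beta> k)) = complex_of_real (s k * t k)"
      using ab[of k] st[of k] trace_kron[of a "\<alpha> k" b "\<beta> k"] by simp
  qed
  finally have "complex_of_real (\<Sum>k<n. s k * t k) = 1" using assms(2) by simp
  then have one: "(\<Sum>k<n. s k * t k) = 1" by (simp only: of_real_eq_1_iff)
  have norm: "density d (complex_of_real (1 / Re (mat_trace A)) \<cdot>\<^sub>m A)" if "psd d A" "Re (mat_trace A) \<noteq> 0" for d A
  proof -
    have "mat_trace (complex_of_real (1 / Re (mat_trace A)) \<cdot>\<^sub>m A) = complex_of_real (1 / Re (mat_trace A)) * complex_of_real (Re (mat_trace A))"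
      unfolding trace_smult[OF psd_carrier[OF that(1)]] using psd_trace_nonneg[OF that(1)] by metis
    also have "\<dots> = complex_of_real (1 / Re (mat_trace A) * Re (mat_trace A))" by (simp only: of_real_mult)
    also have "\<dots> = 1" using that(2) by simp
    finally have t: "mat_trace (complex_of_real (1 / Re (mat_trace A)) \<cdot>\<^sub>m A) = 1" .
    have "psd d (complex_of_real (1 / Re (mat_trace A)) \<cdot>\<^sub>m A)"
      using psd_trace_nonneg[OF that(1)] by (intro psd_smult[OF that(1)]) simp
    then show ?thesis using t by (simp only: density_def)
  qed
  \<comment> \<open>\<open>sep\<close> demands density operators even where the weight is 0; the
    factors of one term \<open>k0\<close> of nonzero trace are reused there.\<close>
  obtain k0 where k0: "k0 < n" "s k0 * t k0 \<noteq> 0"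
    using one by (metis (no_types, lifting) lessThan_iff sum.neutral zero_neq_one)
  define K where "K k = (if s k * t k = 0 then k0 else k)" for k
  have K: "K k < n" "s (K k) \<noteq> 0" "t (K k) \<noteq> 0" if "k < n" for k using k0 that by (auto simp: K_def)
  define A where "A k = complex_of_real (1 / s (K k)) \<cdot>\<^sub>m \<alpha> (K k)" for k
  define B where "B k = complex_of_real (1 / t (K k)) \<cdot>\<^sub>m \<beta> (K k)" for k
  have AB: "density a (A k)" "density b (B k)" if "k < n" for k
    using norm[of a "\<alpha> (K k)"] norm[of b "\<beta> (K k)"] ab K[OF that] by (auto simp: A_def B_def s_def t_def)
  have e: "1 * kron (\<alpha> k) (\<beta> k) $$ (i, j) = complex_of_real (s k * t k) * kron (A k) (B k) $$ (i, j)"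
    if "k < n" and ij: "i < a * b" "j < a * b" for i j k
  proof -
    have c: "\<alpha> k \<in> carrier_mat a a" "\<beta> k \<in> carrier_mat b b" using ab[OF that(1)] psd_carrier by auto
    note less = pidx_less[OF pidx_kron ij(1)] pidx_less[OF pidx_kron ij(2)]
    show ?thesis
    proof (cases "s k * t k = 0")
      case True
      then have "\<alpha> k = 0\<^sub>m a a \<or> \<beta> k = 0\<^sub>m b b"
        using st[OF that(1)] ab[OF that(1)] psd_trace_zero by fastforce
      then have "kron (\<alpha> k) (\<beta> k) $$ (i, j) = 0" using c ij less by (auto simp: kron_def)
      then show ?thesis using True by simp
    next
      case False
      then have "s k \<noteq> 0" "t k \<noteq> 0" "K k = k" by (auto simp: K_def)
      then show ?thesis using c ij less by (simp add: kron_def A_def B_def)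
    qed
  qed
  have "X = mat (a * b) (a * b) (\<lambda>(i, j). \<Sum>k<n. complex_of_real (s k * t k) * kron (A k) (B k) $$ (i, j))"
    unfolding X using e by (intro eq_matI) (auto intro!: sum.cong)
  then show ?thesis unfolding sep_def using AB st one
    by (intro CollectI exI[of _ n] exI[of _ "\<lambda>k. s k * t k"] exI[of _ A] exI[of _ B]) auto
qed

text \<open>Divide by the trace. The zero operator is instead written as 0 times some separable
  state, whence the nonemptiness assumption.\<close>

lemma scone_cone:
  assumes "X \<in> scone a b" "sep a b \<noteq> {}" shows "X \<in> cone (sep a b)"
proof -
  define c where "c = Re (mat_trace X)"
  have p: "psd (a * b) X" by (rule scone_psd[OF assms(1)])
  have c: "mat_trace X = complex_of_real c" "0 \<le> c" using psd_trace_nonneg[OF p] by (auto simp: c_def)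
  show ?thesis
  proof (cases "c = 0")
    case True
    obtain \<sigma> where s: "\<sigma> \<in> sep a b" using assms(2) by blast
    have "X = 0\<^sub>m (a * b) (a * b)" using psd_trace_zero[OF p] c(1) True by simp
    also have "\<dots> = complex_of_real 0 \<cdot>\<^sub>m \<sigma>" using scone_carrier[OF sep_scone(1)[OF s]] by (intro eq_matI) auto
    finally show ?thesis unfolding cone_def using s by blast
  next
    case False
    have "complex_of_real (1 / c) \<cdot>\<^sub>m X \<in> sep a b"
    proof (rule scone_sep)
      show "complex_of_real (1 / c) \<cdot>\<^sub>m X \<in> scone a b" using c by (intro scone_smult[OF assms(1)]) simp
      show "mat_trace (complex_of_real (1 / c) \<cdot>\<^sub>m X) = 1"
        unfolding trace_smult[OF scone_carrier[OF assms(1)]] c(1) using False by simp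
    qed
    moreover have "X = complex_of_real c \<cdot>\<^sub>m (complex_of_real (1 / c) \<cdot>\<^sub>m X)"
      using False by (intro eq_matI) auto
    ultimately show ?thesis unfolding cone_def using c(2) by blast
  qed
qed

text \<open>\<open>bi_tensor\<close> sorts the factors as \<open>A1 A2 : B1 B2\<close>, and in that
  order a product of two product operators is again a product operator.\<close>

lemma kron_kron_index:
  assumes "A \<in> carrier_mat a1 a1" "B \<in> carrier_mat b1 b1" "A' \<in> carrier_mat a2 a2" "B' \<in> carrier_mat b2 b2"
    "k < (a1 * a2) * (b1 * b2)" "l < (a1 * a2) * (b1 * b2)"
  shows "kron (kron A A') (kron B B') $$ (k, l)
    = kron A B $$ (bi_idx1 b1 a2 b2 k, bi_idx1 b1 a2 b2 l) * kron A' B' $$ (bi_idx2 b1 a2 b2 k, bi_idx2 b1 a2 b2 l)"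
proof -
  have c: "kron A A' \<in> carrier_mat (a1 * a2) (a1 * a2)" "kron B B' \<in> carrier_mat (b1 * b2) (b1 * b2)"
    using assms by (auto simp: kron_def)
  have pos: "b1 * b2 > 0" using assms(5) by (auto intro: Nat.gr0I)
  have m: "k mod (b1 * b2) < b1 * b2" "l mod (b1 * b2) < b1 * b2" using pos by auto
  note k = bi_idx_digits[OF assms(5)] and l = bi_idx_digits[OF assms(6)]
  have "kron (kron A A') (kron B B') $$ (k, l) =
      kron A A' $$ (k div (b1 * b2), l div (b1 * b2)) * kron B B' $$ (k mod (b1 * b2), l mod (b1 * b2))"
    using c assms by (simp add: kron_tens[OF c] tens_def)
  also have "kron A A' $$ (k div (b1 * b2), l div (b1 * b2)) =
      A $$ (k div (b1 * b2) div a2, l div (b1 * b2) div a2) * A' $$ (k div (b1 * b2) mod a2, l div (b1 * b2) mod a2)"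
    using k(5) l(5) by (simp add: kron_tens[OF assms(1,3)] tens_def)
  also have "kron B B' $$ (k mod (b1 * b2), l mod (b1 * b2)) =
      B $$ (k mod (b1 * b2) div b2, l mod (b1 * b2) div b2) * B' $$ (k mod (b1 * b2) mod b2, l mod (b1 * b2) mod b2)"
    using m by (simp add: kron_tens[OF assms(2,4)] tens_def)
  finally show ?thesis
    using pidx_less[OF pidx_bi assms(5)] pidx_less[OF pidx_bi assms(6)] k l
    by (simp add: kron_tens[OF assms(1,2)] kron_tens[OF assms(3,4)] tens_def)
qed

lemma scone_bi_tensor:
  assumes "X \<in> scone a1 b1" "Y \<in> scone a2 b2"
  shows "bi_tensor a1 b1 a2 b2 X Y \<in> scone (a1 * a2) (b1 * b2)"
proof -
  obtain n \<alpha> \<beta> where X: "\<And>k. k < n \<Longrightarrow> psd a1 (\<alpha> k) \<and> psd b1 (\<beta> k)"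
    "X = mat (a1 * b1) (a1 * b1) (\<lambda>(i, j). \<Sum>k<(n::nat). 1 * kron (\<alpha> k) (\<beta> k) $$ (i, j))"
    using scone_mat_sum[OF assms(1)] by blast
  obtain m \<alpha>' \<beta>' where Y: "\<And>k. k < m \<Longrightarrow> psd a2 (\<alpha>' k) \<and> psd b2 (\<beta>' k)"
    "Y = mat (a2 * b2) (a2 * b2) (\<lambda>(i, j). \<Sum>k<(m::nat). 1 * kron (\<alpha>' k) (\<beta>' k) $$ (i, j))"
    using scone_mat_sum[OF assms(2)] by blast
  let ?Z = "\<lambda>(k, l). kron (kron (\<alpha> k) (\<alpha>' l)) (kron (\<beta> k) (\<beta>' l))"
  let ?S = "mat ((a1 * a2) * (b1 * b2)) ((a1 * a2) * (b1 * b2)) (\<lambda>(i, j). \<Sum>z\<in>{..<n} \<times> {..<m}. ?Z z $$ (i, j))"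
  have "bi_tensor a1 b1 a2 b2 X Y = ?S"
  proof (rule eq_matI)
    fix i j assume "i < dim_row ?S"
      "j < dim_col ?S"
    then have ij: "i < (a1 * a2) * (b1 * b2)" "j < (a1 * a2) * (b1 * b2)" by simp_all
    let ?f = "bi_idx1 b1 a2 b2" and ?g = "bi_idx2 b1 a2 b2"
    note less = pidx_less[OF pidx_bi ij(1)] pidx_less[OF pidx_bi ij(2)]
    have "bi_tensor a1 b1 a2 b2 X Y $$ (i, j) = X $$ (?f i, ?f j) * Y $$ (?g i, ?g j)"
      using ij by (simp add: bi_tensor_def)
    also have "\<dots> = (\<Sum>k<n. kron (\<alpha> k) (\<beta> k) $$ (?f i, ?f j)) * (\<Sum>l<m. kron (\<alpha>' l) (\<beta>' l) $$ (?g i, ?g j))"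
      unfolding X(2) Y(2) using less by simp
    also have "\<dots> = (\<Sum>k<n. \<Sum>l<m. kron (kron (\<alpha> k) (\<alpha>' l)) (kron (\<beta> k) (\<beta>' l)) $$ (i, j))"
      unfolding sum_product
    proof (intro sum.cong refl)
      fix k l assume "k \<in> {..<n}" "l \<in> {..<m}"
      then show "kron (\<alpha> k) (\<beta> k) $$ (?f i, ?f j) * kron (\<alpha>' l) (\<beta>' l) $$ (?g i, ?g j) = kron (kron (\<alpha> k) (\<alpha>' l)) (kron (\<beta> k) (\<beta>' l)) $$ (i, j)"
        using X(1)[of k] Y(1)[of l] ij by (intro kron_kron_index[symmetric]) (auto intro: psd_carrier)
    qed
    also have "\<dots> = (\<Sum>z\<in>{..<n} \<times> {..<m}. ?Z z $$ (i, j))"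
      unfolding sum.cartesian_product by (intro sum.cong) auto
    finally show "bi_tensor a1 b1 a2 b2 X Y $$ (i, j) = ?S $$ (i, j)"
      using ij by simp
  qed (simp_all add: bi_tensor_def)
  also have "\<dots> \<in> scone (a1 * a2) (b1 * b2)"
  proof (rule scone_sum)
    fix z assume "z \<in> {..<n} \<times> {..<m}"
    then obtain k l where "z = (k, l)" "k < n" "l < m" by blast
    then show "?Z z \<in> scone (a1 * a2) (b1 * b2)"
      using X(1)[of k] Y(1)[of l] by (auto intro!: scone_kron psd_kron)
  qed simp
  finally show ?thesis .
qed

lemma sep_bi_tensor:
  assumes "X \<in> sep a1 b1" "Y \<in> sep a2 b2"
  shows "bi_tensor a1 b1 a2 b2 X Y \<in> sep (a1 * a2) (b1 * b2)"
proof (rule scone_sep)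
  show "bi_tensor a1 b1 a2 b2 X Y \<in> scone (a1 * a2) (b1 * b2)"
    by (intro scone_bi_tensor sep_scone assms)
  show "mat_trace (bi_tensor a1 b1 a2 b2 X Y) = 1"
    using density_bi_tensor[OF sep_scone(2)[OF assms(1)] sep_scone(2)[OF assms(2)]] by (simp add: density_def)
qed

lemma qf_diag: "qf d (mat d d (\<lambda>(i, j). of_bool (i = j) * complex_of_real (g i))) x = complex_of_real (\<Sum>i<d. g i * (cmod (x i))\<^sup>2)"
proof -
  have "qf d (mat d d (\<lambda>(i, j). of_bool (i = j) * complex_of_real (g i))) x = (\<Sum>i<d. \<Sum>j<d. of_bool (i = j) * (complex_of_real (g i) * cnj (x i) * x j))"
    unfolding qf_def by (intro sum.cong refl) simp
  also have "\<dots> = (\<Sum>i<d. complex_of_real (g i) * (x i * cnj (x i)))"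
    by (intro sum.cong refl, subst sum_of_bool_mult(4)) (auto simp: mult_ac)
  finally show ?thesis by (simp add: complex_norm_square[symmetric])
qed

lemma psd_diag:
  assumes "\<And>i. i < d \<Longrightarrow> 0 \<le> g i"
  shows "psd d (mat d d (\<lambda>(i, j). of_bool (i = j) * complex_of_real (g i)))"
    (is "psd d ?D")
proof (rule psdI)
  show "\<exists>r\<ge>0. qf d ?D x = complex_of_real r" for x
    using assms by (intro exI[of _ "\<Sum>i<d. g i * (cmod (x i))\<^sup>2"] conjI sum_nonneg qf_diag) simp
qed simp

text \<open>The projection onto a basis vector is a product projection.\<close>

lemma scone_diag:
  assumes "\<And>i. i < a * b \<Longrightarrow> 0 \<le> g i"
  shows "mat (a * b) (a * b) (\<lambda>(i, j). of_bool (i = j) * complex_of_real (g i)) \<in> scone a b"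
proof -
  define e where "e d r = mat d d (\<lambda>(i, j). of_bool (i = j) * complex_of_real (of_bool (i = r)))" for d r :: nat
  have e: "psd d (e d r)" for d r unfolding e_def by (rule psd_diag) simp
  let ?X = "\<lambda>k. complex_of_real (g k) \<cdot>\<^sub>m kron (e a (k div b)) (e b (k mod b))"
  let ?D = "mat (a * b) (a * b) (\<lambda>(i, j). of_bool (i = j) * complex_of_real (g i))" and ?S = "mat (a * b) (a * b) (\<lambda>(i, j). \<Sum>k\<in>{..<a * b}. ?X k $$ (i, j))"
  have "?D = ?S"
  proof (rule eq_matI)
    fix i j assume "i < dim_row ?S"
      "j < dim_col ?S"
    then have ij: "i < a * b" "j < a * b" by auto
    note less = pidx_less[OF pidx_kron ij(1)] pidx_less[OF pidx_kron ij(2)]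
    have "(\<Sum>k\<in>{..<a * b}. ?X k $$ (i, j)) = (\<Sum>k<a * b. of_bool (k = i) * (of_bool (i = j) * complex_of_real (g k)))"
    proof (intro sum.cong refl)
      fix k assume "k \<in> {..<a * b}"
      then have k: "k < a * b" by simp
      have "?X k $$ (i, j) = complex_of_real (g k) * (of_bool (i div b = j div b) * of_bool (i div b = k div b) * (of_bool (i mod b = j mod b) * of_bool (i mod b = k mod b)))"
        using ij less kron_carrier[OF e e] by (simp add: kron_tens[OF psd_carrier[OF e] psd_carrier[OF e]] tens_def) (simp add: e_def)
      then show "?X k $$ (i, j) = of_bool (k = i) * (of_bool (i = j) * complex_of_real (g k))"
        using pidx_inj[OF pidx_kron ij] pidx_inj[OF pidx_kron ij(1) k] by (auto simp: of_bool_def split: if_splits)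
    qed
    then show "?D $$ (i, j) = ?S $$ (i, j)"
      using ij by (simp add: sum_of_bool_mult)
  qed auto
  also have "\<dots> \<in> scone a b"
    by (rule scone_sum) (use assms e in \<open>auto intro!: scone_smult scone_kron\<close>)
  finally show ?thesis .
qed

lemma scone_one: "1\<^sub>m (a * b) \<in> scone a b"
proof -
  have "1\<^sub>m (a * b) = mat (a * b) (a * b) (\<lambda>(i, j). of_bool (i = j) * complex_of_real 1)" by (intro eq_matI) auto
  then show ?thesis using scone_diag[of a b "\<lambda>_. 1"] by simp
qed

lemma sep_max_mixed:
  assumes "a * b > 0" shows "complex_of_real (1 / real (a * b)) \<cdot>\<^sub>m 1\<^sub>m (a * b) \<in> sep a b"
proof (rule scone_sep)
  show "complex_of_real (1 / real (a * b)) \<cdot>\<^sub>m 1\<^sub>m (a * b) \<in> scone a b" by (intro scone_smult scone_one) simp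
  show "mat_trace (complex_of_real (1 / real (a * b)) \<cdot>\<^sub>m 1\<^sub>m (a * b)) = 1"
    using assms by (simp add: mat_trace_def)
qed

section \<open>Maximally entangled and isotropic states\<close>

definition rk :: "nat \<Rightarrow> (nat \<Rightarrow> complex) \<Rightarrow> complex mat" where
  "rk d x = mat d d (\<lambda>(i, j). x i * cnj (x j))"

definition phi_vec :: "nat \<Rightarrow> nat \<Rightarrow> complex" where
  "phi_vec K i = complex_of_real (1 / sqrt (real K)) * of_bool (i div K = i mod K)"

definition phiK :: "nat \<Rightarrow> complex mat" where
  "phiK K = rk (K * K) (phi_vec K)"

lemma rk_carrier: "rk d x \<in> carrier_mat d d" by (simp add: rk_def)

lemma qf_rk: "qf d (rk d x) y = complex_of_real ((cmod (ip d x y))\<^sup>2)"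
proof -
  have "qf d (rk d x) y = (\<Sum>i<d. \<Sum>j<d. (cnj (y i) * x i) * (cnj (x j) * y j))"
    unfolding qf_def by (intro sum.cong refl) (simp add: rk_def mult_ac)
  also have "\<dots> = ip d y x * ip d x y" by (simp add: ip_def sum_product)
  finally show ?thesis by (simp only: ip_mult_cnj)
qed

lemma psd_rk: "psd d (rk d x)"
  by (rule psdI[OF rk_carrier]) (use qf_rk zero_le_power2 in blast)

lemma trace_rk_mult:
  assumes "X \<in> carrier_mat d d" shows "mat_trace (rk d x * X) = qf d X x"
proof -
  have "mat_trace (rk d x * X) = (\<Sum>i<d. \<Sum>j<d. x i * cnj (x j) * X $$ (j, i))"
    unfolding mat_trace_carrier[OF mult_carrier_mat[OF rk_carrier assms]]
    by (intro sum.cong refl, subst mat_mult_index[OF rk_carrier assms]) (auto simp: rk_def)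
  also have "\<dots> = (\<Sum>j<d. \<Sum>i<d. x i * cnj (x j) * X $$ (j, i))" by (rule sum.swap)
  finally show ?thesis unfolding qf_def by (simp add: mult_ac)
qed

lemma phiK_carrier: "phiK K \<in> carrier_mat (K * K) (K * K)" by (simp add: phiK_def rk_carrier)

lemma phiK_index:
  assumes "i < K * K" "j < K * K"
  shows "phiK K $$ (i, j) = complex_of_real (1 / real K) * of_bool (i div K = i mod K) * of_bool (j div K = j mod K)"
proof -
  have "complex_of_real (1 / sqrt (real K)) * complex_of_real (1 / sqrt (real K)) = complex_of_real (1 / real K)"
    unfolding of_real_mult[symmetric] by simp
  then show ?thesis using assms by (simp add: phiK_def rk_def phi_vec_def mult_ac)
qed

lemma density_phiK:
  assumes "K > 0" shows "density (K * K) (phiK K)"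
proof -
  have "mat_trace (phiK K) = (\<Sum>i<K * K. complex_of_real (1 / real K) * of_bool (i div K = i mod K))"
    unfolding mat_trace_carrier[OF phiK_carrier] by (intro sum.cong refl) (simp add: phiK_index)
  also have "\<dots> = (\<Sum>i<K. \<Sum>j<K. complex_of_real (1 / real K) * of_bool (i = j))"
    by (rule sum_pidx[OF pidx_kron])
  also have "\<dots> = (\<Sum>i<K. complex_of_real (1 / real K))" by (intro sum.cong refl, subst sum_of_bool_mult(2)) auto
  also have "\<dots> = 1" using assms by simp
  finally show ?thesis by (simp add: density_def phiK_def psd_rk)
qed

lemma density_le_one:
  assumes "density d \<rho>" shows "psd d (1\<^sub>m d - \<rho>)"
proof -
  have p: "psd d \<rho>" "mat_trace \<rho> = 1" using assms by (auto simp: density_def)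
  obtain u l where u: "spec d \<rho> u l" "\<And>i. i < d \<Longrightarrow> 0 \<le> l i" using psd_obtain_spec[OF p(1)] by blast
  have "complex_of_real (\<Sum>i<d. l i) = 1" using p(2) by (simp only: trace_spec[OF u(1)])
  then have one: "(\<Sum>i<d. l i) = 1" by (simp only: of_real_eq_1_iff)
  have l1: "l i \<le> 1" if "i < d" for i
    using member_le_sum[of i "{..<d}" l] u(2) that one by auto
  show ?thesis
  proof (rule psdI)
    fix x
    have "qf d (1\<^sub>m d - \<rho>) x = complex_of_real ((\<Sum>i<d. (cmod (x i))\<^sup>2) - (\<Sum>i<d. l i * (cmod (ip d (u i) x))\<^sup>2))"
      using psd_carrier[OF p(1)] by (simp only: qf_minus[OF one_carrier_mat] qf_one spec_qf[OF u(1)] of_real_diff)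
    moreover have "(\<Sum>i<d. l i * (cmod (ip d (u i) x))\<^sup>2) \<le> (\<Sum>i<d. 1 * (cmod (ip d (u i) x))\<^sup>2)"
      using l1 by (intro sum_mono mult_right_mono) auto
    ultimately show "\<exists>r\<ge>0. qf d (1\<^sub>m d - \<rho>) x = complex_of_real r"
      by (intro exI[of _ "(\<Sum>i<d. (cmod (x i))\<^sup>2) - (\<Sum>i<d. l i * (cmod (ip d (u i) x))\<^sup>2)"] conjI)
        (simp_all only: parseval[OF spec_onb[OF u(1)]] mult_1 diff_ge_0_iff_ge)
  qed (use psd_carrier[OF p(1)] in auto)
qed

lemma phi2_phiK: "phi2 = phiK 2"
proof -
  have "phi2_vec $ i = phi_vec 2 i" if "i < 4" for i
  proof -
    have "i = 0 \<or> i = 1 \<or> i = 2 \<or> i = 3" using that by auto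
    then show ?thesis by (auto simp: phi2_vec_def phi_vec_def)
  qed
  then show ?thesis by (intro eq_matI) (auto simp: phi2_def phiK_def rk_def)
qed

text \<open>In the sorted factor order, equality of the first digits and of the second digits on the
  two sides amounts to equality of the composite local indices, so tensor powers of maximally
  entangled states keep that form.\<close>

lemma phiK_bi_tensor: "bi_tensor K1 K1 K2 K2 (phiK K1) (phiK K2) = phiK (K1 * K2)"
proof (rule eq_matI)
  let ?N = "(K1 * K2) * (K1 * K2)"
  have e: "phi_vec K1 (bi_idx1 K1 K2 K2 k) * phi_vec K2 (bi_idx2 K1 K2 K2 k) = phi_vec (K1 * K2) k" if k: "k < ?N" for k
  proof -
    note d = bi_idx_digits[OF k]
    have "k div (K1 * K2) = k mod (K1 * K2) \<longleftrightarrow> k div (K1 * K2) div K2 = k mod (K1 * K2) div K2 \<and> k div (K1 * K2) mod K2 = k mod (K1 * K2) mod K2"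
      by (metis div_mod_decomp)
    moreover have "complex_of_real (1 / sqrt (real K1)) * complex_of_real (1 / sqrt (real K2)) = complex_of_real (1 / sqrt (real (K1 * K2)))"
      unfolding of_real_mult[symmetric] by (simp add: real_sqrt_mult)
    ultimately show ?thesis
      unfolding phi_vec_def d by (auto simp: of_bool_def)
  qed
  fix k l assume "k < dim_row (phiK (K1 * K2))" "l < dim_col (phiK (K1 * K2))"
  then have kl: "k < ?N" "l < ?N" by (auto simp: phiK_def rk_def)
  show "bi_tensor K1 K1 K2 K2 (phiK K1) (phiK K2) $$ (k, l) = phiK (K1 * K2) $$ (k, l)"
    using kl pidx_less[OF pidx_bi kl(1)] pidx_less[OF pidx_bi kl(2)] e[OF kl(1)] e[OF kl(2)]
    by (simp add: bi_tensor_def phiK_def rk_def flip: e)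
qed (simp_all add: bi_tensor_def phiK_def rk_def)

lemma bi_power_phi2: "bi_power 2 2 m phi2 = phiK (2 ^ m)"
proof (induction m)
  case 0
  show ?case by (intro eq_matI) (auto simp: phiK_def rk_def phi_vec_def)
next
  case (Suc m)
  have "bi_power 2 2 (Suc m) phi2 = bi_tensor (2 ^ m) (2 ^ m) 2 2 (phiK (2 ^ m)) (phiK 2)"
    using Suc.IH by (simp add: phi2_phiK)
  then show ?case by (simp add: phiK_bi_tensor mult.commute)
qed

section \<open>Separability of isotropic operators\<close>

lemma phase_sum:
  assumes "\<bar>k\<bar> < int N"
  shows "(\<Sum>t<N. cis (2 * pi * real t * real_of_int k / real N)) = of_nat N * of_bool (k = 0)"
proof -
  have N: "real N > 0" using assms by auto
  define z where "z = cis (2 * pi * real_of_int k / real N)"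
  have "cis (2 * pi * real t * real_of_int k / real N) = z ^ t" for t
    unfolding z_def Complex.DeMoivre by (simp add: mult_ac)
  then have s: "(\<Sum>t<N. cis (2 * pi * real t * real_of_int k / real N)) = (if z = 1 then of_nat N else (1 - z ^ N) / (1 - z))"
    by (simp add: sum_gp_strict)
  have "z ^ N = cis (2 * pi * real_of_int k)" unfolding z_def Complex.DeMoivre using N by simp
  then have zN: "z ^ N = 1" using cis_multiple_2pi[of "real_of_int k"] by simp
  \<comment> \<open>A trivial root of unity makes \<open>N\<close> divide \<open>k\<close>; the
    bound on \<open>\<bar>k\<bar>\<close> leaves only 0.\<close>
  have "k = 0" if "z = 1"
  proof -
    have "cos (2 * pi * real_of_int k / real N) = 1" using that by (simp add: z_def complex_eq_iff)
    then obtain n :: int where "2 * pi * real_of_int k / real N = of_int n * 2 * pi" using cos_one_2pi_int by auto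
    then have "real_of_int k = of_int n * real N" using N by (simp add: field_simps)
    then have kn: "k = n * int N" by (metis of_int_eq_iff of_int_mult of_int_of_nat_eq)
    have "n = 0"
    proof (rule ccontr)
      assume "n \<noteq> 0"
      then have "1 \<le> \<bar>n\<bar>" by simp
      then have "1 * int N \<le> \<bar>n\<bar> * int N" by (intro mult_right_mono) auto
      then show False using assms kn by (simp add: abs_mult)
    qed
    then show "k = 0" using kn by simp
  qed
  moreover have "z = 1" if "k = 0" using that by (simp add: z_def)
  ultimately show ?thesis using s zN by auto
qed

text \<open>If \<open>a = b < c\<close>, the right side is too large. If \<open>a < b\<close>, then
  \<open>2 ^ (a + 1)\<close> divides every other summand but not \<open>2 ^ a\<close>.\<close>

lemma pow2_sum_aux:
  fixes a b c d :: nat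
  assumes "a \<le> b" "c \<le> d" "(2::nat) ^ a + 2 ^ b = 2 ^ c + 2 ^ d" shows "\<not> a < c"
proof
  assume ac: "a < c"
  show False
  proof (cases "a = b")
    case True
    have "(2::nat) ^ Suc a \<le> 2 ^ c" "(2::nat) ^ c \<le> 2 ^ d" using ac assms(2) by (intro power_increasing; simp)+
    then have "2 * (2::nat) ^ a \<le> 2 ^ c" "(2::nat) ^ c \<le> 2 ^ d" by (simp_all only: power_Suc)
    moreover have "(2::nat) ^ c > 0" by simp
    moreover have "(2::nat) ^ a + 2 ^ a = 2 ^ c + 2 ^ d" using assms(3) True by simp
    ultimately show False by linarith
  next
    case False
    have "(2::nat) ^ Suc a dvd 2 ^ c + 2 ^ d" using ac assms(2) by (intro dvd_add le_imp_power_dvd) auto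
    moreover have "(2::nat) ^ Suc a dvd 2 ^ b" using False assms(1) by (intro le_imp_power_dvd) auto
    ultimately have "(2::nat) ^ Suc a dvd 2 ^ a" using assms(3) by (metis dvd_add_left_iff)
    then have "(2::nat) ^ Suc a \<le> 2 ^ a" by (rule dvd_imp_le) simp
    then show False by simp
  qed
qed

lemma pow2_sum_eq:
  fixes a b c d :: nat
  shows "(2::nat) ^ a + 2 ^ b = 2 ^ c + 2 ^ d \<longleftrightarrow> (a = c \<and> b = d) \<or> (a = d \<and> b = c)"
proof
  have aux: "a = c \<and> b = d" if "a \<le> b" "c \<le> d" "(2::nat) ^ a + 2 ^ b = 2 ^ c + 2 ^ d" for a b c d :: nat
  proof -
    have "a = c" using pow2_sum_aux[OF that] pow2_sum_aux[OF that(2,1) that(3)[symmetric]] by simp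
    then show ?thesis using that(3) by simp
  qed
  assume h: "(2::nat) ^ a + 2 ^ b = 2 ^ c + 2 ^ d"
  consider "a \<le> b" "c \<le> d" | "a \<le> b" "d \<le> c" | "b \<le> a" "c \<le> d" | "b \<le> a" "d \<le> c" by linarith
  then show "(a = c \<and> b = d) \<or> (a = d \<and> b = c)"
    by cases (use aux[of a b c d] aux[of a b d c] aux[of b a c d] aux[of b a d c] h in \<open>auto simp: add.commute\<close>)
qed auto

text \<open>For unimodular \<open>c\<close> this is \<open>K\<close> times the projection onto the
  maximally entangled vector with phases \<open>c\<close>, plus the projection onto the basis
  vectors with distinct local indices.\<close>

definition phase_mat :: "nat \<Rightarrow> (nat \<Rightarrow> complex) \<Rightarrow> complex mat" where
  "phase_mat K c = mat (K * K) (K * K) (\<lambda>(i, j).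
     of_bool (i div K = i mod K) * of_bool (j div K = j mod K) * (c (i div K) * cnj (c (j div K)))
     + of_bool (i = j) * of_bool (i div K \<noteq> i mod K))"

text \<open>
  The exponents \<open>2 ^ i\<close> form a Sidon set, so averaging the product vectors with phases
  \<open>\<zeta> ^ (t * 2 ^ i)\<close> and \<open>\<zeta> ^ (- t * 2 ^ i)\<close> over \<open>t\<close> leaves only the terms with matching indices.
\<close>

lemma scone_phase_mat:
  assumes c: "\<And>i. i < K \<Longrightarrow> cmod (c i) = 1" shows "phase_mat K c \<in> scone K K"
proof -
  \<comment> \<open>\<open>N\<close> exceeds every sum of two of the exponents, so a phase that is
    trivial modulo \<open>N\<close> comes from a genuine equality of sums.\<close>
  define N :: nat where "N = 2 ^ (K + 1)"
  define th where "th t i = cis (2 * pi * real t * real (2 ^ i) / real N)" for t i :: nat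
  define ch where "ch t i = c i * cis (- (2 * pi * real t * real (2 ^ i) / real N))" for t i :: nat
  define X where "X t = complex_of_real (1 / real N) \<cdot>\<^sub>m kron (rk K (th t)) (rk K (ch t))" for t
  have X: "X t \<in> scone K K" for t unfolding X_def by (intro scone_smult scone_kron psd_rk) simp
  let ?S = "mat (K * K) (K * K) (\<lambda>(i, j). \<Sum>t\<in>{..<N}. X t $$ (i, j))"
  have "phase_mat K c = ?S"
  proof (rule eq_matI)
    fix i j assume "i < dim_row ?S"
      "j < dim_col ?S"
    then have ij: "i < K * K" "j < K * K" by auto
    define i1 i2 j1 j2 where d: "i1 = i div K" "i2 = i mod K" "j1 = j div K" "j2 = j mod K"
    have less: "i1 < K" "i2 < K" "j1 < K" "j2 < K"
      using pidx_less[OF pidx_kron ij(1)] pidx_less[OF pidx_kron ij(2)] by (auto simp: d)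
    define k where "k = int (2 ^ i1 + 2 ^ j2) - int (2 ^ j1 + 2 ^ i2)"
    have "(2::nat) ^ r < 2 ^ K" if "r < K" for r using that by simp
    note pl = this[OF less(1)] this[OF less(2)] this[OF less(3)] this[OF less(4)]
    have "(2::nat) ^ i1 + 2 ^ j2 < N" using pl unfolding N_def power_add power_one_right by linarith
    moreover have "(2::nat) ^ j1 + 2 ^ i2 < N" using pl unfolding N_def power_add power_one_right by linarith
    ultimately    have kN: "\<bar>k\<bar> < int N" unfolding k_def by linarith
    \<comment> \<open>The first alternative gives the diagonal entries, the second the block of the
      maximally entangled vector.\<close>
    have k0: "k = 0 \<longleftrightarrow> (i1 = j1 \<and> j2 = i2) \<or> (i1 = i2 \<and> j2 = j1)"
      unfolding k_def by (simp only: right_minus_eq of_nat_eq_iff pow2_sum_eq)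
    have "X t $$ (i, j) = complex_of_real (1 / real N) * (c i2 * cnj (c j2)) * cis (2 * pi * real t * real_of_int k / real N)" for t
    proof -
      have "X t $$ (i, j) = complex_of_real (1 / real N) * ((th t i1 * cnj (th t j1)) * (ch t i2 * cnj (ch t j2)))"
        unfolding X_def smult_index[OF kron_carrier[OF psd_rk psd_rk] ij] kron_tens[OF rk_carrier rk_carrier]
        using ij less by (simp add: tens_def rk_def d)
      also have "(th t i1 * cnj (th t j1)) * (ch t i2 * cnj (ch t j2)) = (c i2 * cnj (c j2)) *
          (cis (2 * pi * real t * real (2 ^ i1) / real N) * cis (- (2 * pi * real t * real (2 ^ j1) / real N)) *
           (cis (- (2 * pi * real t * real (2 ^ i2) / real N)) * cis (2 * pi * real t * real (2 ^ j2) / real N)))"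
        unfolding th_def ch_def complex_cnj_mult cis_cnj minus_minus by (simp only: mult_ac)
      also have "\<dots> = (c i2 * cnj (c j2)) * cis (2 * pi * real t * real_of_int k / real N)"
        unfolding cis_mult by (simp add: k_def algebra_simps add_divide_distrib diff_divide_distrib)
      finally show ?thesis by (simp only: mult.assoc)
    qed
    then have "(\<Sum>t\<in>{..<N}. X t $$ (i, j)) = complex_of_real (1 / real N) * (c i2 * cnj (c j2)) * (of_nat N * of_bool (k = 0))"
      by (simp only: sum_distrib_left[symmetric] phase_sum[OF kN])
    also have "\<dots> = c i2 * cnj (c j2) * of_bool (k = 0)"
      by (simp add: N_def)
    also have "\<dots> = of_bool (i1 = i2) * of_bool (j1 = j2) * (c i1 * cnj (c j1)) + of_bool (i = j) * of_bool (i1 \<noteq> i2)"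
    proof -
      have "i = j \<longleftrightarrow> i1 = j1 \<and> i2 = j2" using pidx_inj[OF pidx_kron ij] by (simp add: d)
      moreover have "c i2 * cnj (c i2) = 1" using c[OF less(2)] by (simp add: complex_norm_square[symmetric])
      ultimately show ?thesis using k0 by auto
    qed
    finally show "phase_mat K c $$ (i, j) = ?S $$ (i, j)"
      using ij by (simp add: phase_mat_def d)
  qed (auto simp: phase_mat_def)
  also have "\<dots> \<in> scone K K" by (rule scone_sum) (use X in auto)
  finally show ?thesis .
qed

definition iso :: "nat \<Rightarrow> real \<Rightarrow> real \<Rightarrow> complex mat" where
  "iso K p q = complex_of_real p \<cdot>\<^sub>m phiK K + complex_of_real q \<cdot>\<^sub>m (1\<^sub>m (K * K) - phiK K)"

lemma iso_carrier: "iso K p q \<in> carrier_mat (K * K) (K * K)"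
  unfolding iso_def by (intro add_carrier_mat smult_carrier_mat minus_carrier_mat phiK_carrier)

lemma iso_index:
  assumes "i < K * K" "j < K * K"
  shows "iso K p q $$ (i, j) = complex_of_real ((p - q) / real K) * (of_bool (i div K = i mod K) * of_bool (j div K = j mod K))
    + complex_of_real q * of_bool (i = j)"
proof -
  have "iso K p q $$ (i, j) = complex_of_real p * phiK K $$ (i, j) + complex_of_real q * (of_bool (i = j) - phiK K $$ (i, j))"
    using assms phiK_carrier[of K] by (simp add: iso_def)
  then show ?thesis unfolding phiK_index[OF assms] by (simp add: algebra_simps diff_divide_distrib)
qed

text \<open>For \<open>q \<le> p\<close> and \<open>c = (p - q) / K\<close> the operator is
  \<open>c\<close> times \<open>phase_mat\<close> with trivial phases, plus a diagonal, plus
  \<open>q - c\<close> times the identity; the last weight vanishes exactly at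
  \<open>p = (K + 1) * q\<close>. For \<open>p < q\<close> the nontrivial Fourier phases produce a
  multiple of \<open>1 - \<Phi>\<close>.\<close>

lemma iso_separable:
  assumes K: "K > 0" and pq: "0 \<le> p" "0 \<le> q" "p \<le> (real K + 1) * q"
  shows "iso K p q \<in> scone K K"
proof (cases "q \<le> p")
  case True
  let ?c = "(p - q) / real K"
  let ?P = "mat (K * K) (K * K) (\<lambda>(i, j). of_bool (i = j) * complex_of_real (of_bool (i div K = i mod K)))"
  let ?R = "complex_of_real ?c \<cdot>\<^sub>m phase_mat K (\<lambda>_. 1) + (complex_of_real ?c \<cdot>\<^sub>m ?P + complex_of_real (q - ?c) \<cdot>\<^sub>m 1\<^sub>m (K * K))"
  have "iso K p q = ?R"
  proof (rule eq_matI)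
    fix i j assume "i < dim_row ?R"
      "j < dim_col ?R"
    then have ij: "i < K * K" "j < K * K" by auto
    show "iso K p q $$ (i, j) = ?R $$ (i, j)"
      unfolding iso_index[OF ij] using ij by (auto simp: phase_mat_def of_bool_def algebra_simps)
  qed (use iso_carrier[of K p q] in \<open>auto simp: phase_mat_def\<close>)
  also have "\<dots> \<in> scone K K"
  proof -
    have "0 \<le> ?c" using True by (intro divide_nonneg_nonneg) auto
    moreover have "?c \<le> q" using pq(3) K by (simp add: divide_le_eq algebra_simps)
    then have "0 \<le> q - ?c" by simp
    ultimately show ?thesis
      by (intro scone_add scone_smult scone_phase_mat scone_diag scone_one) simp_all
  qed
  finally show ?thesis .
next
  case False
  let ?c = "(q - p) / real K"
  define ch where "ch s i = cis (2 * pi * real s * real i / real K)" for s i :: nat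
  define S where "S = mat (K * K) (K * K) (\<lambda>(i, j). \<Sum>s\<in>{1..<K}. phase_mat K (ch s) $$ (i, j))"
  define D where "D = mat (K * K) (K * K) (\<lambda>(i, j). of_bool (i = j) * complex_of_real (of_bool (i div K \<noteq> i mod K)))"
  have c: "S \<in> carrier_mat (K * K) (K * K)" "D \<in> carrier_mat (K * K) (K * K)" by (auto simp: S_def D_def)
  let ?R = "complex_of_real p \<cdot>\<^sub>m 1\<^sub>m (K * K) + complex_of_real ?c \<cdot>\<^sub>m (S + D)"
  have "iso K p q = ?R"
  proof (rule eq_matI)
    fix i j assume "i < dim_row ?R"
      "j < dim_col ?R"
    then have ij: "i < K * K" "j < K * K" using c by auto
    define i1 i2 j1 j2 where d: "i1 = i div K" "i2 = i mod K" "j1 = j div K" "j2 = j mod K"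
    have less: "i1 < K" "i2 < K" "j1 < K" "j2 < K"
      using pidx_less[OF pidx_kron ij(1)] pidx_less[OF pidx_kron ij(2)] by (auto simp: d)
    have eq: "i = j \<longleftrightarrow> i1 = j1 \<and> i2 = j2" using pidx_inj[OF pidx_kron ij] by (simp add: d)
    have "(\<Sum>s<K. ch s i1 * cnj (ch s j1)) = (\<Sum>s<K. cis (2 * pi * real s * real_of_int (int i1 - int j1) / real K))"
      unfolding ch_def cis_cnj cis_mult by (simp add: algebra_simps diff_divide_distrib)
    also have "\<dots> = of_nat K * of_bool (int i1 - int j1 = 0)" by (rule phase_sum) (use less in auto)
    finally have full: "(\<Sum>s<K. ch s i1 * cnj (ch s j1)) = of_nat K * of_bool (i1 = j1)" by simp
    have "{..<K} = insert 0 {1..<K}" using K by auto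
    then have "(\<Sum>s<K. ch s i1 * cnj (ch s j1)) = 1 + (\<Sum>s\<in>{1..<K}. ch s i1 * cnj (ch s j1))"
      by (simp add: ch_def)
    then have part: "(\<Sum>s\<in>{1..<K}. ch s i1 * cnj (ch s j1)) = of_nat K * of_bool (i1 = j1) - 1" using full by simp
    have "S $$ (i, j) = (\<Sum>s\<in>{1..<K}. of_bool (i1 = i2) * of_bool (j1 = j2) * (ch s i1 * cnj (ch s j1)) + of_bool (i = j) * of_bool (i1 \<noteq> i2))"
      using ij by (simp add: S_def phase_mat_def d)
    also have "\<dots> = of_bool (i1 = i2) * of_bool (j1 = j2) * (of_nat K * of_bool (i1 = j1) - 1) + of_nat (K - 1) * (of_bool (i = j) * of_bool (i1 \<noteq> i2))"
      by (simp only: sum.distrib sum_distrib_left[symmetric] part sum_constant card_atLeastLessThan, simp only: mult_ac)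
    finally have Sij: "S $$ (i, j) = of_bool (i1 = i2) * of_bool (j1 = j2) * (of_nat K * of_bool (i1 = j1) - 1) + (of_nat K - 1) * (of_bool (i = j) * of_bool (i1 \<noteq> i2))"
      using K by (simp add: of_nat_diff)
    have Dij: "D $$ (i, j) = of_bool (i = j) * of_bool (i1 \<noteq> i2)" using ij by (simp add: D_def d)
    have "complex_of_real ?c * of_nat K = complex_of_real (?c * real K)" by simp
    also have "?c * real K = q - p" using K by simp
    finally have cK: "complex_of_real ?c * of_nat K = complex_of_real (q - p)" .
    \<comment> \<open>Summed over all \<open>s\<close>, the entangled blocks become diagonal; the
      omitted \<open>s = 0\<close> leaves \<open>- K \<Phi>\<close>. Adding \<open>D\<close> once
      more completes the diagonal: \<open>S + D = K (1 - \<Phi>)\<close>.\<close>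
    have SD: "S $$ (i, j) + D $$ (i, j) = of_nat K * of_bool (i = j) - of_bool (i1 = i2) * of_bool (j1 = j2)"
      unfolding Sij Dij using eq by (auto simp: algebra_simps)
    have "?R $$ (i, j) = complex_of_real p * of_bool (i = j) + complex_of_real ?c * (S $$ (i, j) + D $$ (i, j))"
      using ij c by simp
    also have "\<dots> = complex_of_real p * of_bool (i = j) + (complex_of_real ?c * of_nat K) * of_bool (i = j) - complex_of_real ?c * (of_bool (i1 = i2) * of_bool (j1 = j2))"
      unfolding SD by (simp add: algebra_simps)
    also have "\<dots> = iso K p q $$ (i, j)"
      unfolding cK iso_index[OF ij] d by (simp add: algebra_simps diff_divide_distrib)
    finally show "iso K p q $$ (i, j) = ?R $$ (i, j)" ..
  qed (use iso_carrier[of K p q] c in auto)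
  also have "\<dots> \<in> scone K K"
  proof -
    have "S \<in> scone K K" unfolding S_def by (intro scone_sum scone_phase_mat) (auto simp: ch_def)
    moreover have "D \<in> scone K K" unfolding D_def by (intro scone_diag) auto
    moreover have "0 \<le> ?c" using False by (intro divide_nonneg_nonneg) auto
    ultimately show ?thesis using pq(1) by (intro scone_add scone_smult scone_one) simp_all
  qed
  finally show ?thesis .
qed

lemma iso_trace: assumes "K > 0" shows "mat_trace (iso K p q) = complex_of_real (p + q * ((real K)\<^sup>2 - 1))"
proof -
  have "mat_trace (phiK K) = 1" using density_phiK[OF assms] by (simp add: density_def)
  moreover have "mat_trace (1\<^sub>m (K * K) :: complex mat) = complex_of_real ((real K)\<^sup>2)"
    by (simp add: mat_trace_def power2_eq_square)
  ultimately show ?thesis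
    unfolding iso_def trace_add[OF smult_carrier_mat[OF phiK_carrier] smult_carrier_mat[OF minus_carrier_mat[OF phiK_carrier]]]
      trace_smult[OF phiK_carrier] trace_smult[OF minus_carrier_mat[OF phiK_carrier]] trace_minus[OF one_carrier_mat phiK_carrier]
    by simp
qed

lemma psd_add: "psd d A \<Longrightarrow> psd d B \<Longrightarrow> psd d (A + B)"
  by (auto simp: psd_iff qf_add)

lemma iso_psd: "K > 0 \<Longrightarrow> 0 \<le> p \<Longrightarrow> 0 \<le> q \<Longrightarrow> psd (K * K) (iso K p q)"
  unfolding iso_def using density_phiK[of K]
  by (intro psd_add psd_smult density_le_one) (auto simp: density_def)

lemma iso_phi: "phiK K = iso K 1 0"
  using phiK_carrier[of K] by (intro eq_matI) (auto simp: iso_def)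

lemma iso_lincomb:
  "complex_of_real x \<cdot>\<^sub>m iso K p q + complex_of_real y \<cdot>\<^sub>m iso K p' q' = iso K (x * p + y * p') (x * q + y * q')"
  using phiK_carrier[of K] by (intro eq_matI) (auto simp: iso_def algebra_simps)

text \<open>A product operator has an eigenbasis of product vectors, and the overlap of a product
  vector with \<open>phi_vec K\<close> is \<open>1 / sqrt K\<close> times an inner product of two
  unit vectors. Weighting by the eigenvalues gives the bound for products, and traces carry it to
  sums.\<close>

lemma sep_overlap:
  assumes K: "K > 0" and X: "X \<in> sep K K"
  obtains x where "0 \<le> x" "x \<le> 1 / real K" "mat_trace (phiK K * X) = complex_of_real x"
proof -
  let ?q = "\<lambda>A. Re (qf (K * K) A (phi_vec K))"
  have pX: "psd (K * K) X" and tX: "mat_trace X = 1" using sep_scone(2)[OF X] by (auto simp: density_def)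
  have prod: "?q (kron A B) \<le> Re (mat_trace (kron A B)) / real K" if A: "psd K A" and B: "psd K B" for A B
  proof -
    obtain u l where u: "spec K A u l" "\<And>i. i < K \<Longrightarrow> 0 \<le> l i" using psd_obtain_spec[OF A] by blast
    obtain v m where v: "spec K B v m" "\<And>i. i < K \<Longrightarrow> 0 \<le> m i" using psd_obtain_spec[OF B] by blast
    let ?w = "\<lambda>n k. u (n div K) (k div K) * v (n mod K) (k mod K)"
    have s: "spec (K * K) (kron A B) ?w (\<lambda>n. l (n div K) * m (n mod K))"
      unfolding kron_tens[OF psd_carrier[OF A] psd_carrier[OF B]] by (rule spec_tens[OF pidx_kron u(1) v(1)])
    have w: "(cmod (ip (K * K) (?w n) (phi_vec K)))\<^sup>2 \<le> 1 / real K" if n: "n < K * K" for n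
    proof -
      note less = pidx_less[OF pidx_kron n]
      have "ip (K * K) (?w n) (phi_vec K) = (\<Sum>i<K. \<Sum>j<K. cnj (u (n div K) i * v (n mod K) j) * (complex_of_real (1 / sqrt (real K)) * of_bool (i = j)))"
        unfolding ip_def phi_vec_def by (rule sum_pidx[OF pidx_kron])
      also have "\<dots> = (\<Sum>i<K. complex_of_real (1 / sqrt (real K)) * (cnj (u (n div K) i) * cnj (v (n mod K) i)))"
      proof (intro sum.cong refl)
        fix i assume i: "i \<in> {..<K}"
        have "(\<Sum>j<K. cnj (u (n div K) i * v (n mod K) j) * (complex_of_real (1 / sqrt (real K)) * of_bool (i = j)))
          = (\<Sum>j<K. complex_of_real (1 / sqrt (real K)) * (cnj (u (n div K) i) * cnj (v (n mod K) j)) * of_bool (i = j))"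
          by (intro sum.cong refl) (simp only: complex_cnj_mult mult_ac)
        then show "(\<Sum>j<K. cnj (u (n div K) i * v (n mod K) j) * (complex_of_real (1 / sqrt (real K)) * of_bool (i = j)))
          = complex_of_real (1 / sqrt (real K)) * (cnj (u (n div K) i) * cnj (v (n mod K) i))"
          using i by (simp only: sum_of_bool_mult lessThan_iff)
      qed
      also have "\<dots> = complex_of_real (1 / sqrt (real K)) * ip K (u (n div K)) (\<lambda>i. cnj (v (n mod K) i))"
        by (simp only: ip_def sum_distrib_left)
      finally have "(cmod (ip (K * K) (?w n) (phi_vec K)))\<^sup>2 = 1 / real K * (cmod (ip K (u (n div K)) (\<lambda>i. cnj (v (n mod K) i))))\<^sup>2"
        by (simp add: norm_mult norm_divide power_mult_distrib power_divide)
      \<comment> \<open>A single term of Parseval's sum stands in for the Cauchy-Schwarz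
        inequality.\<close>
      also have "(cmod (ip K (u (n div K)) (\<lambda>i. cnj (v (n mod K) i))))\<^sup>2 \<le> (\<Sum>a<K. (cmod (ip K (u a) (\<lambda>i. cnj (v (n mod K) i))))\<^sup>2)"
        by (rule member_le_sum) (use less in auto)
      also have "\<dots> = 1" by (simp add: parseval[OF spec_onb[OF u(1)]] onb_norm[OF spec_onb[OF v(1)] less(2)])
      finally show ?thesis using K by (simp add: divide_right_mono)
    qed
    have "?q (kron A B) \<le> (\<Sum>n<K * K. l (n div K) * m (n mod K) * (1 / real K))"
      unfolding spec_Re_qf[OF s] using w u(2) v(2) pidx_less[OF pidx_kron]
      by (intro sum_mono mult_left_mono) auto
    also have "\<dots> = Re (mat_trace (kron A B)) / real K"
      unfolding trace_spec[OF s] by (simp add: sum_divide_distrib)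
    finally show ?thesis .
  qed
  have "?q X \<le> 1 / real K"
  proof (rule scone_mat_sum[OF sep_scone(1)[OF X]])
    fix n :: nat and \<alpha> \<beta>
    assume ab: "\<And>k. k < n \<Longrightarrow> psd K (\<alpha> k) \<and> psd K (\<beta> k)"
      and XX: "X = mat (K * K) (K * K) (\<lambda>(i, j). \<Sum>k<n. 1 * kron (\<alpha> k) (\<beta> k) $$ (i, j))"
    have kc: "kron (\<alpha> k) (\<beta> k) \<in> carrier_mat (K * K) (K * K)" if "k < n" for k using ab[OF that] kron_carrier by blast
    have "?q X = (\<Sum>k<n. ?q (kron (\<alpha> k) (\<beta> k)))" unfolding XX qf_mat_sum by simp
    also have "\<dots> \<le> (\<Sum>k<n. Re (mat_trace (kron (\<alpha> k) (\<beta> k))) / real K)" using prod ab by (intro sum_mono) auto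
    also have "\<dots> = Re (mat_trace X) / real K"
      unfolding XX mult_1 trace_mat_sum by (simp add: sum_divide_distrib mat_trace_carrier[OF kc])
    finally show ?thesis using tX by simp
  qed
  moreover have "mat_trace (phiK K * X) = complex_of_real (?q X)"
    unfolding phiK_def trace_rk_mult[OF psd_carrier[OF pX]] by (rule psd_qf(1)[OF pX])
  ultimately show ?thesis using that psd_qf(2)[OF pX] by blast
qed

section \<open>Measure-and-prepare channels\<close>

definition mprep :: "nat \<Rightarrow> complex mat \<Rightarrow> complex mat \<Rightarrow> complex mat \<Rightarrow> complex mat \<Rightarrow> complex mat" where
  "mprep d E \<omega> \<tau> X = mat_trace (E * X) \<cdot>\<^sub>m \<omega> + mat_trace ((1\<^sub>m d - E) * X) \<cdot>\<^sub>m \<tau>"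

lemma trace_comm:
  assumes "A \<in> carrier_mat d d" "B \<in> carrier_mat d d" shows "mat_trace (A * B) = mat_trace (B * A)"
proof -
  have "mat_trace (A * B) = (\<Sum>i<d. \<Sum>j<d. A $$ (i, j) * B $$ (j, i))"
    unfolding mat_trace_carrier[OF mult_carrier_mat[OF assms]]
    by (intro sum.cong refl) (simp add: mat_mult_index[OF assms])
  also have "\<dots> = (\<Sum>j<d. \<Sum>i<d. A $$ (i, j) * B $$ (j, i))" by (rule sum.swap)
  also have "\<dots> = mat_trace (B * A)"
    unfolding mat_trace_carrier[OF mult_carrier_mat[OF assms(2,1)]]
    by (intro sum.cong refl) (simp add: mat_mult_index[OF assms(2,1)] mult.commute)
  finally show ?thesis .
qed

lemma trace_psd_mult:
  assumes "psd d A" "psd d B"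
  shows "mat_trace (A * B) = complex_of_real (Re (mat_trace (A * B)))" "0 \<le> Re (mat_trace (A * B))"
proof -
  obtain v m where v: "spec d B v m" "\<And>i. i < d \<Longrightarrow> 0 \<le> m i" using psd_obtain_spec[OF assms(2)] by blast
  have "mat_trace (A * B) = (\<Sum>j<d. complex_of_real (m j) * complex_of_real (Re (qf d A (v j))))"
    unfolding trace_mult_spec[OF psd_carrier[OF assms(1)] v(1)] by (subst psd_qf(1)[OF assms(1)]) (rule refl)
  then have "mat_trace (A * B) = complex_of_real (\<Sum>j<d. m j * Re (qf d A (v j)))" by simp
  moreover have "0 \<le> (\<Sum>j<d. m j * Re (qf d A (v j)))"
    using v(2) psd_qf(2)[OF assms(1)] by (intro sum_nonneg) auto
  ultimately show "mat_trace (A * B) = complex_of_real (Re (mat_trace (A * B)))" "0 \<le> Re (mat_trace (A * B))"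
    by simp_all
qed

text \<open>\<open>?M\<close> is the partial trace of \<open>(1 \<otimes> E) X\<close> over the
  second factor. With \<open>E\<close> diagonalised, its form at \<open>y\<close> is a nonnegative
  combination of the forms of \<open>X\<close> at the vectors
  \<open>y \<otimes> e r\<close>.\<close>

lemma psd_partial_trace:
  assumes E: "psd d E" and X: "psd (k * d) X"
  shows "psd k (mat k k (\<lambda>(i, j). mat_trace (E * mat d d (\<lambda>(p, q). X $$ (i * d + p, j * d + q)))))" (is "psd k ?M")
proof -
  obtain e l where e: "spec d E e l" "\<And>i. i < d \<Longrightarrow> 0 \<le> l i" using psd_obtain_spec[OF E] by blast
  show ?thesis
  proof (rule psdI)
    fix y
    let ?B = "\<lambda>i j. mat d d (\<lambda>(p, q). X $$ (i * d + p, j * d + q))"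
    have t: "mat_trace (E * ?B i j) = (\<Sum>r<d. complex_of_real (l r) * qf d (?B i j) (e r))" for i j
      by (subst trace_comm[OF psd_carrier[OF E]]) (auto intro: trace_mult_spec[OF _ e(1)])
    have "qf k ?M y = (\<Sum>i<k. \<Sum>j<k. \<Sum>r<d. complex_of_real (l r) * (cnj (y i) * qf d (?B i j) (e r) * y j))"
      unfolding qf_def[of k] by (intro sum.cong refl) (simp add: t sum_distrib_left sum_distrib_right mult_ac)
    also have "\<dots> = (\<Sum>r<d. complex_of_real (l r) * (\<Sum>i<k. \<Sum>j<k. cnj (y i) * qf d (?B i j) (e r) * y j))"
      unfolding sum_distrib_left by (rule sum_swap3[symmetric])
    also have "\<dots> = (\<Sum>r<d. complex_of_real (l r) * qf (k * d) X (\<lambda>n. y (n div d) * e r (n mod d)))"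
    proof (intro sum.cong refl arg_cong2[where f = "(*)"])
      fix r
      have "(\<Sum>i<k. \<Sum>j<k. cnj (y i) * qf d (?B i j) (e r) * y j)
        = (\<Sum>i<k. \<Sum>j<k. \<Sum>p<d. \<Sum>q<d. cnj (y i * e r p) * X $$ (i * d + p, j * d + q) * (y j * e r q))"
        unfolding qf_def by (intro sum.cong refl) (simp add: sum_distrib_left sum_distrib_right mult_ac)
      also have "\<dots> = (\<Sum>i<k. \<Sum>p<d. \<Sum>j<k. \<Sum>q<d. cnj (y i * e r p) * X $$ (i * d + p, j * d + q) * (y j * e r q))"
        by (rule sum.cong[OF refl], rule sum.swap)
      also have "\<dots> = (\<Sum>i<k. \<Sum>p<d. \<Sum>n<k * d. cnj (y i * e r p) * X $$ (i * d + p, (n div d) * d + n mod d) * (y (n div d) * e r (n mod d)))"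
        by (rule sum.cong[OF refl], rule sum.cong[OF refl], rule sum_pidx[OF pidx_kron, symmetric])
      also have "\<dots> = (\<Sum>n'<k * d. \<Sum>n<k * d. cnj (y (n' div d) * e r (n' mod d)) * X $$ ((n' div d) * d + n' mod d, (n div d) * d + n mod d) * (y (n div d) * e r (n mod d)))"
        by (rule sum_pidx[OF pidx_kron, symmetric])
      finally show "(\<Sum>i<k. \<Sum>j<k. cnj (y i) * qf d (?B i j) (e r) * y j) = qf (k * d) X (\<lambda>n. y (n div d) * e r (n mod d))"
        by (simp add: qf_def)
    qed
    also have "\<dots> = complex_of_real (\<Sum>r<d. l r * Re (qf (k * d) X (\<lambda>n. y (n div d) * e r (n mod d))))"
      by (subst psd_qf(1)[OF X]) simp
    finally have "qf k ?M y = complex_of_real (\<Sum>r<d. l r * Re (qf (k * d) X (\<lambda>n. y (n div d) * e r (n mod d))))" .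
    moreover have "0 \<le> (\<Sum>r<d. l r * Re (qf (k * d) X (\<lambda>n. y (n div d) * e r (n mod d))))"
      using e(2) psd_qf(2)[OF X] by (intro sum_nonneg) auto
    ultimately show "\<exists>r\<ge>0. qf k ?M y = complex_of_real r" by blast
  qed simp
qed

text \<open>Measure-and-prepare maps break entanglement: the ampliation of \<open>X\<close> is a sum
  of two Kronecker products, each pairing a partial trace of \<open>X\<close> against an effect with
  a prepared state.\<close>

lemma cptp_mprep:
  assumes E: "psd d E" "psd d (1\<^sub>m d - E)" and w: "density d' \<omega>" and t: "density d' \<tau>"
  shows "cptp d d' (mprep d E \<omega> \<tau>)"
proof -
  note Ec = psd_carrier[OF E(1)] and Fc = psd_carrier[OF E(2)]
  have wp: "psd d' \<omega>" "mat_trace \<omega> = 1" and tp: "psd d' \<tau>" "mat_trace \<tau> = 1" using w t by (auto simp: density_def)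
  note wc = psd_carrier[OF wp(1)] and tc = psd_carrier[OF tp(1)]
  have tadd: "mat_trace (A * (X + Y)) = mat_trace (A * X) + mat_trace (A * Y)"
    if "A \<in> carrier_mat d d" "X \<in> carrier_mat d d" "Y \<in> carrier_mat d d" for A X Y
    using that by (simp add: mult_add_distrib_mat[OF that] trace_add[of _ d])
  have tsm: "mat_trace (A * (c \<cdot>\<^sub>m X)) = c * mat_trace (A * X)"
    if "A \<in> carrier_mat d d" "X \<in> carrier_mat d d" for A X c
    using that by (simp add: mult_smult_distrib[OF that] trace_smult[of _ d])
  have "linear_map d d' (mprep d E \<omega> \<tau>)"
    unfolding linear_map_def
  proof (intro conjI ballI allI)
    fix X :: "complex mat" and c :: complex assume X: "X \<in> carrier_mat d d"
    show "mprep d E \<omega> \<tau> X \<in> carrier_mat d' d'" using wc tc by (simp add: mprep_def)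
    show "mprep d E \<omega> \<tau> (c \<cdot>\<^sub>m X) = c \<cdot>\<^sub>m mprep d E \<omega> \<tau> X"
      unfolding mprep_def tsm[OF Ec X] tsm[OF Fc X] using wc tc by (intro eq_matI) (auto simp: algebra_simps)
    fix Y :: "complex mat" assume Y: "Y \<in> carrier_mat d d"
    show "mprep d E \<omega> \<tau> (X + Y) = mprep d E \<omega> \<tau> X + mprep d E \<omega> \<tau> Y"
      unfolding mprep_def tadd[OF Ec X Y] tadd[OF Fc X Y] using wc tc by (intro eq_matI) (auto simp: algebra_simps)
  qed
  moreover have "completely_positive d d' (mprep d E \<omega> \<tau>)"
    unfolding completely_positive_def
  proof (intro allI impI)
    fix k X assume X: "psd (k * d) X"
    define M where "M E = mat k k (\<lambda>(i, j). mat_trace (E * mat d d (\<lambda>(p, q). X $$ (i * d + p, j * d + q))))" for E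
    have Mc: "M E \<in> carrier_mat k k" for E by (simp add: M_def)
    have pM: "psd k (M E)" "psd k (M (1\<^sub>m d - E))" unfolding M_def by (intro psd_partial_trace E X)+
    note kc = kron_carrier[OF pM(1) wp(1)] kron_carrier[OF pM(2) tp(1)]
    have "ampliation k d d' (mprep d E \<omega> \<tau>) X = kron (M E) \<omega> + kron (M (1\<^sub>m d - E)) \<tau>"
    proof (rule eq_matI)
      fix i j assume "i < dim_row (kron (M E) \<omega> + kron (M (1\<^sub>m d - E)) \<tau>)" "j < dim_col (kron (M E) \<omega> + kron (M (1\<^sub>m d - E)) \<tau>)"
      then have ij: "i < k * d'" "j < k * d'" using kc(2) by auto
      note less = pidx_less[OF pidx_kron ij(1)] pidx_less[OF pidx_kron ij(2)]
      have "(kron (M E) \<omega> + kron (M (1\<^sub>m d - E)) \<tau>) $$ (i, j) = kron (M E) \<omega> $$ (i, j) + kron (M (1\<^sub>m d - E)) \<tau> $$ (i, j)"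
        using ij kc by simp
      also have "\<dots> = M E $$ (i div d', j div d') * \<omega> $$ (i mod d', j mod d') + M (1\<^sub>m d - E) $$ (i div d', j div d') * \<tau> $$ (i mod d', j mod d')"
        unfolding kron_tens[OF Mc wc] kron_tens[OF Mc tc] using ij by (simp add: tens_def)
      finally show "ampliation k d d' (mprep d E \<omega> \<tau>) X $$ (i, j) = (kron (M E) \<omega> + kron (M (1\<^sub>m d - E)) \<tau>) $$ (i, j)"
        using ij less wc tc by (simp add: ampliation_def mprep_def M_def)
    qed (use kc in \<open>auto simp: ampliation_def\<close>)
    moreover have "psd (k * d') (kron (M E) \<omega> + kron (M (1\<^sub>m d - E)) \<tau>)"
      by (intro psd_add psd_kron pM wp tp)
    ultimately show "psd (k * d') (ampliation k d d' (mprep d E \<omega> \<tau>) X)" by simp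
  qed
  moreover have "trace_preserving d (mprep d E \<omega> \<tau>)"
    unfolding trace_preserving_def
  proof
    fix X :: "complex mat" assume X: "X \<in> carrier_mat d d"
    have "mat_trace (mprep d E \<omega> \<tau> X) = mat_trace (E * X) + mat_trace ((1\<^sub>m d - E) * X)"
      using wc tc by (simp add: mprep_def trace_add[of _ d'] trace_smult[of _ d'] wp tp)
    also have "(1\<^sub>m d - E) * X = X - E * X" using minus_mult_distrib_mat[OF one_carrier_mat Ec X] X by simp
    also have "mat_trace (X - E * X) = mat_trace X - mat_trace (E * X)"
      using X Ec by (intro trace_minus[of _ d]) auto
    finally show "mat_trace (mprep d E \<omega> \<tau> X) = mat_trace X" by simp
  qed
  ultimately show ?thesis by (simp add: cptp_def)
qed

text \<open>Pairing with matrix units reads off the entries. It settles uniqueness for the definite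
  description in \<open>adjoint_map\<close>.\<close>

lemma trace_form_nondegenerate:
  assumes "Z \<in> carrier_mat d d" "Z' \<in> carrier_mat d d"
    and "\<And>Y. Y \<in> carrier_mat d d \<Longrightarrow> mat_trace (Z * Y) = mat_trace (Z' * Y)"
  shows "Z = Z'"
proof -
  have *: "mat_trace (Z * mat d d (\<lambda>(i, j). of_bool (i = q) * of_bool (j = p))) = Z $$ (p, q)"
    if Z: "Z \<in> carrier_mat d d" and pq: "p < d" "q < d" for Z p q
  proof -
    let ?Y = "mat d d (\<lambda>(i, j). of_bool (i = q) * of_bool (j = p)) :: complex mat"
    have Y: "?Y \<in> carrier_mat d d" by simp
    have "mat_trace (Z * ?Y) = (\<Sum>i<d. (\<Sum>j<d. Z $$ (i, j) * of_bool (j = q)) * of_bool (i = p))"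
      unfolding mat_trace_carrier[OF mult_carrier_mat[OF Z Y]] sum_distrib_right
      by (intro sum.cong refl, subst mat_mult_index[OF Z Y]) (simp_all add: mult_ac)
    then show ?thesis using pq by (simp only: sum_of_bool_mult)
  qed
  show ?thesis
  proof (rule eq_matI)
    fix p q assume "p < dim_row Z'" "q < dim_col Z'"
    then have pq: "p < d" "q < d" using assms(2) by auto
    show "Z $$ (p, q) = Z' $$ (p, q)"
      using assms(3) *[OF assms(1) pq] *[OF assms(2) pq] by (metis mat_carrier)
  qed (use assms(1,2) in auto)
qed

text \<open>For \<open>E = phiK K\<close> the right-hand side is an isotropic operator, so the dual
  condition reduces to an inequality between the two traces.\<close>

lemma adjoint_mprep:
  assumes Ec: "E \<in> carrier_mat d d" and wc: "\<omega> \<in> carrier_mat d' d'" and tc: "\<tau> \<in> carrier_mat d' d'" and Yc: "Y \<in> carrier_mat d' d'"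
  shows "adjoint_map d (mprep d E \<omega> \<tau>) Y = mat_trace (Y * \<omega>) \<cdot>\<^sub>m E + mat_trace (Y * \<tau>) \<cdot>\<^sub>m (1\<^sub>m d - E)"
    (is "_ = ?Z")
proof -
  have Fc: "1\<^sub>m d - E \<in> carrier_mat d d" by (rule minus_carrier_mat[OF Ec])
  have Zc: "?Z \<in> carrier_mat d d" by (intro add_carrier_mat smult_carrier_mat Fc)
  have Z: "mat_trace (Y * mprep d E \<omega> \<tau> X) = mat_trace (?Z * X)" if X: "X \<in> carrier_mat d d" for X
  proof -
    let ?a = "mat_trace (E * X)" and ?b = "mat_trace ((1\<^sub>m d - E) * X)"
    have "Y * mprep d E \<omega> \<tau> X = ?a \<cdot>\<^sub>m (Y * \<omega>) + ?b \<cdot>\<^sub>m (Y * \<tau>)"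
      unfolding mprep_def mult_add_distrib_mat[OF Yc smult_carrier_mat[OF wc] smult_carrier_mat[OF tc]]
        mult_smult_distrib[OF Yc wc] mult_smult_distrib[OF Yc tc] ..
    then have 1: "mat_trace (Y * mprep d E \<omega> \<tau> X) = ?a * mat_trace (Y * \<omega>) + ?b * mat_trace (Y * \<tau>)"
      using wc tc Yc by (simp add: trace_add[of _ d'] trace_smult[of _ d'])
    have "?Z * X = mat_trace (Y * \<omega>) \<cdot>\<^sub>m (E * X) + mat_trace (Y * \<tau>) \<cdot>\<^sub>m ((1\<^sub>m d - E) * X)"
      using add_mult_distrib_mat[of "mat_trace (Y * \<omega>) \<cdot>\<^sub>m E" d d "mat_trace (Y * \<tau>) \<cdot>\<^sub>m (1\<^sub>m d - E)" X d] Ec Fc X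
      by (simp add: mult_smult_assoc_mat[OF Ec X] mult_smult_assoc_mat[OF Fc X])
    then have "mat_trace (?Z * X) = mat_trace (Y * \<omega>) * ?a + mat_trace (Y * \<tau>) * ?b"
      using Ec Fc X by (simp add: trace_add[of _ d] trace_smult[of _ d])
    with 1 show ?thesis by (simp add: mult.commute)
  qed
  show ?thesis
    unfolding adjoint_map_def
  proof (rule the_equality)
    fix W assume W: "W \<in> carrier_mat d d \<and> (\<forall>X\<in>carrier_mat d d. mat_trace (Y * mprep d E \<omega> \<tau> X) = mat_trace (W * X))"
    show "W = ?Z" by (rule trace_form_nondegenerate[OF _ Zc]) (use W Z in auto)
  qed (use Zc Z in auto)
qed

lemma cp_psd:
  assumes "cptp d d' \<Xi>" "psd d X" shows "psd d' (\<Xi> X)"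
proof -
  note Xc = psd_carrier[OF assms(2)]
  have c: "\<Xi> X \<in> carrier_mat d' d'" using assms Xc by (simp add: cptp_def linear_map_def)
  have e: "mat d d (\<lambda>(p, q). X $$ (0 * d + p, 0 * d + q)) = X" using Xc by (intro eq_matI) auto
  have "ampliation 1 d d' \<Xi> X = \<Xi> X"
  proof (rule eq_matI)
    fix i j assume "i < dim_row (\<Xi> X)" "j < dim_col (\<Xi> X)"
    then have ij: "i < d'" "j < d'" using c by auto
    then have "i div d' = 0" "j div d' = 0" by auto
    then show "ampliation 1 d d' \<Xi> X $$ (i, j) = \<Xi> X $$ (i, j)"
      using ij e by (simp add: ampliation_def)
  qed (use c in \<open>auto simp: ampliation_def\<close>)
  moreover have "psd (1 * d) X" using assms(2) by simp
  then have "psd (1 * d') (ampliation 1 d d' \<Xi> X)"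
    using assms(1) unfolding cptp_def completely_positive_def by blast
  ultimately show ?thesis by simp
qed

lemma cptp_density: "cptp d d' \<Xi> \<Longrightarrow> density d X \<Longrightarrow> density d' (\<Xi> X)"
  using cp_psd[of d d' \<Xi> X] by (auto simp: density_def cptp_def trace_preserving_def psd_carrier)

lemma cptp_lincomb:
  assumes "cptp d d' \<Xi>" "X \<in> carrier_mat d d" "Y \<in> carrier_mat d d"
  shows "\<Xi> (c \<cdot>\<^sub>m X + e \<cdot>\<^sub>m Y) = c \<cdot>\<^sub>m \<Xi> X + e \<cdot>\<^sub>m \<Xi> Y"
  using assms by (simp add: cptp_def linear_map_def)

section \<open>One-shot bounds\<close>

lemma robustness_le:
  assumes "\<sigma> \<in> sep a b" "0 \<le> r" "psd (a * b) (complex_of_real (1 + r) \<cdot>\<^sub>m \<sigma> - \<rho>)"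
  shows "robustness a b \<rho> \<le> ereal r"
  unfolding robustness_def by (rule Inf_lower) (use assms in blast)

text \<open>Attainment of the infimum is not established, so witnesses are drawn from strict bounds;
  the converse gives away a slack of 1 for this.\<close>

lemma robustness_lessE:
  assumes "robustness a b \<rho> < ereal d"
  obtains r \<sigma> where "0 \<le> r" "r < d" "\<sigma> \<in> sep a b" "psd (a * b) (complex_of_real (1 + r) \<cdot>\<^sub>m \<sigma> - \<rho>)"
  using assms unfolding robustness_def Inf_less_iff by auto

lemma Re_qf_le_of_psd_minus:
  assumes "psd d (A - B)" "A \<in> carrier_mat d d" "B \<in> carrier_mat d d"
  shows "Re (qf d B x) \<le> Re (qf d A x)"
  using psd_qf(2)[OF assms(1), of x] by (simp add: qf_minus[OF assms(2,3)])

lemma psd_minusI: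
  assumes "psd d A" "psd d B" "\<And>x. Re (qf d B x) \<le> Re (qf d A x)"
  shows "psd d (A - B)"
proof (rule psdI)
  note c = psd_carrier[OF assms(1)] psd_carrier[OF assms(2)]
  show "A - B \<in> carrier_mat d d" by (rule minus_carrier_mat[OF c(2)])
  fix x
  have "qf d (A - B) x = complex_of_real (Re (qf d A x) - Re (qf d B x))"
    unfolding qf_minus[OF c] of_real_diff using psd_qf(1)[OF assms(1), of x] psd_qf(1)[OF assms(2), of x] by metis
  then show "\<exists>r\<ge>0. qf d (A - B) x = complex_of_real r" using assms(3)[of x] by (metis diff_ge_0_iff_ge)
qed

lemma Re_qf_smult: "A \<in> carrier_mat d d \<Longrightarrow> Re (qf d (complex_of_real c \<cdot>\<^sub>m A) x) = c * Re (qf d A x)"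
  by (simp add: qf_smult)

lemma trace_phiK_square:
  assumes "K > 0" shows "mat_trace (phiK K * phiK K) = 1"
proof -
  have "mat_trace (phiK K * phiK K) = qf (K * K) (phiK K) (phi_vec K)"
    unfolding phiK_def by (rule trace_rk_mult[OF rk_carrier])
  also have "\<dots> = complex_of_real ((cmod (ip (K * K) (phi_vec K) (phi_vec K)))\<^sup>2)"
    unfolding phiK_def by (rule qf_rk)
  also have "ip (K * K) (phi_vec K) (phi_vec K) = mat_trace (phiK K)"
    unfolding mat_trace_carrier[OF phiK_carrier] ip_def
    by (intro sum.cong refl) (simp add: phiK_def rk_def mult.commute)
  finally show ?thesis using density_phiK[OF assms] by (simp add: density_def)
qed

lemma mprep_phiK:
  assumes "X \<in> carrier_mat (K * K) (K * K)" "mat_trace X = 1" "mat_trace (phiK K * X) = complex_of_real x"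
  shows "mprep (K * K) (phiK K) \<omega> \<tau> X = complex_of_real x \<cdot>\<^sub>m \<omega> + complex_of_real (1 - x) \<cdot>\<^sub>m \<tau>"
proof -
  have "(1\<^sub>m (K * K) - phiK K) * X = X - phiK K * X"
    using minus_mult_distrib_mat[OF one_carrier_mat phiK_carrier assms(1)] assms(1) by simp
  then have "mat_trace ((1\<^sub>m (K * K) - phiK K) * X) = complex_of_real (1 - x)"
    using trace_minus[OF assms(1) mult_carrier_mat[OF phiK_carrier assms(1)]] assms by simp
  then show ?thesis by (simp only: mprep_def assms(3))
qed

lemma mprep_phiK_phiK:
  assumes "K > 0" "\<omega> \<in> carrier_mat d d" "\<tau> \<in> carrier_mat d d"
  shows "mprep (K * K) (phiK K) \<omega> \<tau> (phiK K) = \<omega>"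
proof -
  have "mat_trace (phiK K * phiK K) = complex_of_real 1" using trace_phiK_square[OF assms(1)] by simp
  then have "mprep (K * K) (phiK K) \<omega> \<tau> (phiK K) = complex_of_real 1 \<cdot>\<^sub>m \<omega> + complex_of_real (1 - 1) \<cdot>\<^sub>m \<tau>"
    using density_phiK[OF assms(1)] by (intro mprep_phiK phiK_carrier) (auto simp: density_def)
  also have "\<dots> = \<omega>" using assms(2,3) by (intro eq_matI) auto
  finally show ?thesis .
qed

text \<open>A separable input has overlap \<open>x \<le> 1 / K\<close>, so the output
  \<open>x \<omega> + (1 - x) \<sigma>\<close> is at most \<open>(1 + x L) \<sigma>\<close>, and
  \<open>x L \<le> \<delta>\<close>.\<close>

lemma NE_achieve:
  assumes w: "density (a * b) \<omega>" and s: "\<sigma> \<in> sep a b" and L: "psd (a * b) (complex_of_real L \<cdot>\<^sub>m \<sigma> - \<omega>)" "0 \<le> L"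
    and K: "K > 0" "L \<le> \<delta> * real K" and d: "0 \<le> \<delta>"
  shows "\<exists>\<Lambda>\<in>NE \<delta> K K a b. \<Lambda> (phiK K) = \<omega>"
proof -
  let ?L = "mprep (K * K) (phiK K) \<omega> \<sigma>"
  note dp = density_phiK[OF K(1)]
  have pp: "psd (K * K) (phiK K)" "mat_trace (phiK K) = 1" using dp by (auto simp: density_def)
  have ds: "density (a * b) \<sigma>" by (rule sep_scone(2)[OF s])
  have wp: "psd (a * b) \<omega>" and sp: "psd (a * b) \<sigma>" using w ds by (auto simp: density_def)
  note wc = psd_carrier[OF wp] and sc = psd_carrier[OF sp]
  have c: "cptp (K * K) (a * b) ?L" by (rule cptp_mprep[OF pp(1) density_le_one[OF dp] w ds])
  have "robustness a b (?L X) \<le> ereal \<delta>" if X: "X \<in> sep K K" for X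
  proof -
    obtain x where x: "0 \<le> x" "x \<le> 1 / real K" "mat_trace (phiK K * X) = complex_of_real x"
      using sep_overlap[OF K(1) X] by blast
    have "density (K * K) X" by (rule sep_scone(2)[OF X])
    then have Xc: "X \<in> carrier_mat (K * K) (K * K)" "mat_trace X = 1" by (auto simp: density_def psd_carrier)
    have x1: "x \<le> 1"
    proof -
      have "1 / real K \<le> 1" using K(1) by (simp add: divide_le_eq)
      then show ?thesis using x(2) by linarith
    qed
    have LX: "?L X = complex_of_real x \<cdot>\<^sub>m \<omega> + complex_of_real (1 - x) \<cdot>\<^sub>m \<sigma>"
      by (rule mprep_phiK[OF Xc x(3)])
    have pL: "psd (a * b) (?L X)" using x(1) x1 unfolding LX by (intro psd_add psd_smult wp sp) auto
    have "psd (a * b) (complex_of_real (1 + \<delta>) \<cdot>\<^sub>m \<sigma> - ?L X)"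
    proof (rule psd_minusI[OF psd_smult[OF sp] pL])
      show "0 \<le> 1 + \<delta>" using d by simp
      fix y
      have q: "0 \<le> Re (qf (a * b) \<sigma> y)" by (rule psd_qf(2)[OF sp])
      have wL: "Re (qf (a * b) \<omega> y) \<le> L * Re (qf (a * b) \<sigma> y)"
        using Re_qf_le_of_psd_minus[OF L(1) smult_carrier_mat[OF sc] wc] by (simp add: qf_smult[OF sc])
      have "x * L \<le> \<delta>"
      proof -
        have "x * L \<le> 1 / real K * (\<delta> * real K)" using x(1,2) K(2) L(2) by (intro mult_mono) auto
        then show ?thesis using K(1) by simp
      qed
      then have xL: "x * L * Re (qf (a * b) \<sigma> y) \<le> \<delta> * Re (qf (a * b) \<sigma> y)" using q by (rule mult_right_mono)
      have "Re (qf (a * b) (?L X) y) = x * Re (qf (a * b) \<omega> y) + (1 - x) * Re (qf (a * b) \<sigma> y)"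
        unfolding LX using wc sc by (simp add: qf_add[of _ "a * b"] qf_smult)
      also have "\<dots> \<le> x * (L * Re (qf (a * b) \<sigma> y)) + (1 - x) * Re (qf (a * b) \<sigma> y)"
        using x(1) wL by (simp add: mult_left_mono)
      also have "\<dots> \<le> (1 + \<delta>) * Re (qf (a * b) \<sigma> y)"
        using xL mult_nonneg_nonneg[OF x(1) q] by (simp add: algebra_simps)
      finally show "Re (qf (a * b) (?L X) y) \<le> Re (qf (a * b) (complex_of_real (1 + \<delta>) \<cdot>\<^sub>m \<sigma>) y)"
        by (simp only: Re_qf_smult[OF sc])
    qed
    then show ?thesis by (rule robustness_le[OF s d])
  qed
  then have "?L \<in> NE \<delta> K K a b" using c by (simp add: NE_def)
  moreover have "?L (phiK K) = \<omega>" by (rule mprep_phiK_phiK[OF K(1) wc sc])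
  ultimately show ?thesis by blast
qed

lemma NE_converse:
  assumes r: "density (a * b) \<rho>" and N: "\<Lambda> \<in> NE \<delta> K K a b" and K: "K > 0" and d: "0 \<le> \<delta>"
    and t: "1 / 2 * trace_norm (\<Lambda> (phiK K) - \<rho>) \<le> \<epsilon>" "\<epsilon> \<le> 1"
  shows "rel_entropy_set \<rho> (sep a b)
    \<le> ereal ((ln (2 * (real K * (2 + \<delta>))) + 2 + \<epsilon> * ln (real (a * b)) + \<epsilon> * ln (2 * real (a * b))) / ln 2)"
proof -
  have c: "cptp (K * K) (a * b) \<Lambda>" and rob: "\<And>X. X \<in> sep K K \<Longrightarrow> robustness a b (\<Lambda> X) \<le> ereal \<delta>"
    using N by (auto simp: NE_def)
  have dw: "density (a * b) (\<Lambda> (phiK K))" by (rule cptp_density[OF c density_phiK[OF K]])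
  have d0: "a * b > 0"
  proof (rule ccontr)
    assume "\<not> a * b > 0"
    then have "a * b = 0" by simp
    then have "mat_trace \<rho> = 0" using r unfolding density_def by (auto simp: psd_def mat_trace_def)
    then show False using r by (simp add: density_def)
  qed
  \<comment> \<open>\<open>s1\<close> is the isotropic state at the separability threshold: its
    overlap is \<open>1 / K\<close>, and \<open>K s1 - \<Phi>\<close> is a nonnegative multiple of
    \<open>1 - \<Phi>\<close>, which \<open>\<Lambda>\<close> maps to a positive operator.\<close>
  define q where "q = 1 / (real K * (real K + 1))"
  have q: "0 \<le> q" by (simp add: q_def)
  define s1 where "s1 = iso K ((real K + 1) * q) q"
  have Kq: "(real K + 1) * q = 1 / real K" by (simp add: q_def)
  have s1: "s1 \<in> sep K K"
  proof (rule scone_sep)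
    show "s1 \<in> scone K K" unfolding s1_def using q by (intro iso_separable[OF K]) auto
    have "(real K + 1) * q + q * ((real K)\<^sup>2 - 1) = 1"
    proof -
      have "(real K + 1) * q + q * ((real K)\<^sup>2 - 1) = q * (real K * (real K + 1))" by (simp add: algebra_simps power2_eq_square)
      moreover have "real K * (real K + 1) \<noteq> 0" using K by simp
      then have "q * (real K * (real K + 1)) = 1" unfolding q_def by (metis nonzero_eq_divide_eq)
      ultimately show ?thesis by simp
    qed
    then show "mat_trace s1 = 1" unfolding s1_def iso_trace[OF K] by simp
  qed
  have s1c: "s1 \<in> carrier_mat (K * K) (K * K)" unfolding s1_def by (rule iso_carrier)
  \<comment> \<open>The slack 1 above \<open>\<delta>\<close> secures a witness and enters the bound
    as \<open>2 + \<delta>\<close>.\<close>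
  have "ereal \<delta> < ereal (1 + \<delta>)" by simp
  then have "robustness a b (\<Lambda> s1) < ereal (1 + \<delta>)" using rob[OF s1] by (rule le_less_trans[rotated])
  then obtain rr \<sigma> where rs: "0 \<le> rr" "rr < 1 + \<delta>" "\<sigma> \<in> sep a b" "psd (a * b) (complex_of_real (1 + rr) \<cdot>\<^sub>m \<sigma> - \<Lambda> s1)"
    by (rule robustness_lessE)
  have ds: "density (a * b) \<sigma>" by (rule sep_scone(2)[OF rs(3)])
  then have sp: "psd (a * b) \<sigma>" by (simp add: density_def)
  note sc = psd_carrier[OF sp]
  have lin: "\<Lambda> (iso K 0 (real K * q)) = complex_of_real (real K) \<cdot>\<^sub>m \<Lambda> s1 + complex_of_real (- 1) \<cdot>\<^sub>m \<Lambda> (phiK K)"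
  proof -
    have "iso K 0 (real K * q) = complex_of_real (real K) \<cdot>\<^sub>m s1 + complex_of_real (- 1) \<cdot>\<^sub>m phiK K"
      unfolding s1_def iso_phi iso_lincomb Kq using K by simp
    then show ?thesis by (simp only: cptp_lincomb[OF c s1c phiK_carrier])
  qed
  have p1: "psd (a * b) (\<Lambda> (iso K 0 (real K * q)))" using q by (intro cp_psd[OF c] iso_psd[OF K]) auto
  have pw: "psd (a * b) (\<Lambda> (phiK K))" using dw by (simp add: density_def)
  have ps1: "psd (a * b) (\<Lambda> s1)" using cptp_density[OF c sep_scone(2)[OF s1]] by (simp add: density_def)
  note wc = psd_carrier[OF pw] and s1c' = psd_carrier[OF ps1]
  define L where "L = real K * (1 + rr)"
  have L0: "L > 0" using K rs(1) by (simp add: L_def)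
  have "psd (a * b) (complex_of_real L \<cdot>\<^sub>m \<sigma> - \<Lambda> (phiK K))"
  proof (rule psd_minusI[OF psd_smult[OF sp] pw])
    show "0 \<le> L" using L0 by simp
    fix y
    have "Re (qf (a * b) (\<Lambda> (phiK K)) y) \<le> real K * Re (qf (a * b) (\<Lambda> s1) y)"
      using psd_qf(2)[OF p1, of y] wc s1c' unfolding lin by (simp add: qf_add[of _ "a * b"] qf_smult)
    also have "\<dots> \<le> real K * ((1 + rr) * Re (qf (a * b) \<sigma> y))"
      using Re_qf_le_of_psd_minus[OF rs(4) smult_carrier_mat[OF sc] s1c', of y]
      by (intro mult_left_mono) (simp_all only: Re_qf_smult[OF sc] of_nat_0_le_iff)
    finally show "Re (qf (a * b) (\<Lambda> (phiK K)) y) \<le> Re (qf (a * b) (complex_of_real L \<cdot>\<^sub>m \<sigma>) y)"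
      by (simp only: Re_qf_smult[OF sc] L_def mult.assoc)
  qed
  note ub = rel_entropy_upper_bound[OF dw r t ds L0 this]
  \<comment> \<open>The comparison state of \<open>rel_entropy_upper_bound\<close> competes in the
    infimum only if it is separable itself.\<close>
  let ?s = "complex_of_real (1 / 2) \<cdot>\<^sub>m \<sigma> + complex_of_real (1 / (2 * real (a * b))) \<cdot>\<^sub>m 1\<^sub>m (a * b)"
  have "?s \<in> sep a b"
  proof (rule scone_sep)
    show "?s \<in> scone a b" by (intro scone_add scone_smult scone_one sep_scone(1)[OF rs(3)]) auto
    have "mat_trace ?s = complex_of_real (1 / 2) * mat_trace \<sigma> + complex_of_real (1 / (2 * real (a * b))) * mat_trace (1\<^sub>m (a * b))"
      using trace_add[OF smult_carrier_mat[OF sc] smult_carrier_mat[OF one_carrier_mat]]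
      by (simp only: trace_smult[OF sc] trace_smult[OF one_carrier_mat])
    also have "mat_trace (1\<^sub>m (a * b)) = complex_of_real (real (a * b))" by (simp add: mat_trace_def)
    also have "complex_of_real (1 / (2 * real (a * b))) * complex_of_real (real (a * b)) = complex_of_real (1 / 2)"
      unfolding of_real_mult[symmetric] using d0 by simp
    also have "mat_trace \<sigma> = 1" using ds by (simp add: density_def)
    finally show "mat_trace ?s = 1" by simp
  qed
  then have "rel_entropy_set \<rho> (sep a b) \<le> rel_entropy \<rho> ?s" unfolding rel_entropy_set_def by (rule INF_lower)
  also note ub
  also have "ereal ((ln (2 * L) + 2 + \<epsilon> * ln (real (a * b)) + \<epsilon> * ln (2 * real (a * b))) / ln 2)
    \<le> ereal ((ln (2 * (real K * (2 + \<delta>))) + 2 + \<epsilon> * ln (real (a * b)) + \<epsilon> * ln (2 * real (a * b))) / ln 2)"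
  proof -
    have "L \<le> real K * (2 + \<delta>)" unfolding L_def using rs(2) by (intro mult_left_mono) auto
    then have "ln (2 * L) \<le> ln (2 * (real K * (2 + \<delta>)))" using L0 by (intro ln_mono) auto
    then show ?thesis by (simp add: divide_le_cancel)
  qed
  finally show ?thesis .
qed

lemma NE_to_DNE:
  assumes N: "\<Lambda> \<in> NE \<delta> K K a b" and K: "K > 0"
  shows "\<exists>\<Lambda>'\<in>DNE \<delta> (4 * K) (4 * K) a b. \<Lambda>' (phiK (4 * K)) = \<Lambda> (phiK K)"
proof -
  have c: "cptp (K * K) (a * b) \<Lambda>" and rob: "\<And>X. X \<in> sep K K \<Longrightarrow> robustness a b (\<Lambda> X) \<le> ereal \<delta>"
    using N by (auto simp: NE_def)
  let ?K = "4 * K"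
  have K': "?K > 0" using K by simp
  have K1: "real K \<ge> 1" using K by simp
  \<comment> \<open>The ratio \<open>p / q = 1 + K / 2\<close> is the midpoint between 1 (maximally
    mixed) and \<open>K + 1\<close> (separability threshold); \<open>q\<close> is fixed by trace
    one.\<close>
  define q where "q = 2 / (real K * (2 * real K + 1))"
  define p where "p = (1 + real K / 2) * q"
  have q: "0 < q" using K by (simp add: q_def)
  have p: "0 \<le> p" using q by (simp add: p_def)
  have qK: "q * real K * (2 * real K + 1) = 2"
  proof -
    have "2 * real K + 1 > 0" by (simp add: add_nonneg_pos)
    then have "real K * (2 * real K + 1) \<noteq> 0" using K by simp
    then have "q * (real K * (2 * real K + 1)) = 2" unfolding q_def by (metis nonzero_eq_divide_eq)
    then show ?thesis by (simp only: mult.assoc)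
  qed
  define t0 where "t0 = iso K p q"
  have t0s: "t0 \<in> sep K K"
  proof (rule scone_sep)
    have "p \<le> (real K + 1) * q" unfolding p_def using q by (intro mult_right_mono) auto
    then show "t0 \<in> scone K K" unfolding t0_def using p q by (intro iso_separable[OF K]) auto
    have "p + q * ((real K)\<^sup>2 - 1) = q * real K * (2 * real K + 1) / 2"
      by (simp add: p_def field_simps power2_eq_square)
    also have "\<dots> = 1" unfolding qK by simp
    finally show "mat_trace t0 = 1" unfolding t0_def iso_trace[OF K] by simp
  qed
  define w where "w = \<Lambda> (phiK K)"
  define t where "t = \<Lambda> t0"
  have dw: "density (a * b) w" unfolding w_def by (rule cptp_density[OF c density_phiK[OF K]])
  have dt: "density (a * b) t" unfolding t_def by (rule cptp_density[OF c sep_scone(2)[OF t0s]])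
  have wp: "psd (a * b) w" and tp: "psd (a * b) t" using dw dt by (auto simp: density_def)
  note wc = psd_carrier[OF wp] and tc = psd_carrier[OF tp] and pc = phiK_carrier[of ?K]
  note dp = density_phiK[OF K']
  have pp: "psd (?K * ?K) (phiK ?K)" "mat_trace (phiK ?K) = 1" using dp by (auto simp: density_def)
  let ?L = "mprep (?K * ?K) (phiK ?K) w t"
  have cL: "cptp (?K * ?K) (a * b) ?L" by (rule cptp_mprep[OF pp(1) density_le_one[OF dp] dw dt])
  have "robustness a b (?L X) \<le> ereal \<delta>" if X: "X \<in> sep ?K ?K" for X
  proof -
    obtain x where x: "0 \<le> x" "x \<le> 1 / real ?K" "mat_trace (phiK ?K * X) = complex_of_real x"
      using sep_overlap[OF K' X] by blast
    have "density (?K * ?K) X" by (rule sep_scone(2)[OF X])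
    then have Xc: "X \<in> carrier_mat (?K * ?K) (?K * ?K)" "mat_trace X = 1" by (auto simp: density_def psd_carrier)
    have x4: "4 * real K * x \<le> 1" using x(2) K by (simp add: field_simps)
    \<comment> \<open>\<open>4 K \<ge> 2 K + 2\<close> for \<open>K \<ge> 1\<close>: this is what
      the factor 4 in the dimension supplies for the primal condition.\<close>
    have x2: "x * (2 * real K + 2) \<le> 1"
    proof -
      have "x * (2 * real K + 2) \<le> x * (4 * real K)" using x(1) K1 by (intro mult_left_mono) auto
      then show ?thesis using x4 by (simp add: mult_ac)
    qed
    have x1: "x \<le> 1"
    proof -
      have "x * 1 \<le> x * (2 * real K + 2)" using x(1) K1 by (intro mult_left_mono) auto
      then show ?thesis using x2 by simp
    qed
    have "?L X = complex_of_real x \<cdot>\<^sub>m w + complex_of_real (1 - x) \<cdot>\<^sub>m t"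
      by (rule mprep_phiK[OF Xc x(3)])
    \<comment> \<open>By linearity the output is the image under \<open>\<Lambda>\<close> of a
      single isotropic state, so the hypothesis on \<open>\<Lambda>\<close> applies once that state
      is separable.\<close>
    also have "\<dots> = \<Lambda> (complex_of_real x \<cdot>\<^sub>m phiK K + complex_of_real (1 - x) \<cdot>\<^sub>m t0)"
      unfolding w_def t_def by (rule cptp_lincomb[OF c phiK_carrier, symmetric]) (simp add: t0_def iso_carrier)
    also have "complex_of_real x \<cdot>\<^sub>m phiK K + complex_of_real (1 - x) \<cdot>\<^sub>m t0 = iso K (x + (1 - x) * p) ((1 - x) * q)"
      unfolding t0_def iso_phi iso_lincomb by simp
    finally have LX: "?L X = \<Lambda> (iso K (x + (1 - x) * p) ((1 - x) * q))" .
    have "iso K (x + (1 - x) * p) ((1 - x) * q) \<in> sep K K"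
    proof (rule scone_sep)
      have "x * (2 * real K + 1) \<le> 1 - x" using x2 by (simp add: algebra_simps)
      then have "(x * (2 * real K + 1)) * (q * real K) \<le> (1 - x) * (q * real K)" using q by (intro mult_right_mono) auto
      moreover have "(x * (2 * real K + 1)) * (q * real K) = 2 * x"
        using qK by (metis (no_types, opaque_lifting) mult.assoc mult.commute)
      ultimately have "2 * x \<le> (1 - x) * (q * real K)" by simp
      moreover have "(real K + 1) * ((1 - x) * q) - (x + (1 - x) * p) = (1 - x) * (q * real K) / 2 - x"
        by (simp add: p_def field_simps)
      ultimately have le: "x + (1 - x) * p \<le> (real K + 1) * ((1 - x) * q)" by linarith
      show "iso K (x + (1 - x) * p) ((1 - x) * q) \<in> scone K K"
        using x(1) x1 p q le by (intro iso_separable[OF K]) auto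
      have "p + q * ((real K)\<^sup>2 - 1) = q * real K * (2 * real K + 1) / 2"
        by (simp add: p_def field_simps power2_eq_square)
      then have pq1: "p + q * ((real K)\<^sup>2 - 1) = 1" unfolding qK by simp
      have "x + (1 - x) * p + (1 - x) * q * ((real K)\<^sup>2 - 1) = x + (1 - x) * (p + q * ((real K)\<^sup>2 - 1))"
        by (simp add: algebra_simps)
      also have "\<dots> = 1" unfolding pq1 by simp
      finally show "mat_trace (iso K (x + (1 - x) * p) ((1 - x) * q)) = 1" unfolding iso_trace[OF K] by (simp only: of_real_1)
    qed
    then show ?thesis unfolding LX by (rule rob)
  qed
  then have LN: "?L \<in> NE \<delta> ?K ?K a b" using cL by (simp add: NE_def)
  have "adjoint_map (?K * ?K) ?L Y \<in> cone (sep ?K ?K)" if Y: "Y \<in> sep a b" for Y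
  proof -
    have Yp: "psd (a * b) Y" using sep_scone(2)[OF Y] by (simp add: density_def)
    note Yc = psd_carrier[OF Yp]
    define P where "P = Re (mat_trace (Y * w))"
    define Q where "Q = Re (mat_trace (Y * t))"
    have P: "mat_trace (Y * w) = complex_of_real P" "0 \<le> P" unfolding P_def by (fact trace_psd_mult[OF Yp wp])+
    have Q: "mat_trace (Y * t) = complex_of_real Q" "0 \<le> Q" unfolding Q_def by (fact trace_psd_mult[OF Yp tp])+
    have adj: "adjoint_map (?K * ?K) ?L Y = iso ?K P Q"
      unfolding adjoint_mprep[OF pc wc tc Yc] P Q iso_def ..
    \<comment> \<open>The overlap \<open>p\<close> makes \<open>(4 K + 1) t0 - \<Phi>\<close>
      positive; applying \<open>\<Lambda>\<close> gives \<open>w \<le> (4 K + 1) t\<close>, and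
      pairing with \<open>Y\<close> gives the threshold inequality in dimension
      \<open>4 K\<close>.\<close>
    let ?z = "iso K ((4 * real K + 1) * p - 1) ((4 * real K + 1) * q)"
    have "(2 + real K) * (4 * real K + 1) \<ge> real K * (2 * real K + 1)" by (simp add: algebra_simps)
    then have "q * ((2 + real K) * (4 * real K + 1)) \<ge> q * (real K * (2 * real K + 1))" using q by (intro mult_left_mono) auto
    then have "(4 * real K + 1) * p - 1 \<ge> 0" using qK by (simp add: p_def algebra_simps)
    then have "psd (a * b) (\<Lambda> ?z)" using q by (intro cp_psd[OF c] iso_psd[OF K]) auto
    moreover have "\<Lambda> ?z = complex_of_real (4 * real K + 1) \<cdot>\<^sub>m t + complex_of_real (- 1) \<cdot>\<^sub>m w"
    proof -
      have "?z = complex_of_real (4 * real K + 1) \<cdot>\<^sub>m t0 + complex_of_real (- 1) \<cdot>\<^sub>m phiK K"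
        unfolding t0_def iso_phi iso_lincomb by simp
      then show ?thesis unfolding t_def w_def
        by (simp only: cptp_lincomb[OF c _ phiK_carrier] t0_def iso_carrier)
    qed
    ultimately have "0 \<le> Re (mat_trace (Y * (complex_of_real (4 * real K + 1) \<cdot>\<^sub>m t + complex_of_real (- 1) \<cdot>\<^sub>m w)))"
      using trace_psd_mult(2)[OF Yp] by metis
    also have "Y * (complex_of_real (4 * real K + 1) \<cdot>\<^sub>m t + complex_of_real (- 1) \<cdot>\<^sub>m w)
      = complex_of_real (4 * real K + 1) \<cdot>\<^sub>m (Y * t) + complex_of_real (- 1) \<cdot>\<^sub>m (Y * w)"
      unfolding mult_add_distrib_mat[OF Yc smult_carrier_mat[OF tc] smult_carrier_mat[OF wc]]
        mult_smult_distrib[OF Yc tc] mult_smult_distrib[OF Yc wc] ..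
    also have "mat_trace \<dots> = complex_of_real (4 * real K + 1) * complex_of_real Q + complex_of_real (- 1) * complex_of_real P"
      using trace_add[OF smult_carrier_mat[OF mult_carrier_mat[OF Yc tc]] smult_carrier_mat[OF mult_carrier_mat[OF Yc wc]]]
      by (simp only: trace_smult[OF mult_carrier_mat[OF Yc tc]] trace_smult[OF mult_carrier_mat[OF Yc wc]] P Q)
    also have "\<dots> = complex_of_real ((4 * real K + 1) * Q - P)" by simp
    finally have "P \<le> (real ?K + 1) * Q" by (simp only: Re_complex_of_real) simp
    then have "iso ?K P Q \<in> scone ?K ?K" using P(2) Q(2) by (intro iso_separable[OF K']) auto
    moreover have "sep ?K ?K \<noteq> {}" using sep_max_mixed[of ?K ?K] K' by auto
    ultimately show ?thesis unfolding adj by (rule scone_cone)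
  qed
  then have "?L \<in> DNE \<delta> ?K ?K a b" using LN by (auto simp: DNE_def)
  moreover have "?L (phiK ?K) = w" by (rule mprep_phiK_phiK[OF K' wc tc])
  ultimately show ?thesis unfolding w_def by blast
qed

section \<open>Smoothing the max-relative entropy\<close>

lemma sum_of_bool_ge: "(\<Sum>i\<in>A. of_bool (P i) * f i) + (\<Sum>i\<in>A. of_bool (\<not> P i) * f i) = (\<Sum>i\<in>A. f i)"
  for f :: "'a \<Rightarrow> real"
  unfolding sum.distrib[symmetric] by (intro sum.cong refl) auto

lemma ip_diff_left: "ip d (\<lambda>p. x p - y p) z = ip d x z - ip d y z"
  by (simp add: ip_def algebra_simps sum_subtractf)

lemma ip_diff_right: "ip d z (\<lambda>p. x p - y p) = ip d z x - ip d z y"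
  by (simp add: ip_def algebra_simps sum_subtractf)

text \<open>Factor the difference of squares and apply the weighted arithmetic-geometric inequality.
  Both sides of the result are quadratic, so it can be summed over an orthonormal basis by
  Parseval.\<close>

lemma square_diff_le:
  fixes z w :: complex
  assumes "0 < c"
  shows "\<bar>(cmod z)\<^sup>2 - (cmod w)\<^sup>2\<bar> \<le> (cmod (w - z))\<^sup>2 / (2 * c) + c * ((cmod z)\<^sup>2 + (cmod w)\<^sup>2)"
proof -
  define D where "D = cmod (w - z)"
  define S where "S = cmod z + cmod w"
  have "\<bar>cmod z - cmod w\<bar> \<le> D" unfolding D_def by (metis norm_minus_commute norm_triangle_ineq3)
  moreover have "S \<ge> 0" by (simp add: S_def)
  moreover have "(cmod z)\<^sup>2 - (cmod w)\<^sup>2 = (cmod z - cmod w) * S" by (simp add: S_def algebra_simps power2_eq_square)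
  ultimately have "\<bar>(cmod z)\<^sup>2 - (cmod w)\<^sup>2\<bar> \<le> D * S" by (simp add: abs_mult mult_right_mono)
  also have "D * S \<le> D\<^sup>2 / (2 * c) + c / 2 * S\<^sup>2"
  proof -
    have "0 \<le> (D - c * S)\<^sup>2 / (2 * c)" using assms by simp
    also have "\<dots> = D\<^sup>2 / (2 * c) + c / 2 * S\<^sup>2 - D * S" using assms by (simp add: field_simps power2_eq_square)
    finally show ?thesis by simp
  qed
  also have "c / 2 * S\<^sup>2 \<le> c * ((cmod z)\<^sup>2 + (cmod w)\<^sup>2)"
  proof -
  have "S\<^sup>2 \<le> 2 * ((cmod z)\<^sup>2 + (cmod w)\<^sup>2)"
    unfolding S_def using sum_squares_bound[of "cmod z" "cmod w"] by (simp add: power2_sum)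
  then have "c / 2 * S\<^sup>2 \<le> c / 2 * (2 * ((cmod z)\<^sup>2 + (cmod w)\<^sup>2))" using assms by (intro mult_left_mono) auto
  moreover have "c / 2 * (2 * ((cmod z)\<^sup>2 + (cmod w)\<^sup>2)) = c * ((cmod z)\<^sup>2 + (cmod w)\<^sup>2)" by simp
  ultimately show ?thesis by linarith
  qed
  finally show ?thesis by (simp only: D_def)
qed

text \<open>
  Cutting \<open>\<rho>\<close> down to its eigenvectors below \<open>\<theta>\<close> and then to the eigenvectors of \<open>\<sigma>\<close> above \<open>\<kappa>\<close>
  yields an operator below \<open>(\<theta> / \<kappa>) \<sigma>\<close>, which is close to \<open>\<rho>\<close> by gentle measurement; the missing
  trace is refilled with \<open>\<sigma>\<close>.
\<close>

lemma smoothing: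
  assumes r: "density d \<rho>" "spec d \<rho> u r" and s: "density d \<sigma>" "spec d \<sigma> v s"
    and th: "0 < \<theta>" "0 < \<kappa>" and eps: "0 < \<epsilon>" "\<epsilon> \<le> 1"
    and bad: "(\<Sum>i<d. of_bool (\<not> r i \<le> \<theta>) * r i) + (\<Sum>j<d. of_bool (\<not> \<kappa> \<le> s j) * Re (qf d \<rho> (v j))) \<le> \<epsilon>\<^sup>2 / 2"
  shows "\<exists>\<omega>. density d \<omega> \<and> psd d (complex_of_real (\<theta> / \<kappa> + 1) \<cdot>\<^sub>m \<sigma> - \<omega>) \<and> 1 / 2 * trace_norm (\<omega> - \<rho>) \<le> \<epsilon>"
proof -
  have rp: "psd d \<rho>" "mat_trace \<rho> = 1" and sp: "psd d \<sigma>" "mat_trace \<sigma> = 1" using r s by (auto simp: density_def)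
  note rc = psd_carrier[OF rp(1)] and sc = psd_carrier[OF sp(1)]
  note ou = spec_onb[OF r(2)] and ov = spec_onb[OF s(2)]
  have r0: "\<And>i. i < d \<Longrightarrow> 0 \<le> r i" using psd_spec_nonneg[OF rp(1) r(2)] .
  have s0: "\<And>i. i < d \<Longrightarrow> 0 \<le> s i" using psd_spec_nonneg[OF sp(1) s(2)] .
  have r1: "(\<Sum>i<d. r i) = 1" using rp(2) trace_spec[OF r(2)] by (metis of_real_eq_1_iff)
  define G where "G i \<longleftrightarrow> r i \<le> \<theta>" for i
  define J where "J j \<longleftrightarrow> \<kappa> \<le> s j" for j
  define pr where "pr x = (\<lambda>p. \<Sum>j<d. (of_bool (J j) * ip d (v j) x) * v j p)" for x
  define nsq where "nsq x = (\<Sum>p<d. (cmod (x p))\<^sup>2)" for x :: "nat \<Rightarrow> complex"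
  have ipr: "ip d (v k) (pr x) = of_bool (J k) * ip d (v k) x" if "k < d" for k x
  proof -
    have "ip d (v k) (pr x) = (\<Sum>j<d. (of_bool (J j) * ip d (v j) x) * of_bool (k = j))"
      unfolding pr_def ip_sum_right using onb_ip[OF ov that] by (intro sum.cong refl) simp
    then show ?thesis using that by (simp only: sum_of_bool_mult)
  qed
  have ipr2: "ip d (pr y) x = ip d y (pr x)" for x y
  proof -
    have "ip d (pr y) x = cnj (ip d x (pr y))" by (rule ip_cnj[symmetric])
    also have "\<dots> = (\<Sum>j<d. (of_bool (J j) * ip d y (v j)) * ip d (v j) x)"
      unfolding pr_def ip_sum_right cnj_sum complex_cnj_mult ip_cnj by (intro sum.cong refl) (simp add: of_bool_def)
    also have "\<dots> = ip d y (pr x)" unfolding pr_def ip_sum_right by (intro sum.cong refl) (simp only: mult_ac)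
    finally show ?thesis .
  qed
  have nsqv: "nsq x = (\<Sum>j<d. (cmod (ip d (v j) x))\<^sup>2)" for x unfolding nsq_def by (rule parseval[OF ov, symmetric])
  have npr: "nsq (pr x) = (\<Sum>j<d. of_bool (J j) * (cmod (ip d (v j) x))\<^sup>2)" for x
    unfolding nsqv by (intro sum.cong refl) (simp add: ipr)
  have npr': "nsq (\<lambda>p. x p - pr x p) = (\<Sum>j<d. of_bool (\<not> J j) * (cmod (ip d (v j) x))\<^sup>2)" for x
    unfolding nsqv by (intro sum.cong refl) (simp add: ip_diff_right ipr)
  have pyth: "nsq (pr x) + nsq (\<lambda>p. x p - pr x p) = nsq x" for x
    unfolding npr npr' sum_of_bool_ge by (rule nsqv[symmetric])
  have nu: "nsq (u i) = 1" if "i < d" for i unfolding nsq_def by (rule onb_norm[OF ou that])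
  \<comment> \<open>Eigenvectors above \<open>\<theta>\<close> are dropped and the others projected;
    \<open>f i\<close> is the squared norm lost, and \<open>e\<close> the expected loss.\<close>
  define y where "y i = (if G i then pr (u i) else (\<lambda>p. 0))" for i
  define f where "f i = nsq (\<lambda>p. u i p - y i p)" for i
  have nsq0: "0 \<le> nsq x" for x unfolding nsq_def by (intro sum_nonneg) auto
  have yf: "nsq (y i) + f i = 1" if "i < d" for i
    unfolding f_def y_def using pyth[of "u i"] nu[OF that] by (auto simp: nsq_def)
  have y1: "nsq (y i) \<le> 1" if "i < d" for i using yf[OF that] nsq0[of "\<lambda>p. u i p - y i p"] by (simp add: f_def)
  define e where "e = (\<Sum>i<d. r i * f i)"
  have e0: "0 \<le> e" unfolding e_def f_def using r0 nsq0 by (intro sum_nonneg) auto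
  have ee: "e \<le> \<epsilon>\<^sup>2 / 2"
  proof -
    have "f i \<le> of_bool (\<not> G i) + (\<Sum>j<d. of_bool (\<not> J j) * (cmod (ip d (u i) (v j)))\<^sup>2)" if "i < d" for i
    proof (cases "G i")
      case True
      then show ?thesis by (simp add: f_def y_def npr' cmod_ip_commute)
    next
      case False
      then have "f i = 1" using nu[OF that] by (simp add: f_def y_def)
      moreover have "0 \<le> (\<Sum>j<d. of_bool (\<not> J j) * (cmod (ip d (u i) (v j)))\<^sup>2)" by (intro sum_nonneg) auto
      ultimately show ?thesis using False by simp
    qed
    then have "e \<le> (\<Sum>i<d. r i * (of_bool (\<not> G i) + (\<Sum>j<d. of_bool (\<not> J j) * (cmod (ip d (u i) (v j)))\<^sup>2)))"
      unfolding e_def using r0 by (intro sum_mono mult_left_mono) auto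
    also have "\<dots> = (\<Sum>i<d. of_bool (\<not> G i) * r i) + (\<Sum>i<d. \<Sum>j<d. of_bool (\<not> J j) * (r i * (cmod (ip d (u i) (v j)))\<^sup>2))"
      unfolding distrib_left sum.distrib sum_distrib_left by (simp only: mult_ac)
    also have "(\<Sum>i<d. \<Sum>j<d. of_bool (\<not> J j) * (r i * (cmod (ip d (u i) (v j)))\<^sup>2)) = (\<Sum>j<d. of_bool (\<not> J j) * Re (qf d \<rho> (v j)))"
      unfolding spec_Re_qf[OF r(2)] sum_distrib_left by (rule sum.swap)
    finally show ?thesis using bad by (simp add: G_def J_def)
  qed
  define w0 where "w0 = mat d d (\<lambda>(i, j). \<Sum>k<d. complex_of_real (r k) * rk d (y k) $$ (i, j))"
  have qw0: "qf d w0 x = complex_of_real (\<Sum>k<d. r k * (cmod (ip d (y k) x))\<^sup>2)" for x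
    unfolding w0_def qf_mat_sum qf_rk by simp
  have w0c: "w0 \<in> carrier_mat d d" by (simp add: w0_def)
  have w0p: "psd d w0"
  proof (rule psdI[OF w0c])
    fix x
    have "0 \<le> (\<Sum>k<d. r k * (cmod (ip d (y k) x))\<^sup>2)" using r0 by (intro sum_nonneg) auto
    then show "\<exists>r\<ge>0. qf d w0 x = complex_of_real r" using qw0 by blast
  qed
  have tw0: "mat_trace w0 = complex_of_real (1 - e)"
  proof -
    have "mat_trace w0 = (\<Sum>k<d. qf d w0 (v k))" by (rule trace_onb[OF w0c ov])
    also have "\<dots> = complex_of_real (\<Sum>j<d. \<Sum>k<d. r k * (cmod (ip d (y k) (v j)))\<^sup>2)" unfolding qw0 by simp
    also have "(\<Sum>j<d. \<Sum>k<d. r k * (cmod (ip d (y k) (v j)))\<^sup>2) = (\<Sum>k<d. r k * nsq (y k))"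
      unfolding nsqv sum_distrib_left
      by (subst sum.swap) (simp only: cmod_ip_commute[of d "y _"])
    also have "\<dots> = (\<Sum>k<d. r k - r k * f k)"
    proof (intro sum.cong refl)
      fix k assume "k \<in> {..<d}"
      then have "nsq (y k) = 1 - f k" using yf[of k] by simp
      then show "r k * nsq (y k) = r k - r k * f k" by (simp only: right_diff_distrib mult_1_right)
    qed
    also have "\<dots> = 1 - e" by (simp add: sum_subtractf r1 e_def)
    finally show ?thesis .
  qed
  have e1: "e \<le> 1"
  proof -
    have "e \<le> (\<Sum>i<d. r i * 1)" unfolding e_def
    proof (intro sum_mono mult_left_mono)
      fix i assume "i \<in> {..<d}"
      then show "f i \<le> 1" using yf[of i] nsq0[of "y i"] by simp
    qed (use r0 in auto)
    then show ?thesis by (simp add: r1)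
  qed
  \<comment> \<open>\<open>e\<close> is the trace missing from \<open>w0\<close>. Refilling with
    \<open>\<sigma>\<close> keeps the operator dominated, at the price of the summand 1 in
    \<open>\<theta> / \<kappa> + 1\<close>.\<close>
  define w where "w = w0 + complex_of_real e \<cdot>\<^sub>m \<sigma>"
  have wp: "psd d w" unfolding w_def using e0 by (intro psd_add w0p psd_smult sp(1))
  have wc: "w \<in> carrier_mat d d" by (rule psd_carrier[OF wp])
  have qw: "Re (qf d w x) = (\<Sum>k<d. r k * (cmod (ip d (y k) x))\<^sup>2) + e * Re (qf d \<sigma> x)" for x
    unfolding w_def qf_add[OF w0c smult_carrier_mat[OF sc]] qf_smult[OF sc] qw0 by simp
  have "mat_trace w = 1"
    unfolding w_def trace_add[OF w0c smult_carrier_mat[OF sc]] trace_smult[OF sc] tw0 sp(2) by simp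
  then have dw: "density d w" using wp by (simp add: density_def)
  have dom: "psd d (complex_of_real (\<theta> / \<kappa> + 1) \<cdot>\<^sub>m \<sigma> - w)"
  proof (rule psd_minusI[OF psd_smult[OF sp(1)] wp])
    show "0 \<le> \<theta> / \<kappa> + 1" using th by simp
    fix x
    \<comment> \<open>For retained \<open>k\<close> the eigenvalue is at most
      \<open>\<theta>\<close>, and the projected vector sees only eigenvalues of
      \<open>\<sigma>\<close> that are at least \<open>\<kappa>\<close>.\<close>
    have "(\<Sum>k<d. r k * (cmod (ip d (y k) x))\<^sup>2) \<le> (\<Sum>k<d. \<theta> * (cmod (ip d (u k) (pr x)))\<^sup>2)"
    proof (rule sum_mono)
      fix k assume "k \<in> {..<d}"
      show "r k * (cmod (ip d (y k) x))\<^sup>2 \<le> \<theta> * (cmod (ip d (u k) (pr x)))\<^sup>2"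
      proof (cases "G k")
        case True
        then have "y k = pr (u k)" by (simp add: y_def)
        then have "ip d (y k) x = ip d (u k) (pr x)" using ipr2 by simp
        then show ?thesis using True by (simp add: G_def mult_right_mono)
      next
        case False
        then have "ip d (y k) x = 0" by (simp add: y_def ip_def)
        then show ?thesis using th by simp
      qed
    qed
    also have "\<dots> = \<theta> * nsq (pr x)" unfolding sum_distrib_left[symmetric] parseval[OF ou] nsq_def ..
    also have "\<dots> = \<theta> / \<kappa> * (\<Sum>j<d. \<kappa> * (of_bool (J j) * (cmod (ip d (v j) x))\<^sup>2))"
      unfolding npr using th by (simp add: sum_distrib_left[symmetric])
    also have "\<dots> \<le> \<theta> / \<kappa> * (\<Sum>j<d. s j * (cmod (ip d (v j) x))\<^sup>2)"
      using th s0 by (intro mult_left_mono sum_mono) (auto simp: J_def of_bool_def mult_right_mono)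
    also have "\<dots> = \<theta> / \<kappa> * Re (qf d \<sigma> x)" by (simp only: spec_Re_qf[OF s(2)])
    finally have "(\<Sum>k<d. r k * (cmod (ip d (y k) x))\<^sup>2) \<le> \<theta> / \<kappa> * Re (qf d \<sigma> x)" .
    moreover have "e * Re (qf d \<sigma> x) \<le> 1 * Re (qf d \<sigma> x)" using e1 psd_qf(2)[OF sp(1)] by (intro mult_right_mono) auto
    ultimately show "Re (qf d w x) \<le> Re (qf d (complex_of_real (\<theta> / \<kappa> + 1) \<cdot>\<^sub>m \<sigma>) x)"
      unfolding qw Re_qf_smult[OF sc] by (simp add: distrib_right)
  qed
  have "Im (qf d (w - \<rho>) x) = 0" for x
    using wp rp(1) by (simp add: qf_minus[OF wc rc] psd_iff)
  then obtain x l where X: "spec d (w - \<rho>) x l"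
    using real_qf_spec[of "w - \<rho>" d, OF minus_carrier_mat[OF rc]] by blast
  note ox = spec_onb[OF X]
  \<comment> \<open>This choice balances the error: \<open>e / (2 c) \<le> \<epsilon> / 2\<close>
    since \<open>e \<le> \<epsilon>^2 / 2\<close>, then \<open>2 c = \<epsilon>\<close>, and
    \<open>e \<le> \<epsilon> / 2\<close> for the refill, in total
    \<open>2 * \<epsilon>\<close>.\<close>
  define c where "c = \<epsilon> / 2"
  have c: "0 < c" using eps by (simp add: c_def)
  let ?T = "\<lambda>i k. r i * ((cmod (ip d (\<lambda>p. u i p - y i p) (x k)))\<^sup>2 / (2 * c) + c * ((cmod (ip d (y i) (x k)))\<^sup>2 + (cmod (ip d (u i) (x k)))\<^sup>2))"
  let ?A = "\<lambda>i k. r i * ((cmod (ip d (y i) (x k)))\<^sup>2 - (cmod (ip d (u i) (x k)))\<^sup>2)"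
  have "\<bar>l k\<bar> \<le> (\<Sum>i<d. ?T i k)
      + e * Re (qf d \<sigma> (x k))" if k: "k < d" for k
  proof -
    have "l k = Re (qf d (w - \<rho>) (x k))" using spec_eigenvalue[OF X k] by simp
    also have "\<dots> = (\<Sum>i<d. ?A i k) + e * Re (qf d \<sigma> (x k))"
      unfolding qf_minus[OF wc rc] minus_complex.sel qw spec_Re_qf[OF r(2)] by (simp add: right_diff_distrib sum_subtractf)
    finally have lk: "l k = (\<Sum>i<d. ?A i k) + e * Re (qf d \<sigma> (x k))" .
    have "\<bar>l k\<bar> \<le> \<bar>\<Sum>i<d. ?A i k\<bar> + \<bar>e * Re (qf d \<sigma> (x k))\<bar>"
      unfolding lk by (rule abs_triangle_ineq)
    also have "\<bar>e * Re (qf d \<sigma> (x k))\<bar> = e * Re (qf d \<sigma> (x k))" using e0 psd_qf(2)[OF sp(1)] by simp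
    also have "\<bar>\<Sum>i<d. ?A i k\<bar>
      \<le> (\<Sum>i<d. \<bar>r i * ((cmod (ip d (y i) (x k)))\<^sup>2 - (cmod (ip d (u i) (x k)))\<^sup>2)\<bar>)" by (rule sum_abs)
    also have "\<dots> \<le> (\<Sum>i<d. ?T i k)"
      unfolding ip_diff_left abs_mult
    proof (rule sum_mono)
      fix i assume "i \<in> {..<d}"
      then have "\<bar>r i\<bar> = r i" "0 \<le> r i" using r0[of i] by auto
      then show "\<bar>r i\<bar> * \<bar>(cmod (ip d (y i) (x k)))\<^sup>2 - (cmod (ip d (u i) (x k)))\<^sup>2\<bar>
        \<le> r i * ((cmod (ip d (u i) (x k) - ip d (y i) (x k)))\<^sup>2 / (2 * c) + c * ((cmod (ip d (y i) (x k)))\<^sup>2 + (cmod (ip d (u i) (x k)))\<^sup>2))"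
        using square_diff_le[OF c] by (simp add: mult_left_mono)
    qed
    finally show ?thesis by simp
  qed
  then have "(\<Sum>k<d. \<bar>l k\<bar>) \<le> (\<Sum>k<d. (\<Sum>i<d. ?T i k)
      + e * Re (qf d \<sigma> (x k)))" by (intro sum_mono) auto
  also have "\<dots> = (\<Sum>i<d. \<Sum>k<d. ?T i k)
      + e * (\<Sum>k<d. Re (qf d \<sigma> (x k)))"
    unfolding sum.distrib[of "\<lambda>k. \<Sum>i<d. _ i k"] sum_distrib_left[of e] by (subst sum.swap) (rule refl)
  also have "(\<Sum>k<d. Re (qf d \<sigma> (x k))) = 1" by (simp add: trace_qf_real[OF sc ox] sp)
  also have "(\<Sum>i<d. \<Sum>k<d. ?T i k)
    = (\<Sum>i<d. r i * (f i / (2 * c) + c * (nsq (y i) + nsq (u i))))"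
  proof (intro sum.cong refl)
    fix i
    have n: "(\<Sum>k<d. (cmod (ip d z (x k)))\<^sup>2) = nsq z" for z
      unfolding nsq_def by (simp only: cmod_ip_commute[of d z] parseval[OF ox])
    show "(\<Sum>k<d. ?T i k)
      = r i * (f i / (2 * c) + c * (nsq (y i) + nsq (u i)))"
      unfolding sum_distrib_left[symmetric] sum.distrib sum_divide_distrib[symmetric] n f_def ..
  qed
  also have "\<dots> \<le> (\<Sum>i<d. r i * (f i / (2 * c) + c * 2))"
  proof (intro sum_mono mult_left_mono add_left_mono)
    fix i assume "i \<in> {..<d}"
    then show "nsq (y i) + nsq (u i) \<le> 2" "0 \<le> r i" using y1[of i] nu[of i] r0[of i] by auto
  qed (use c in auto)
  also have "(\<Sum>i<d. r i * (f i / (2 * c) + c * 2)) = e / (2 * c) + 2 * c"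
  proof -
    have "(\<Sum>i<d. r i * (f i / (2 * c) + c * 2)) = (\<Sum>i<d. r i * f i / (2 * c) + r i * (2 * c))"
      by (intro sum.cong refl) (simp add: algebra_simps)
    also have "\<dots> = e / (2 * c) + (\<Sum>i<d. r i) * (2 * c)"
      by (simp only: sum.distrib sum_divide_distrib[symmetric] sum_distrib_right[symmetric] e_def)
    finally show ?thesis by (simp add: r1)
  qed
  finally have "(\<Sum>k<d. \<bar>l k\<bar>) \<le> e / (2 * c) + 2 * c + e" by simp
  also have "e / (2 * c) \<le> \<epsilon> / 2"
    using ee eps by (simp add: c_def divide_le_eq power2_eq_square)
  also have "e \<le> \<epsilon> / 2"
  proof -
    have "\<epsilon>\<^sup>2 \<le> \<epsilon> * 1" unfolding power2_eq_square using eps by (intro mult_left_mono) auto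
    then show ?thesis using ee by simp
  qed
  finally have "(\<Sum>k<d. \<bar>l k\<bar>) \<le> 2 * \<epsilon>" by (simp add: c_def)
  then have "1 / 2 * trace_norm (w - \<rho>) \<le> \<epsilon>" by (simp add: trace_norm_spec[OF X])
  then show ?thesis using dw dom by blast
qed

section \<open>Exponential moments\<close>

text \<open>\<open>M\<close> is the trace of \<open>\<rho>^(1+t)\<close> and \<open>N\<close> that
  of \<open>\<rho> \<sigma>^(-t)\<close>. Because \<open>0 powr x = 0\<close>, the kernel of
  \<open>\<sigma>\<close> is invisible in \<open>N\<close>; the last conjunct excludes weight of
  \<open>\<rho>\<close> there.\<close>

definition moments :: "nat \<Rightarrow> real \<Rightarrow> complex mat \<Rightarrow> complex mat \<Rightarrow> real \<Rightarrow> real \<Rightarrow> bool" where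
  "moments d t \<rho> \<sigma> M N \<longleftrightarrow> (\<exists>u r v s. spec d \<rho> u r \<and> spec d \<sigma> v s \<and>
     (\<Sum>i<d. r i powr (1 + t)) = M \<and> (\<Sum>j<d. Re (qf d \<rho> (v j)) * s j powr (- t)) = N \<and>
     (\<forall>j<d. s j = 0 \<longrightarrow> Re (qf d \<rho> (v j)) = 0))"

text \<open>Both sums factor over product eigenbases; this is what makes the tail bounds for many
  copies exponential.\<close>

lemma moments_tens:
  assumes p: "pidx D f g d1 d2" and psd: "psd d1 \<rho>1" "psd d2 \<rho>2" "psd d1 \<sigma>1" "psd d2 \<sigma>2"
    and m: "moments d1 t \<rho>1 \<sigma>1 M1 N1" "moments d2 t \<rho>2 \<sigma>2 M2 N2"
  shows "moments D t (tens D f g \<rho>1 \<rho>2) (tens D f g \<sigma>1 \<sigma>2) (M1 * M2) (N1 * N2)"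
proof -
  obtain u1 r1 v1 s1 where 1: "spec d1 \<rho>1 u1 r1" "spec d1 \<sigma>1 v1 s1" "(\<Sum>i<d1. r1 i powr (1 + t)) = M1"
    "(\<Sum>j<d1. Re (qf d1 \<rho>1 (v1 j)) * s1 j powr (- t)) = N1" "\<And>j. j < d1 \<Longrightarrow> s1 j = 0 \<Longrightarrow> Re (qf d1 \<rho>1 (v1 j)) = 0"
    using m(1) unfolding moments_def by blast
  obtain u2 r2 v2 s2 where 2: "spec d2 \<rho>2 u2 r2" "spec d2 \<sigma>2 v2 s2" "(\<Sum>i<d2. r2 i powr (1 + t)) = M2"
    "(\<Sum>j<d2. Re (qf d2 \<rho>2 (v2 j)) * s2 j powr (- t)) = N2" "\<And>j. j < d2 \<Longrightarrow> s2 j = 0 \<Longrightarrow> Re (qf d2 \<rho>2 (v2 j)) = 0"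
    using m(2) unfolding moments_def by blast
  let ?v = "\<lambda>n k. v1 (f n) (f k) * v2 (g n) (g k)"
  have q: "Re (qf D (tens D f g \<rho>1 \<rho>2) (?v n)) = Re (qf d1 \<rho>1 (v1 (f n))) * Re (qf d2 \<rho>2 (v2 (g n)))" for n
    using psd(1,2) by (simp add: qf_tens[OF p] psd_iff)
  have "(\<Sum>n<D. (r1 (f n) * r2 (g n)) powr (1 + t)) = (\<Sum>i<d1. \<Sum>j<d2. (r1 i * r2 j) powr (1 + t))" by (rule sum_pidx[OF p])
  also have "\<dots> = M1 * M2"
    unfolding 1(3)[symmetric] 2(3)[symmetric] sum_product by (intro sum.cong refl powr_mult)
  finally have A: "(\<Sum>n<D. (r1 (f n) * r2 (g n)) powr (1 + t)) = M1 * M2" .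
  have "(\<Sum>n<D. Re (qf D (tens D f g \<rho>1 \<rho>2) (?v n)) * (s1 (f n) * s2 (g n)) powr (- t))
    = (\<Sum>i<d1. \<Sum>j<d2. (Re (qf d1 \<rho>1 (v1 i)) * Re (qf d2 \<rho>2 (v2 j))) * (s1 i * s2 j) powr (- t))"
    unfolding q by (rule sum_pidx[OF p])
  also have "\<dots> = N1 * N2"
    unfolding 1(4)[symmetric] 2(4)[symmetric] sum_product
  proof (intro sum.cong refl)
    fix i j assume "i \<in> {..<d1}" "j \<in> {..<d2}"
    have e: "(s1 i * s2 j) powr (- t) = s1 i powr (- t) * s2 j powr (- t)" by (rule powr_mult)
    show "Re (qf d1 \<rho>1 (v1 i)) * Re (qf d2 \<rho>2 (v2 j)) * (s1 i * s2 j) powr (- t)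
      = Re (qf d1 \<rho>1 (v1 i)) * s1 i powr (- t) * (Re (qf d2 \<rho>2 (v2 j)) * s2 j powr (- t))" unfolding e by (simp only: mult_ac)
  qed
  finally have B: "(\<Sum>n<D. Re (qf D (tens D f g \<rho>1 \<rho>2) (?v n)) * (s1 (f n) * s2 (g n)) powr (- t)) = N1 * N2" .
  have C: "\<forall>n<D. s1 (f n) * s2 (g n) = 0 \<longrightarrow> Re (qf D (tens D f g \<rho>1 \<rho>2) (?v n)) = 0"
    unfolding q using 1(5) 2(5) pidx_less[OF p] by auto
  show ?thesis
    unfolding moments_def
    by (rule exI[of _ "\<lambda>n k. u1 (f n) (f k) * u2 (g n) (g k)"], rule exI[of _ "\<lambda>n. r1 (f n) * r2 (g n)"], rule exI[of _ ?v], rule exI[of _ "\<lambda>n. s1 (f n) * s2 (g n)"],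
      intro conjI spec_tens[OF p 1(1) 2(1)] spec_tens[OF p 1(2) 2(2)] A B C)
qed

text \<open>Markov's inequality: above \<open>\<theta>\<close> one has
  \<open>1 \<le> (r / \<theta>)^t\<close>, and below \<open>\<kappa>\<close> one has
  \<open>1 \<le> (\<kappa> / s)^t\<close>, so the moments bound both discarded weights in
  \<open>smoothing\<close>.\<close>

lemma smoothing_moments:
  assumes r: "density d \<rho>" and s: "density d \<sigma>" and m: "moments d t \<rho> \<sigma> M N" and t: "0 < t"
    and th: "0 < \<theta>" "0 < \<kappa>" and eps: "0 < \<epsilon>" "\<epsilon> \<le> 1" and small: "M * \<theta> powr (- t) + N * \<kappa> powr t \<le> \<epsilon>\<^sup>2 / 2"
  shows "\<exists>\<omega>. density d \<omega> \<and> psd d (complex_of_real (\<theta> / \<kappa> + 1) \<cdot>\<^sub>m \<sigma> - \<omega>) \<and> 1 / 2 * trace_norm (\<omega> - \<rho>) \<le> \<epsilon>"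
proof -
  have rp: "psd d \<rho>" and sp: "psd d \<sigma>" using r s by (auto simp: density_def)
  obtain u r' v s' where 1: "spec d \<rho> u r'" "spec d \<sigma> v s'" "(\<Sum>i<d. r' i powr (1 + t)) = M"
    "(\<Sum>j<d. Re (qf d \<rho> (v j)) * s' j powr (- t)) = N" "\<And>j. j < d \<Longrightarrow> s' j = 0 \<Longrightarrow> Re (qf d \<rho> (v j)) = 0"
    using m unfolding moments_def by blast
  have "(\<Sum>i<d. of_bool (\<not> r' i \<le> \<theta>) * r' i) \<le> (\<Sum>i<d. r' i powr (1 + t) * \<theta> powr (- t))"
  proof (rule sum_mono)
    fix i assume "i \<in> {..<d}"
    show "of_bool (\<not> r' i \<le> \<theta>) * r' i \<le> r' i powr (1 + t) * \<theta> powr (- t)"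
    proof (cases "r' i \<le> \<theta>")
      case False
      then have pos: "r' i > 0" using th by simp
      have "1 \<le> (r' i / \<theta>) powr t" using False th t by (intro ge_one_powr_ge_zero) auto
      then have "r' i * 1 \<le> r' i * (r' i / \<theta>) powr t" using pos by (intro mult_left_mono) auto
      also have "\<dots> = r' i powr (1 + t) * \<theta> powr (- t)"
        using pos th by (simp add: powr_add powr_divide powr_minus field_simps)
      finally show ?thesis using False by simp
    qed simp
  qed
  also have "\<dots> = M * \<theta> powr (- t)" unfolding sum_distrib_right[symmetric] 1(3) ..
  finally have A: "(\<Sum>i<d. of_bool (\<not> r' i \<le> \<theta>) * r' i) \<le> M * \<theta> powr (- t)" .
  have "(\<Sum>j<d. of_bool (\<not> \<kappa> \<le> s' j) * Re (qf d \<rho> (v j))) \<le> (\<Sum>j<d. Re (qf d \<rho> (v j)) * s' j powr (- t) * \<kappa> powr t)"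
  proof (rule sum_mono)
    fix j assume "j \<in> {..<d}"
    then have j: "j < d" by simp
    have q: "0 \<le> Re (qf d \<rho> (v j))" by (rule psd_qf(2)[OF rp])
    show "of_bool (\<not> \<kappa> \<le> s' j) * Re (qf d \<rho> (v j)) \<le> Re (qf d \<rho> (v j)) * s' j powr (- t) * \<kappa> powr t"
    proof (cases "\<kappa> \<le> s' j \<or> s' j = 0")
      case True
      then show ?thesis using 1(5)[OF j] q by auto
    next
      case False
      then have pos: "s' j > 0" using psd_spec_nonneg[OF sp 1(2) j] by simp
      have "1 \<le> (\<kappa> / s' j) powr t" using False pos t by (intro ge_one_powr_ge_zero) auto
      then have "Re (qf d \<rho> (v j)) * 1 \<le> Re (qf d \<rho> (v j)) * (\<kappa> / s' j) powr t" using q by (intro mult_left_mono) auto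
      also have "\<dots> = Re (qf d \<rho> (v j)) * s' j powr (- t) * \<kappa> powr t"
        using pos th by (simp add: powr_divide powr_minus field_simps)
      finally show ?thesis using False by simp
    qed
  qed
  also have "\<dots> = N * \<kappa> powr t" unfolding sum_distrib_right[symmetric] 1(4) ..
  finally have B: "(\<Sum>j<d. of_bool (\<not> \<kappa> \<le> s' j) * Re (qf d \<rho> (v j))) \<le> N * \<kappa> powr t" .
  show ?thesis
    by (rule smoothing[OF r 1(1) s 1(2) th eps]) (use A B small in linarith)
qed

section \<open>Tensor powers\<close>

lemma mod_mult_div_mod: "(x mod (q * p)) div p = x div p mod q" "(x mod (q * p)) mod p = x mod p" for x p q :: nat
proof -
  have e: "x mod (q * p) = p * (x div p mod q) + x mod p"
    using mod_mult2_eq[of x p q] by (simp add: mult.commute)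
  show "(x mod (q * p)) mod p = x mod p" by (simp add: mod_mod_cancel)
  show "(x mod (q * p)) div p = x div p mod q" unfolding e by (cases "p = 0") auto
qed

text \<open>\<open>bi_power\<close> appends one copy at a time, whereas blocks of \<open>k\<close>
  copies are appended later. With mixed-radix indices associativity is an equality of matrices, not
  merely one up to a permutation of the basis.\<close>

lemma bi_tensor_assoc:
  "bi_tensor (a1 * a2) (b1 * b2) a3 b3 (bi_tensor a1 b1 a2 b2 X Y) Z
    = bi_tensor a1 b1 (a2 * a3) (b2 * b3) X (bi_tensor a2 b2 a3 b3 Y Z)"
proof (rule eq_matI)
  let ?L = "bi_tensor (a1 * a2) (b1 * b2) a3 b3 (bi_tensor a1 b1 a2 b2 X Y) Z"
  let ?R = "bi_tensor a1 b1 (a2 * a3) (b2 * b3) X (bi_tensor a2 b2 a3 b3 Y Z)"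
  have idx: "bi_idx1 b1 a2 b2 (bi_idx1 (b1 * b2) a3 b3 k) = bi_idx1 b1 (a2 * a3) (b2 * b3) k"
    "bi_idx2 b1 a2 b2 (bi_idx1 (b1 * b2) a3 b3 k) = bi_idx1 b2 a3 b3 (bi_idx2 b1 (a2 * a3) (b2 * b3) k)"
    "bi_idx2 (b1 * b2) a3 b3 k = bi_idx2 b2 a3 b3 (bi_idx2 b1 (a2 * a3) (b2 * b3) k)"
    if "k < ((a1 * a2) * a3) * ((b1 * b2) * b3)" for k
  proof -
    have k': "k < (a1 * (a2 * a3)) * (b1 * (b2 * b3))" using that by (simp only: mult.assoc)
    note l = bi_idx_digits[OF that] and r = bi_idx_digits[OF k']
    define I where "I = k div (b1 * (b2 * b3))"
    define J where "J = k mod (b1 * (b2 * b3))"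
    note IJ = I_def[symmetric] J_def[symmetric]
    have dd: "x div (q * p) = x div p div q" for x p q :: nat by (metis div_mult2_eq mult.commute)
    show "bi_idx1 b1 a2 b2 (bi_idx1 (b1 * b2) a3 b3 k) = bi_idx1 b1 (a2 * a3) (b2 * b3) k"
      unfolding bi_idx1_def[of b1 a2 b2] l bi_idx1_def[of b1 "a2 * a3"] by (simp only: dd[of _ a2 a3] dd[of _ b2 b3] mult.assoc)
    show "bi_idx2 b1 a2 b2 (bi_idx1 (b1 * b2) a3 b3 k) = bi_idx1 b2 a3 b3 (bi_idx2 b1 (a2 * a3) (b2 * b3) k)"
      unfolding bi_idx2_def[of b1 a2 b2] l bi_idx1_def[of b2 a3 b3] r unfolding mult.assoc IJ by (simp only: mod_mult_div_mod)
    show "bi_idx2 (b1 * b2) a3 b3 k = bi_idx2 b2 a3 b3 (bi_idx2 b1 (a2 * a3) (b2 * b3) k)"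
      unfolding bi_idx2_def[of b2 a3 b3] r unfolding bi_idx2_def mult.assoc IJ by (simp only: mod_mult_div_mod)
  qed
  fix k n assume "k < dim_row ?R" "n < dim_col ?R"
  then have kn: "k < ((a1 * a2) * a3) * ((b1 * b2) * b3)" "n < ((a1 * a2) * a3) * ((b1 * b2) * b3)"
    by (simp_all add: bi_tensor_def mult.assoc)
  then have kn': "k < (a1 * (a2 * a3)) * (b1 * (b2 * b3))" "n < (a1 * (a2 * a3)) * (b1 * (b2 * b3))"
    by (simp_all only: mult.assoc)
  note less = pidx_less(1)[OF pidx_bi kn(1)] pidx_less(1)[OF pidx_bi kn(2)] pidx_less(2)[OF pidx_bi kn'(1)] pidx_less(2)[OF pidx_bi kn'(2)]
  have "?L $$ (k, n) = X $$ (bi_idx1 b1 a2 b2 (bi_idx1 (b1 * b2) a3 b3 k), bi_idx1 b1 a2 b2 (bi_idx1 (b1 * b2) a3 b3 n)) *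
      Y $$ (bi_idx2 b1 a2 b2 (bi_idx1 (b1 * b2) a3 b3 k), bi_idx2 b1 a2 b2 (bi_idx1 (b1 * b2) a3 b3 n)) *
      Z $$ (bi_idx2 (b1 * b2) a3 b3 k, bi_idx2 (b1 * b2) a3 b3 n)"
    using kn less(1,2) by (simp add: bi_tensor_def)
  also have "\<dots> = X $$ (bi_idx1 b1 (a2 * a3) (b2 * b3) k, bi_idx1 b1 (a2 * a3) (b2 * b3) n) *
      (Y $$ (bi_idx1 b2 a3 b3 (bi_idx2 b1 (a2 * a3) (b2 * b3) k), bi_idx1 b2 a3 b3 (bi_idx2 b1 (a2 * a3) (b2 * b3) n)) *
       Z $$ (bi_idx2 b2 a3 b3 (bi_idx2 b1 (a2 * a3) (b2 * b3) k), bi_idx2 b2 a3 b3 (bi_idx2 b1 (a2 * a3) (b2 * b3) n)))"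
    unfolding idx[OF kn(1)] idx[OF kn(2)] by (simp only: mult.assoc)
  also have "\<dots> = ?R $$ (k, n)"
    using kn' less(3,4) by (simp add: bi_tensor_def)
  finally show "?L $$ (k, n) = ?R $$ (k, n)" .
qed (simp_all add: bi_tensor_def mult.assoc)

lemma bi_tensor_unit:
  assumes "X \<in> carrier_mat (a * b) (a * b)" shows "bi_tensor a b 1 1 X (1\<^sub>m 1) = X"
proof (rule eq_matI)
  fix i j assume "i < dim_row X" "j < dim_col X"
  then have ij: "i < a * b" "j < a * b" using assms by auto
  have "bi_idx1 b 1 1 k = k" "bi_idx2 b 1 1 k = 0" for k by (simp_all add: bi_idx1_def bi_idx2_def)
  then show "bi_tensor a b 1 1 X (1\<^sub>m 1) $$ (i, j) = X $$ (i, j)" using ij by (simp add: bi_tensor_def)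
qed (use assms in \<open>auto simp: bi_tensor_def\<close>)

lemma bi_power_carrier: "bi_power a b n \<rho> \<in> carrier_mat (a ^ n * b ^ n) (a ^ n * b ^ n)"
  by (cases n) (simp_all add: bi_tensor_def mult_ac)

lemma bi_power_add:
  "bi_power a b (n + m) \<rho> = bi_tensor (a ^ n) (b ^ n) (a ^ m) (b ^ m) (bi_power a b n \<rho>) (bi_power a b m \<rho>)"
proof (induction m)
  case 0
  show ?case using bi_tensor_unit[OF bi_power_carrier] by simp
next
  case (Suc m)
  have "bi_power a b (n + Suc m) \<rho> = bi_tensor (a ^ n * a ^ m) (b ^ n * b ^ m) a b (bi_tensor (a ^ n) (b ^ n) (a ^ m) (b ^ m) (bi_power a b n \<rho>) (bi_power a b m \<rho>)) \<rho>"
    using Suc.IH by (simp add: power_add)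
  then show ?case unfolding bi_tensor_assoc by (simp add: mult.commute)
qed

section \<open>Asymptotic equipartition\<close>

text \<open>At \<open>t = 0\<close> the sum is 1, and its derivative there is the mean of
  \<open>x\<close> minus the threshold, that is \<open>- \<eta>\<close>; so it drops below 1 for
  small positive \<open>t\<close>.\<close>

lemma exp_moment_decreasing:
  fixes p x :: "nat \<Rightarrow> real"
  assumes "(\<Sum>i<d. p i) = 1" "0 < \<eta>"
  shows "\<exists>t0>0. \<forall>t. 0 < t \<longrightarrow> t < t0 \<longrightarrow> (\<Sum>i<d. p i * exp (t * (x i - (\<Sum>i<d. p i * x i) - \<eta>))) < 1"
proof -
  define C where "C = (\<Sum>i<d. p i * x i)"
  define f where "f t = (\<Sum>i<d. p i * exp (t * (x i - C - \<eta>)))" for t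
  have "(f has_real_derivative (\<Sum>i<d. p i * (exp (0 * (x i - C - \<eta>)) * (x i - C - \<eta>)))) (at 0)"
    unfolding f_def by (auto intro!: derivative_eq_intros simp: mult.commute)
  also have "(\<Sum>i<d. p i * (exp (0 * (x i - C - \<eta>)) * (x i - C - \<eta>))) = - \<eta>"
  proof -
    have "(\<Sum>i<d. p i * (exp (0 * (x i - C - \<eta>)) * (x i - C - \<eta>))) = (\<Sum>i<d. p i * x i - p i * (C + \<eta>))"
      by (intro sum.cong refl) (simp add: algebra_simps)
    also have "\<dots> = C - (C + \<eta>)"
      unfolding sum_subtractf sum_distrib_right[symmetric] assms(1) C_def by simp
    finally show ?thesis by simp
  qed
  finally obtain t0 where "t0 > 0" "\<And>t. 0 < t \<Longrightarrow> t < t0 \<Longrightarrow> f (0 + t) < f 0"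
    using DERIV_neg_dec_right[of f "- \<eta>" 0] assms(2) by auto
  moreover have "f 0 = 1" by (simp add: f_def assms(1))
  ultimately show ?thesis unfolding f_def C_def by auto
qed

text \<open>Serves the copies left over after division into blocks. Only finiteness of the two
  numbers matters, since they stay fixed while the number of blocks grows.\<close>

lemma max_mixed_moments:
  assumes "density d \<rho>"
  shows "\<exists>M N. moments d t \<rho> (complex_of_real (1 / real d) \<cdot>\<^sub>m 1\<^sub>m d) M N"
proof -
  have rp: "psd d \<rho>" using assms by (simp add: density_def)
  obtain u r where u: "spec d \<rho> u r" using psd_obtain_spec[OF rp] by blast
  have "spec d (complex_of_real (1 / real d) \<cdot>\<^sub>m 1\<^sub>m d) u (\<lambda>_. 1 / real d)"
    using spec_onb[OF u] by (auto simp: spec_def onb_def mult.assoc sum_distrib_left[symmetric] sum_divide_distrib[symmetric] of_bool_def)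
  then have "moments d t \<rho> (complex_of_real (1 / real d) \<cdot>\<^sub>m 1\<^sub>m d) (\<Sum>i<d. r i powr (1 + t)) (\<Sum>j<d. Re (qf d \<rho> (u j)) * (1 / real d) powr (- t))"
    unfolding moments_def using u
    by (intro exI[of _ u] exI[of _ r] exI[of _ "\<lambda>_. 1 / real d"] conjI) auto
  then show ?thesis by blast
qed

lemma density_dim_pos: "density d \<rho> \<Longrightarrow> d > 0"
  by (rule ccontr) (auto simp: density_def psd_def mat_trace_def)

text \<open>The separable state is a product of \<open>q\<close> copies of \<open>\<sigma>\<close>
  and a base state on the \<open>n\<close> remaining copies, so the moments are geometric in
  \<open>q\<close>.\<close>

lemma block_moments:
  assumes r: "density (a * b) \<rho>" and s: "\<sigma> \<in> sep (a ^ k) (b ^ k)"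
    and base: "\<tau> \<in> sep (a ^ n) (b ^ n)" "moments (a ^ n * b ^ n) t (bi_power a b n \<rho>) \<tau> M0 N0"
    and m: "moments (a ^ k * b ^ k) t (bi_power a b k \<rho>) \<sigma> M N"
  shows "\<exists>\<sigma>'\<in>sep (a ^ (n + q * k)) (b ^ (n + q * k)).
    moments (a ^ (n + q * k) * b ^ (n + q * k)) t (bi_power a b (n + q * k) \<rho>) \<sigma>' (M0 * M ^ q) (N0 * N ^ q)"
proof (induction q)
  case 0
  show ?case using base by auto
next
  case (Suc q)
  let ?n = "n + q * k"
  obtain \<sigma>' where s': "\<sigma>' \<in> sep (a ^ ?n) (b ^ ?n)"
    "moments (a ^ ?n * b ^ ?n) t (bi_power a b ?n \<rho>) \<sigma>' (M0 * M ^ q) (N0 * N ^ q)" using Suc by blast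
  have e: "n + Suc q * k = ?n + k" by simp
  let ?s = "bi_tensor (a ^ ?n) (b ^ ?n) (a ^ k) (b ^ k) \<sigma>' \<sigma>"
  have p: "psd (a ^ j * b ^ j) (bi_power a b j \<rho>)" for j using density_bi_power[OF r] by (simp add: density_def)
  have ps: "psd (a ^ ?n * b ^ ?n) \<sigma>'" "psd (a ^ k * b ^ k) \<sigma>"
    using sep_scone(2)[OF s'(1)] sep_scone(2)[OF s] by (auto simp: density_def)
  have "moments ((a ^ ?n * a ^ k) * (b ^ ?n * b ^ k)) t (bi_power a b (?n + k) \<rho>) ?s (M0 * M ^ q * M) (N0 * N ^ q * N)"
    unfolding bi_power_add[of a b ?n k] bi_tensor_tens by (rule moments_tens[OF pidx_bi p p ps s'(2) m])
  moreover have "?s \<in> sep (a ^ ?n * a ^ k) (b ^ ?n * b ^ k)" by (rule sep_bi_tensor[OF s'(1) s])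
  ultimately show ?case unfolding e power_add[of a ?n k] power_add[of b ?n k]
    by (intro bexI[of _ ?s]) (simp_all add: mult_ac)
qed

text \<open>In other terms, the smoothed max-relative entropy to the separable states is at most the
  logarithm of \<open>L\<close>.\<close>

definition sep_approx :: "nat \<Rightarrow> nat \<Rightarrow> complex mat \<Rightarrow> real \<Rightarrow> real \<Rightarrow> bool" where
  "sep_approx a b \<rho> L \<epsilon> \<longleftrightarrow> (\<exists>\<sigma>\<in>sep a b. \<exists>\<omega>. density (a * b) \<omega> \<and>
     psd (a * b) (complex_of_real L \<cdot>\<^sub>m \<sigma> - \<omega>) \<and> 1 / 2 * trace_norm (\<omega> - \<rho>) \<le> \<epsilon>)"

text \<open>With the thresholds \<open>th ^ q\<close> and \<open>ka ^ q\<close>, set slightly beyond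
  the typical eigenvalues, the discarded weights decay geometrically in \<open>q\<close> and fall
  below any fixed \<open>\<epsilon>^2 / 2\<close>. All remainders \<open>n < k\<close> are treated
  together, as every number of copies has the form \<open>n + q * k\<close>.\<close>

lemma achieve_blocks:
  assumes r: "density (a * b) \<rho>" and s: "\<sigma> \<in> sep (a ^ k) (b ^ k)"
    and c: "rel_entropy (bi_power a b k \<rho>) \<sigma> = ereal c" and \<eta>: "0 < \<eta>" and eps: "0 < \<epsilon>" "\<epsilon> \<le> 1"
  shows "0 \<le> c"
    "\<forall>\<^sub>F q in sequentially. \<forall>n<k. sep_approx (a ^ (n + q * k)) (b ^ (n + q * k)) (bi_power a b (n + q * k) \<rho>) (exp (real q * (c * ln 2 + 2 * \<eta>)) + 1) \<epsilon>"
proof -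
  let ?D = "a ^ k * b ^ k"
  let ?R = "bi_power a b k \<rho>"
  have dR: "density ?D ?R" by (rule density_bi_power[OF r])
  have ds: "density ?D \<sigma>" by (rule sep_scone(2)[OF s])
  have Rp: "psd ?D ?R" "mat_trace ?R = 1" and sp: "psd ?D \<sigma>" "mat_trace \<sigma> = 1" using dR ds by (auto simp: density_def)
  note Rc = psd_carrier[OF Rp(1)]
  obtain u l where u: "spec ?D ?R u l" "\<And>i. i < ?D \<Longrightarrow> 0 \<le> l i" using psd_obtain_spec[OF Rp(1)] by blast
  obtain v m where v: "spec ?D \<sigma> v m" "\<And>i. i < ?D \<Longrightarrow> 0 \<le> m i" using psd_obtain_spec[OF sp(1)] by blast
  define Q where "Q j = Re (qf ?D ?R (v j))" for j
  have sub: "supp ?R \<subseteq> supp \<sigma>" using c unfolding rel_entropy_def by (auto split: if_splits)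
  have ker: "Q j = 0" if "j < ?D" "m j = 0" for j
    unfolding Q_def using supp_kernel[OF Rc v(1) sub that] by simp
  have Q0: "0 \<le> Q j" for j unfolding Q_def by (rule psd_qf(2)[OF Rp(1)])
  have Q1: "(\<Sum>j<?D. Q j) = 1" unfolding Q_def trace_qf_real[OF Rc spec_onb[OF v(1)]] Rp(2) by simp
  have l1: "(\<Sum>i<?D. l i) = 1" using Rp(2) trace_spec[OF u(1)] by (metis of_real_eq_1_iff)
  define h where "h = ent ?D l"
  define x where "x = cross ?D ?R v m"
  have "rel_entropy ?R \<sigma> = ereal ((h - x) / ln 2)"
    unfolding h_def x_def by (rule rel_entropy_spec[OF Rp(1) u(1) sp(1) v(1) sub])
  then have hx: "h - x = c * ln 2" using c by simp
  have "x \<le> h + Re (mat_trace \<sigma>) - Re (mat_trace ?R)"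
    unfolding x_def h_def by (rule cross_le_ent[OF Rp(1) u(1) sp(1) v(1)]) (use ker in \<open>simp add: Q_def\<close>)
  then have "0 \<le> c * ln 2" using hx Rp(2) sp(2) by simp
  then show "0 \<le> c" by (simp add: zero_le_mult_iff)
  obtain t1 where t1: "t1 > 0" "\<And>t. 0 < t \<Longrightarrow> t < t1 \<Longrightarrow> (\<Sum>i<?D. l i * exp (t * (ln (l i) - (\<Sum>i<?D. l i * ln (l i)) - \<eta>))) < 1"
    using exp_moment_decreasing[OF l1 \<eta>, of "\<lambda>i. ln (l i)"] by blast
  obtain t2 where t2: "t2 > 0" "\<And>t. 0 < t \<Longrightarrow> t < t2 \<Longrightarrow> (\<Sum>j<?D. Q j * exp (t * (- ln (m j) - (\<Sum>j<?D. Q j * - ln (m j)) - \<eta>))) < 1"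
    using exp_moment_decreasing[OF Q1 \<eta>, of "\<lambda>j. - ln (m j)"] by blast
  \<comment> \<open>One exponent has to work for both tails.\<close>
  define t where "t = min t1 t2 / 2"
  have t: "0 < t" "t < t1" "t < t2" using t1(1) t2(1) by (auto simp: t_def)
  \<comment> \<open>\<open>h\<close> is \<open>Tr R ln R\<close> and \<open>x\<close> is
    \<open>Tr R ln \<sigma>\<close>, hence \<open>th / ka = exp (c * ln 2 + 2 * \<eta>)\<close>: the
    relative entropy in natural units, loosened by \<open>\<eta>\<close> on either side.\<close>
  define th where "th = exp (h + \<eta>)"
  define ka where "ka = exp (x - \<eta>)"
  define M where "M = (\<Sum>i<?D. l i powr (1 + t))"
  define N where "N = (\<Sum>j<?D. Q j * m j powr (- t))"
  have mom: "moments ?D t ?R \<sigma> M N"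
    unfolding moments_def M_def N_def using u(1) v(1) ker
    by (intro exI[of _ u] exI[of _ l] exI[of _ v] exI[of _ m] conjI) (auto simp: Q_def)
  have M0: "0 \<le> M" unfolding M_def by (intro sum_nonneg) auto
  have N0: "0 \<le> N" unfolding N_def using Q0 by (intro sum_nonneg) auto
  have Mth: "M * th powr (- t) < 1"
  proof -
    have "M * th powr (- t) = (\<Sum>i<?D. l i * exp (t * (ln (l i) - h - \<eta>)))"
      unfolding M_def sum_distrib_right
    proof (intro sum.cong refl)
      fix i assume "i \<in> {..<?D}"
      then have "0 \<le> l i" using u(2) by simp
      then show "l i powr (1 + t) * th powr - t = l i * exp (t * (ln (l i) - h - \<eta>))"
      proof (cases "l i = 0")
        case False
        then have "l i > 0" using \<open>0 \<le> l i\<close> by simp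
        then have "l i powr (1 + t) = l i * exp (t * ln (l i))" by (simp add: powr_def exp_add distrib_right)
        moreover have "th powr - t = exp (- t * (h + \<eta>))" by (simp add: th_def powr_def)
        moreover have "exp (t * ln (l i)) * exp (- t * (h + \<eta>)) = exp (t * (ln (l i) - h - \<eta>))"
          unfolding exp_add[symmetric] by (simp add: algebra_simps)
        ultimately show ?thesis by (simp only: mult.assoc)
      qed simp
    qed
    then show ?thesis using t1(2)[OF t(1,2)] by (simp add: h_def ent_def)
  qed
  have Nka: "N * ka powr t < 1"
  proof -
    have "N * ka powr t = (\<Sum>j<?D. Q j * exp (t * (- ln (m j) - (- x) - \<eta>)))"
      unfolding N_def sum_distrib_right
    proof (intro sum.cong refl)
      fix j assume j: "j \<in> {..<?D}"
      show "Q j * m j powr - t * ka powr t = Q j * exp (t * (- ln (m j) - (- x) - \<eta>))"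
      proof (cases "m j = 0")
        case True
        then show ?thesis using ker j by simp
      next
        case False
        then have "m j powr - t = exp (- t * ln (m j))" by (simp add: powr_def)
        moreover have "ka powr t = exp (t * (x - \<eta>))" by (simp add: ka_def powr_def)
        moreover have "exp (- t * ln (m j)) * exp (t * (x - \<eta>)) = exp (t * (- ln (m j) - (- x) - \<eta>))"
          unfolding exp_add[symmetric] by (simp add: algebra_simps)
        ultimately show ?thesis by (simp only: mult.assoc)
      qed
    qed
    moreover have "(\<Sum>j<?D. Q j * - ln (m j)) = - x" by (simp add: x_def cross_def Q_def sum_negf)
    ultimately show ?thesis using t2(2)[OF t(1,3)] by simp
  qed
  have step: "\<forall>\<^sub>F q in sequentially. sep_approx (a ^ (n + q * k)) (b ^ (n + q * k)) (bi_power a b (n + q * k) \<rho>) (exp (real q * (c * ln 2 + 2 * \<eta>)) + 1) \<epsilon>" for n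
  proof -
    have dn: "density (a ^ n * b ^ n) (bi_power a b n \<rho>)" by (rule density_bi_power[OF r])
    obtain Mn Nn where mn: "moments (a ^ n * b ^ n) t (bi_power a b n \<rho>) (complex_of_real (1 / real (a ^ n * b ^ n)) \<cdot>\<^sub>m 1\<^sub>m (a ^ n * b ^ n)) Mn Nn"
      using max_mixed_moments[OF dn] by blast
    have base: "complex_of_real (1 / real (a ^ n * b ^ n)) \<cdot>\<^sub>m 1\<^sub>m (a ^ n * b ^ n) \<in> sep (a ^ n) (b ^ n)"
      by (rule sep_max_mixed) (rule density_dim_pos[OF dn])
    have "(\<lambda>q. Mn * (M * th powr (- t)) ^ q + Nn * (N * ka powr t) ^ q) \<longlonglongrightarrow> Mn * 0 + Nn * 0"
      using Mth Nka M0 N0 by (intro tendsto_add tendsto_mult tendsto_const LIMSEQ_power_zero) auto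
    moreover have "\<epsilon>\<^sup>2 / 2 > Mn * 0 + Nn * 0" using eps by simp
    ultimately have "\<forall>\<^sub>F q in sequentially. Mn * (M * th powr (- t)) ^ q + Nn * (N * ka powr t) ^ q < \<epsilon>\<^sup>2 / 2"
      by (rule order_tendstoD(2))
    then show ?thesis
    proof (rule eventually_mono)
      fix q assume small: "Mn * (M * th powr (- t)) ^ q + Nn * (N * ka powr t) ^ q < \<epsilon>\<^sup>2 / 2"
      let ?n = "n + q * k"
      obtain \<sigma>' where s': "\<sigma>' \<in> sep (a ^ ?n) (b ^ ?n)"
        "moments (a ^ ?n * b ^ ?n) t (bi_power a b ?n \<rho>) \<sigma>' (Mn * M ^ q) (Nn * N ^ q)"
        using block_moments[OF r s base mn mom] by blast
      have thq: "(th ^ q) powr (- t) = (th powr (- t)) ^ q" and kaq: "(ka ^ q) powr t = (ka powr t) ^ q"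
        unfolding th_def ka_def by (simp_all add: powr_def exp_of_nat_mult[symmetric] mult_ac)
      have "Mn * M ^ q * (th ^ q) powr (- t) + Nn * N ^ q * (ka ^ q) powr t \<le> \<epsilon>\<^sup>2 / 2"
        using small unfolding thq kaq by (simp add: power_mult_distrib mult.assoc)
      then have "\<exists>\<omega>. density (a ^ ?n * b ^ ?n) \<omega> \<and>
          psd (a ^ ?n * b ^ ?n) (complex_of_real (th ^ q / ka ^ q + 1) \<cdot>\<^sub>m \<sigma>' - \<omega>) \<and>
          1 / 2 * trace_norm (\<omega> - bi_power a b ?n \<rho>) \<le> \<epsilon>"
        by (intro smoothing_moments[OF density_bi_power[OF r] sep_scone(2)[OF s'(1)] s'(2) t(1) _ _ eps])
          (auto simp: th_def ka_def)
      moreover have "th ^ q / ka ^ q = exp (real q * (c * ln 2 + 2 * \<eta>))"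
      proof -
        have "th ^ q / ka ^ q = (th / ka) ^ q" by (simp add: power_divide)
        also have "th / ka = exp (c * ln 2 + 2 * \<eta>)" unfolding th_def ka_def hx[symmetric] by (simp add: exp_diff[symmetric])
        finally show ?thesis by (simp add: exp_of_nat_mult)
      qed
      ultimately show "sep_approx (a ^ ?n) (b ^ ?n) (bi_power a b ?n \<rho>) (exp (real q * (c * ln 2 + 2 * \<eta>)) + 1) \<epsilon>"
        unfolding sep_approx_def using s'(1) by auto
    qed
  qed
  have "\<forall>\<^sub>F q in sequentially. \<forall>n\<in>{..<k}. sep_approx (a ^ (n + q * k)) (b ^ (n + q * k)) (bi_power a b (n + q * k) \<rho>) (exp (real q * (c * ln 2 + 2 * \<eta>)) + 1) \<epsilon>"
    using step by (intro eventually_ball_finite) auto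
  then show "\<forall>\<^sub>F q in sequentially. \<forall>n<k. sep_approx (a ^ (n + q * k)) (b ^ (n + q * k)) (bi_power a b (n + q * k) \<rho>) (exp (real q * (c * ln 2 + 2 * \<eta>)) + 1) \<epsilon>"
    by (rule eventually_mono) auto
qed

section \<open>Entanglement cost\<close>

definition best_error :: "op_class \<Rightarrow> nat \<Rightarrow> nat \<Rightarrow> nat \<Rightarrow> complex mat \<Rightarrow> ereal" where
  "best_error F m a b \<rho> = (INF \<Lambda>\<in>F (2 ^ m) (2 ^ m) a b. ereal (1 / 2 * trace_norm (\<Lambda> (phiK (2 ^ m)) - \<rho>)))"

lemma one_shot_cost_best_error:
  "one_shot_cost F \<epsilon> a b \<rho> = Inf {ereal (real m) | m. best_error F m a b \<rho> \<le> ereal \<epsilon>}"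
  by (simp add: one_shot_cost_def best_error_def bi_power_phi2)

lemma one_shot_cost_le:
  assumes "\<Lambda> \<in> F (2 ^ m) (2 ^ m) a b" "1 / 2 * trace_norm (\<Lambda> (phiK (2 ^ m)) - \<rho>) \<le> \<epsilon>"
  shows "one_shot_cost F \<epsilon> a b \<rho> \<le> ereal (real m)"
proof -
  have "best_error F m a b \<rho> \<le> ereal \<epsilon>"
    unfolding best_error_def using assms(2) by (intro INF_lower2[OF assms(1)]) simp
  then show ?thesis unfolding one_shot_cost_best_error by (intro Inf_lower) blast
qed

text \<open>A nonempty set of naturals has a least element, so a finite cost is attained; the
  infimum over operations inside \<open>best_error\<close> is left as it stands.\<close>

lemma one_shot_cost_cases:
  assumes "one_shot_cost F \<epsilon> a b \<rho> \<noteq> \<infinity>"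
  obtains m where "one_shot_cost F \<epsilon> a b \<rho> = ereal (real m)" "best_error F m a b \<rho> \<le> ereal \<epsilon>"
proof -
  let ?P = "\<lambda>m. best_error F m a b \<rho> \<le> ereal \<epsilon>"
  have "\<exists>m. ?P m"
  proof (rule ccontr)
    assume "\<nexists>m. ?P m"
    then have "{ereal (real m) | m. ?P m} = {}" by auto
    then show False using assms unfolding one_shot_cost_best_error by (simp add: top_ereal_def)
  qed
  then have P: "?P (LEAST m. ?P m)" by (rule LeastI_ex)
  have "Inf {ereal (real m) | m. ?P m} = ereal (real (LEAST m. ?P m))"
  proof (rule antisym)
    show "Inf {ereal (real m) | m. ?P m} \<le> ereal (real (LEAST m. ?P m))" using P by (intro Inf_lower) blast
    show "ereal (real (LEAST m. ?P m)) \<le> Inf {ereal (real m) | m. ?P m}"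
      by (intro Inf_greatest) (auto intro: Least_le)
  qed
  then show ?thesis using that P unfolding one_shot_cost_best_error by blast
qed

lemma one_shot_cost_antimono:
  assumes "\<epsilon> \<le> \<epsilon>'" shows "one_shot_cost F \<epsilon>' a b \<rho> \<le> one_shot_cost F \<epsilon> a b \<rho>"
proof -
  have "x \<le> ereal \<epsilon>'" if "x \<le> ereal \<epsilon>" for x
    by (rule order_trans[OF that]) (use assms in simp)
  then show ?thesis unfolding one_shot_cost_best_error by (intro Inf_superset_mono) blast
qed

lemma one_shot_cost_NE_le_DNE: "one_shot_cost (NE \<delta>) \<epsilon> a b \<rho> \<le> one_shot_cost (DNE \<delta>) \<epsilon> a b \<rho>"
proof -
  have "best_error (NE \<delta>) m a b \<rho> \<le> best_error (DNE \<delta>) m a b \<rho>" for m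
    unfolding best_error_def by (rule INF_superset_mono) (auto simp: DNE_def)
  then have "best_error (NE \<delta>) m a b \<rho> \<le> x" if "best_error (DNE \<delta>) m a b \<rho> \<le> x" for m x
    using that by (rule order_trans)
  then show ?thesis unfolding one_shot_cost_best_error by (intro Inf_superset_mono) blast
qed

text \<open>The map from \<open>NE_to_DNE\<close> reproduces the output exactly, so two more ebits
  buy dual non-entanglement at the same error and the same \<open>\<delta>\<close>.\<close>

lemma one_shot_cost_DNE_le_NE: "one_shot_cost (DNE \<delta>) \<epsilon> a b \<rho> \<le> one_shot_cost (NE \<delta>) \<epsilon> a b \<rho> + ereal 2"
proof (cases "one_shot_cost (NE \<delta>) \<epsilon> a b \<rho> = \<infinity>")
  case False
  then obtain m where m: "one_shot_cost (NE \<delta>) \<epsilon> a b \<rho> = ereal (real m)" "best_error (NE \<delta>) m a b \<rho> \<le> ereal \<epsilon>"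
    by (rule one_shot_cost_cases)
  have p: "(2::nat) ^ (m + 2) = 4 * 2 ^ m" by (simp add: power_add)
  have "best_error (DNE \<delta>) (m + 2) a b \<rho> \<le> best_error (NE \<delta>) m a b \<rho>"
    unfolding best_error_def[of "NE \<delta>"]
  proof (rule INF_greatest)
    fix \<Lambda> assume "\<Lambda> \<in> NE \<delta> (2 ^ m) (2 ^ m) a b"
    then obtain \<Lambda>' where L: "\<Lambda>' \<in> DNE \<delta> (2 ^ (m + 2)) (2 ^ (m + 2)) a b" "\<Lambda>' (phiK (2 ^ (m + 2))) = \<Lambda> (phiK (2 ^ m))"
      using NE_to_DNE[of \<Lambda> \<delta> "2 ^ m" a b] unfolding p by auto
    show "best_error (DNE \<delta>) (m + 2) a b \<rho> \<le> ereal (1 / 2 * trace_norm (\<Lambda> (phiK (2 ^ m)) - \<rho>))"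
      unfolding best_error_def using L(2) by (intro INF_lower2[OF L(1)]) (simp only: order_refl)
  qed
  also note m(2)
  finally have "one_shot_cost (DNE \<delta>) \<epsilon> a b \<rho> \<le> ereal (real (m + 2))"
    unfolding one_shot_cost_best_error by (intro Inf_lower) blast
  then show ?thesis unfolding m(1) by (simp add: add.commute)
qed simp

section \<open>Passage to asymptotic rates\<close>

lemma limsup_le_vanishing:
  fixes x y :: "nat \<Rightarrow> ereal" and z :: "nat \<Rightarrow> real"
  assumes "\<forall>\<^sub>F n in sequentially. x n \<le> y n + ereal (z n)" "z \<longlonglongrightarrow> l"
  shows "limsup x \<le> limsup y + ereal l"
proof (rule ereal_le_epsilon2)
  fix e :: real assume "0 < e"
  then have "\<forall>\<^sub>F n in sequentially. z n < l + e" using assms(2) by (intro order_tendstoD) auto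
  then have "\<forall>\<^sub>F n in sequentially. x n \<le> y n + ereal (l + e)"
    using assms(1)
  proof eventually_elim
    case (elim n)
    have "y n + ereal (z n) \<le> y n + ereal (l + e)" using elim(1) by (intro add_left_mono) simp
    then show ?case using elim(2) by (rule order_trans[rotated])
  qed
  then have "limsup x \<le> limsup (\<lambda>n. y n + ereal (l + e))" by (rule Limsup_mono)
  also have "\<dots> = limsup y + ereal (l + e)" by (rule Limsup_add_ereal_right) auto
  finally show "limsup x \<le> limsup y + ereal l + ereal e" by (simp add: add.assoc)
qed

lemma ereal_add_divide: "0 < n \<Longrightarrow> (x + ereal w) / ereal n = x / ereal n + ereal (w / n)"
  by (cases x) (auto simp: add_divide_distrib)

definition cost_rate :: "(real \<Rightarrow> op_class) \<Rightarrow> (nat \<Rightarrow> real) \<Rightarrow> nat \<Rightarrow> nat \<Rightarrow> complex mat \<Rightarrow> real \<Rightarrow> ereal" where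
  "cost_rate F \<delta> a b \<rho> \<epsilon> =
     limsup (\<lambda>n. one_shot_cost (F (\<delta> n)) \<epsilon> (a ^ n) (b ^ n) (bi_power a b n \<rho>) / ereal (real n))"

text \<open>The rate is antitone in \<open>\<epsilon>\<close>, so its limit from the right at 0 is a
  supremum. Later arguments can then work with order alone.\<close>

lemma ent_cost_seq_SUP: "ent_cost_seq F \<delta> a b \<rho> = (SUP \<epsilon>\<in>{0<..}. cost_rate F \<delta> a b \<rho> \<epsilon>)"
proof -
  let ?g = "cost_rate F \<delta> a b \<rho>"
  have anti: "?g \<epsilon>' \<le> ?g \<epsilon>" if "\<epsilon> \<le> \<epsilon>'" for \<epsilon> \<epsilon>'
    unfolding cost_rate_def
    by (intro Limsup_mono eventually_mono[OF eventually_gt_at_top[of 0]] ereal_divide_right_mono one_shot_cost_antimono that) auto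
  have "(?g \<longlongrightarrow> (SUP \<epsilon>\<in>{0<..}. ?g \<epsilon>)) (at_right 0)"
  proof (rule order_tendstoI)
    fix y assume "y < (SUP \<epsilon>\<in>{0<..}. ?g \<epsilon>)"
    then obtain e where e: "0 < e" "y < ?g e" by (auto simp: less_SUP_iff)
    have "\<forall>\<^sub>F \<epsilon> in at_right 0. \<epsilon> < e" by (rule order_tendstoD(2)[OF tendsto_ident_at e(1)])
    then show "\<forall>\<^sub>F \<epsilon> in at_right 0. y < ?g \<epsilon>"
      by (rule eventually_mono) (use e(2) anti in \<open>meson less_imp_le less_le_trans\<close>)
  next
    fix y assume y: "(SUP \<epsilon>\<in>{0<..}. ?g \<epsilon>) < y"
    have "\<forall>\<^sub>F \<epsilon> :: real in at_right 0. \<epsilon> > 0" by (rule eventually_at_right_less)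
    then show "\<forall>\<^sub>F \<epsilon> in at_right 0. ?g \<epsilon> < y"
      by (rule eventually_mono) (use y in \<open>auto intro: le_less_trans[OF SUP_upper]\<close>)
  qed
  then show ?thesis unfolding ent_cost_seq_def cost_rate_def[symmetric] by (intro tendsto_Lim) auto
qed

text \<open>The additive 2 vanishes after division by \<open>n\<close>. As this works for each
  sequence \<open>\<delta>\<close> separately, it covers both the exact and the asymptotic
  claim.\<close>

lemma ent_cost_seq_DNE_NE: "ent_cost_seq DNE \<delta> a b \<rho> = ent_cost_seq NE \<delta> a b \<rho>"
proof -
  have "cost_rate DNE \<delta> a b \<rho> \<epsilon> = cost_rate NE \<delta> a b \<rho> \<epsilon>" for \<epsilon>
  proof (rule antisym)
    have "cost_rate DNE \<delta> a b \<rho> \<epsilon> \<le> cost_rate NE \<delta> a b \<rho> \<epsilon> + ereal 0"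
      unfolding cost_rate_def
    proof (rule limsup_le_vanishing)
      show "(\<lambda>n. 2 / real n) \<longlonglongrightarrow> 0" by real_asymp
      show "\<forall>\<^sub>F n in sequentially. one_shot_cost (DNE (\<delta> n)) \<epsilon> (a ^ n) (b ^ n) (bi_power a b n \<rho>) / ereal (real n)
        \<le> one_shot_cost (NE (\<delta> n)) \<epsilon> (a ^ n) (b ^ n) (bi_power a b n \<rho>) / ereal (real n) + ereal (2 / real n)"
        using eventually_gt_at_top[of 0]
      proof eventually_elim
        case (elim n)
        then have n: "0 < real n" by simp
        show ?case unfolding ereal_add_divide[OF n, symmetric]
          using n by (intro ereal_divide_right_mono one_shot_cost_DNE_le_NE) simp
      qed
    qed
    then show "cost_rate DNE \<delta> a b \<rho> \<epsilon> \<le> cost_rate NE \<delta> a b \<rho> \<epsilon>" by simp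
    show "cost_rate NE \<delta> a b \<rho> \<epsilon> \<le> cost_rate DNE \<delta> a b \<rho> \<epsilon>"
      unfolding cost_rate_def
      by (intro Limsup_mono eventually_mono[OF eventually_gt_at_top[of 0]] ereal_divide_right_mono one_shot_cost_NE_le_DNE) auto
  qed
  then show ?thesis unfolding ent_cost_seq_SUP by simp
qed

definition rel_ent_rate :: "nat \<Rightarrow> nat \<Rightarrow> complex mat \<Rightarrow> nat \<Rightarrow> ereal" where
  "rel_ent_rate a b \<rho> n = rel_entropy_set (bi_power a b n \<rho>) (sep (a ^ n) (b ^ n)) / ereal (real n)"

text \<open>The continuity terms of \<open>NE_converse\<close> contribute a multiple of
  \<open>\<epsilon>\<close> per copy that does not vanish with \<open>n\<close>. It is absorbed by
  taking \<open>\<epsilon>\<close> small, the cost being a supremum over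
  \<open>\<epsilon>\<close>.\<close>

lemma cost_lower_bound:
  assumes r: "density (a * b) \<rho>" and d: "\<And>n. \<delta> n \<ge> 0" "\<delta> \<longlonglongrightarrow> 0"
  shows "limsup (rel_ent_rate a b \<rho>) \<le> ent_cost_seq NE \<delta> a b \<rho>"
proof (rule ereal_le_epsilon2)
  fix e :: real assume e: "0 < e"
  define L where "L = ln (real (a * b)) / ln 2"
  have ab: "a * b > 0" by (rule density_dim_pos[OF r])
  have "1 \<le> a * b" using ab by linarith
  then have "real 1 \<le> real (a * b)" by (rule of_nat_mono)
  then have L0: "0 \<le> L" unfolding L_def by (intro divide_nonneg_nonneg ln_ge_zero) simp_all
  \<comment> \<open>The 4 counts two dimension terms with error \<open>2 * \<epsilon>\<close> each;
    the cap \<open>1 / 2\<close> keeps \<open>2 * \<epsilon> \<le> 1\<close>, as the continuity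
    estimate requires.\<close>
  define \<epsilon> where "\<epsilon> = min (1 / 2) (e / (4 * (L + 1)))"
  have eps: "0 < \<epsilon>" "2 * \<epsilon> \<le> 1" using e L0 by (auto simp: \<epsilon>_def)
  have "\<epsilon> * (4 * L) \<le> e / (4 * (L + 1)) * (4 * (L + 1))"
    using L0 e by (intro mult_mono) (auto simp: \<epsilon>_def)
  then have eL: "4 * \<epsilon> * L \<le> e" using L0 by (simp add: mult_ac)
  define z where "z n = (ln (2 * (2 + \<delta> n)) + 2 + 2 * \<epsilon> * ln 2) / ln 2 / real n + 4 * \<epsilon> * L" for n
  have "limsup (rel_ent_rate a b \<rho>) \<le> cost_rate NE \<delta> a b \<rho> \<epsilon> + ereal (4 * \<epsilon> * L)"
    unfolding cost_rate_def
  proof (rule limsup_le_vanishing)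
    have "(\<lambda>n. 1 / real n) \<longlonglongrightarrow> 0" by real_asymp
    then have "(\<lambda>n. (ln (2 * (2 + \<delta> n)) + 2 + 2 * \<epsilon> * ln 2) / ln 2 * (1 / real n) + 4 * \<epsilon> * L) \<longlonglongrightarrow> (ln (2 * (2 + 0)) + 2 + 2 * \<epsilon> * ln 2) / ln 2 * 0 + 4 * \<epsilon> * L"
      using d(2) by (intro tendsto_intros) auto
    then show "z \<longlonglongrightarrow> 4 * \<epsilon> * L" unfolding z_def by simp
    show "\<forall>\<^sub>F n in sequentially. rel_ent_rate a b \<rho> n
      \<le> one_shot_cost (NE (\<delta> n)) \<epsilon> (a ^ n) (b ^ n) (bi_power a b n \<rho>) / ereal (real n) + ereal (z n)"
      using eventually_gt_at_top[of 0]
    proof eventually_elim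
      case (elim n)
      then have n: "0 < real n" by simp
      let ?C = "one_shot_cost (NE (\<delta> n)) \<epsilon> (a ^ n) (b ^ n) (bi_power a b n \<rho>)"
      let ?w = "(ln (2 * (2 + \<delta> n)) + 2 + 2 * \<epsilon> * ln 2) / ln 2 + real n * (4 * \<epsilon> * L)"
      have "rel_entropy_set (bi_power a b n \<rho>) (sep (a ^ n) (b ^ n)) \<le> ?C + ereal ?w"
      proof (cases "?C = \<infinity>")
        case False
        then obtain m where m: "?C = ereal (real m)"
          "best_error (NE (\<delta> n)) m (a ^ n) (b ^ n) (bi_power a b n \<rho>) \<le> ereal \<epsilon>"
          by (rule one_shot_cost_cases)
        \<comment> \<open>The infimum over operations may fail to be attained, so an operation with
          error below \<open>2 * \<epsilon>\<close> is taken.\<close>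
        have "ereal \<epsilon> < ereal (2 * \<epsilon>)" using eps by simp
        then have "best_error (NE (\<delta> n)) m (a ^ n) (b ^ n) (bi_power a b n \<rho>) < ereal (2 * \<epsilon>)"
          using m(2) by (rule le_less_trans[rotated])
        then obtain \<Lambda> where La: "\<Lambda> \<in> NE (\<delta> n) (2 ^ m) (2 ^ m) (a ^ n) (b ^ n)"
          "ereal (1 / 2 * trace_norm (\<Lambda> (phiK (2 ^ m)) - bi_power a b n \<rho>)) < ereal (2 * \<epsilon>)"
          unfolding best_error_def INF_less_iff by blast
        have tn: "1 / 2 * trace_norm (\<Lambda> (phiK (2 ^ m)) - bi_power a b n \<rho>) \<le> 2 * \<epsilon>"
          using La(2) unfolding less_ereal.simps by (rule less_imp_le)
        have "rel_entropy_set (bi_power a b n \<rho>) (sep (a ^ n) (b ^ n))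
          \<le> ereal ((ln (2 * (real (2 ^ m) * (2 + \<delta> n))) + 2 + 2 * \<epsilon> * ln (real (a ^ n * b ^ n)) + 2 * \<epsilon> * ln (2 * real (a ^ n * b ^ n))) / ln 2)"
          by (rule NE_converse[OF density_bi_power[OF r] La(1) _ d(1) tn eps(2)]) simp
        also have "(ln (2 * (real (2 ^ m) * (2 + \<delta> n))) + 2 + 2 * \<epsilon> * ln (real (a ^ n * b ^ n)) + 2 * \<epsilon> * ln (2 * real (a ^ n * b ^ n))) / ln 2 = real m + ?w"
        proof -
          have "real (a ^ n * b ^ n) = real (a * b) ^ n" by (simp add: power_mult_distrib)
          then have l1: "ln (real (a ^ n * b ^ n)) = real n * ln (real (a * b))" using ab by (simp only: ln_realpow of_nat_0_less_iff)
          have l2: "ln (2 * real (a ^ n * b ^ n)) = ln 2 + real n * ln (real (a * b))"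
            unfolding l1[symmetric] using ab by (intro ln_mult_pos) auto
          have "2 * (real (2 ^ m) * (2 + \<delta> n)) = 2 ^ m * (2 * (2 + \<delta> n))" by simp
          then have l3: "ln (2 * (real (2 ^ m) * (2 + \<delta> n))) = real m * ln 2 + ln (2 * (2 + \<delta> n))"
            using d(1)[of n] by (simp only:) (subst ln_mult_pos, simp_all add: ln_realpow)
          show ?thesis unfolding l1 l2 l3 L_def by (simp add: field_simps)
        qed
        finally show ?thesis unfolding m(1) by simp
      qed simp
      then have "rel_ent_rate a b \<rho> n \<le> (?C + ereal ?w) / ereal (real n)"
        unfolding rel_ent_rate_def using n by (intro ereal_divide_right_mono) auto
      also have "\<dots> = ?C / ereal (real n) + ereal (z n)"
        unfolding ereal_add_divide[OF n] z_def using n by (simp add: add_divide_distrib)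
      finally show ?case .
    qed
  qed
  also have "\<dots> \<le> ent_cost_seq NE \<delta> a b \<rho> + ereal e"
    unfolding ent_cost_seq_SUP using eps(1) eL by (intro add_mono SUP_upper) auto
  finally show "limsup (rel_ent_rate a b \<rho>) \<le> ent_cost_seq NE \<delta> a b \<rho> + ereal e" .
qed

lemma cost_upper_bound_real:
  assumes r: "density (a * b) \<rho>" and k: "0 < k" and s: "\<sigma> \<in> sep (a ^ k) (b ^ k)"
    and c: "rel_entropy (bi_power a b k \<rho>) \<sigma> = ereal c"
  shows "ent_cost_seq NE (\<lambda>n. 1 / (real n + 1)) a b \<rho> \<le> ereal (c / real k)"
  unfolding ent_cost_seq_SUP
proof (rule SUP_least)
  fix \<epsilon>' :: real assume "\<epsilon>' \<in> {0<..}"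
  then have e': "0 < \<epsilon>'" by simp
  \<comment> \<open>Smoothing asks for an error of at most 1; a larger \<open>\<epsilon>'\<close> is
    served by 1.\<close>
  define \<epsilon> where "\<epsilon> = min \<epsilon>' 1"
  have eps: "0 < \<epsilon>" "\<epsilon> \<le> 1" "\<epsilon> \<le> \<epsilon>'" using e' by (auto simp: \<epsilon>_def)
  let ?\<delta> = "\<lambda>n::nat. 1 / (real n + 1)"
  have c0: "0 \<le> c" by (rule achieve_blocks(1)[OF r s c, of 1 1]) simp_all
  show "cost_rate NE ?\<delta> a b \<rho> \<epsilon>' \<le> ereal (c / real k)"
  proof (rule ereal_le_epsilon2)
    fix e :: real assume e: "0 < e"
    \<comment> \<open>Chosen so that \<open>2 * \<eta> / (real k * ln 2) = e\<close>, which yields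
      \<open>gk\<close>.\<close>
    define \<eta> where "\<eta> = e * real k * ln 2 / 2"
    have \<eta>: "0 < \<eta>" using e k by (simp add: \<eta>_def)
    define g where "g = c * ln 2 + 2 * \<eta>"
    have g0: "0 \<le> g" using c0 \<eta> by (simp add: g_def)
    have gk: "g / (real k * ln 2) = c / real k + e"
    proof -
      have "g = (c + e * real k) * ln 2" by (simp add: g_def \<eta>_def algebra_simps)
      then have "g / (real k * ln 2) = (c + e * real k) / real k" by simp
      also have "\<dots> = c / real k + e" using k by (simp add: add_divide_distrib)
      finally show ?thesis .
    qed
    obtain Q where Q: "\<And>q n. q \<ge> Q \<Longrightarrow> n < k \<Longrightarrow>
        sep_approx (a ^ (n + q * k)) (b ^ (n + q * k)) (bi_power a b (n + q * k) \<rho>) (exp (real q * g) + 1) \<epsilon>"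
      using achieve_blocks(2)[OF r s c \<eta> eps(1,2)] by (auto simp: eventually_sequentially g_def)
    define z where "z n = (log 2 (real n + 1) + 2) / real n + g / (real k * ln 2)" for n
    \<comment> \<open>The comparison sequence is 0, so the whole cost per copy is carried by
      \<open>z\<close>.\<close>
    have "cost_rate NE ?\<delta> a b \<rho> \<epsilon>' \<le> limsup (\<lambda>_. 0) + ereal (g / (real k * ln 2))"
      unfolding cost_rate_def
    proof (rule limsup_le_vanishing)
      have "(\<lambda>n. (log 2 (real n + 1) + 2) / real n) \<longlonglongrightarrow> 0" by real_asymp
      then have "z \<longlonglongrightarrow> 0 + g / (real k * ln 2)" unfolding z_def by (intro tendsto_add tendsto_const)
      then show "z \<longlonglongrightarrow> g / (real k * ln 2)" by simp
      show "\<forall>\<^sub>F n in sequentially. one_shot_cost (NE (?\<delta> n)) \<epsilon>' (a ^ n) (b ^ n) (bi_power a b n \<rho>) / ereal (real n) \<le> 0 + ereal (z n)"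
        using eventually_ge_at_top[of "Q * k + 1"]
      proof eventually_elim
        case (elim N)
        \<comment> \<open>The \<open>+ 1\<close> in the lower bound on \<open>N\<close> makes it
          positive, for the division.\<close>
        then have N: "0 < real N" by simp
        define q where "q = N div k"
        define n where "n = N mod k"
        have Nn: "N = n + q * k" by (simp add: q_def n_def)
        have nk: "n < k" using k by (simp add: n_def)
        have "Q * k div k \<le> N div k" using elim by (intro div_le_mono) simp
        then have qQ: "q \<ge> Q" using k by (simp add: q_def)
        obtain \<sigma>' \<omega> where w: "\<sigma>' \<in> sep (a ^ N) (b ^ N)" "density (a ^ N * b ^ N) \<omega>"
          "psd (a ^ N * b ^ N) (complex_of_real (exp (real q * g) + 1) \<cdot>\<^sub>m \<sigma>' - \<omega>)"
          "1 / 2 * trace_norm (\<omega> - bi_power a b N \<rho>) \<le> \<epsilon>"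
          using Q[OF qQ nk] unfolding sep_approx_def Nn[symmetric] by (elim bexE exE conjE)
        \<comment> \<open>\<open>NE_achieve\<close> asks that the domination factor be at most
          \<open>\<delta> * real K\<close>; with robustness \<open>1 / (N + 1)\<close> and
          \<open>K = 2 ^ m\<close> this reads \<open>L \<le> 2 ^ m\<close>.\<close>
        define L where "L = (exp (real q * g) + 1) * (real N + 1)"
        define m where "m = nat \<lceil>log 2 L\<rceil>"
        have ex: "1 \<le> exp (real q * g)" using g0 by simp
        have "1 * 1 \<le> L" unfolding L_def using ex by (intro mult_mono) auto
        then have L1: "1 \<le> L" by simp
        then have "log 2 L \<le> real m" "real m \<le> log 2 L + 1" unfolding m_def by (simp_all add: real_nat_ceiling_ge)
        then have Lm: "L \<le> 2 ^ m" using L1 by (subst (asm) log_le_iff) (auto simp: powr_realpow)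
        have "\<exists>\<Lambda>\<in>NE (?\<delta> N) (2 ^ m) (2 ^ m) (a ^ N) (b ^ N). \<Lambda> (phiK (2 ^ m)) = \<omega>"
        proof (rule NE_achieve[OF w(2,1,3)])
          show "0 \<le> exp (real q * g) + 1" by (simp add: add_nonneg_nonneg)
          have "(exp (real q * g) + 1) * (real N + 1) \<le> real (2 ^ m)" using Lm by (simp add: L_def)
          then show "exp (real q * g) + 1 \<le> ?\<delta> N * real (2 ^ m)" by (simp add: pos_le_divide_eq add_nonneg_pos)
        qed auto
        then obtain \<Lambda> where "\<Lambda> \<in> NE (?\<delta> N) (2 ^ m) (2 ^ m) (a ^ N) (b ^ N)" "\<Lambda> (phiK (2 ^ m)) = \<omega>" by blast
        then have "one_shot_cost (NE (?\<delta> N)) \<epsilon>' (a ^ N) (b ^ N) (bi_power a b N \<rho>) \<le> ereal (real m)"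
          using w(4) eps(3) by (intro one_shot_cost_le) auto
        also have "real m \<le> real N * z N"
        proof -
          have "log 2 L = log 2 (exp (real q * g) + 1) + log 2 (real N + 1)"
            unfolding L_def by (intro log_mult_pos) (auto simp: add_pos_pos add_nonneg_pos)
          also have "log 2 (exp (real q * g) + 1) \<le> log 2 (2 * exp (real q * g))" using ex by (subst log_le_cancel_iff) (auto simp: add_pos_pos)
          also have "log 2 (2 * exp (real q * g)) = 1 + real q * g / ln 2"
            by (subst log_mult_pos) (auto simp: log_def)
          also have "real q * g / ln 2 \<le> real N * (g / (real k * ln 2))"
          proof -
            have "real q * real k \<le> real N" unfolding Nn by simp
            then have "real q \<le> real N / real k" using k by (simp add: pos_le_divide_eq)
            then have "real q * (g / ln 2) \<le> real N / real k * (g / ln 2)" using g0 by (intro mult_right_mono) auto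
            then show ?thesis by simp
          qed
          finally have "log 2 L + 1 \<le> real N * (g / (real k * ln 2)) + (log 2 (real N + 1) + 2)" by simp
          also have "\<dots> = real N * z N" using N by (simp add: z_def field_simps)
          finally show ?thesis using \<open>real m \<le> log 2 L + 1\<close> by linarith
        qed
        finally have "one_shot_cost (NE (?\<delta> N)) \<epsilon>' (a ^ N) (b ^ N) (bi_power a b N \<rho>) / ereal (real N) \<le> ereal (real N * z N) / ereal (real N)"
          using N by (intro ereal_divide_right_mono) auto
        then show ?case using N by simp
      qed
    qed
    also have "limsup (\<lambda>_. 0 :: ereal) = 0" by (simp add: Limsup_const)
    finally show "cost_rate NE ?\<delta> a b \<rho> \<epsilon>' \<le> ereal (c / real k) + ereal e" by (simp add: gk)
  qed
qed

text \<open>Multiplying by \<open>k\<close> moves the bound inside the infimum over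
  \<open>\<sigma>\<close>. A \<open>\<sigma>\<close> that violates the support condition has value
  \<infinity> there.\<close>

lemma cost_upper_bound:
  assumes r: "density (a * b) \<rho>" and k: "0 < k"
  shows "ent_cost_seq NE (\<lambda>n. 1 / (real n + 1)) a b \<rho> \<le> rel_ent_rate a b \<rho> k"
proof -
  let ?E = "ent_cost_seq NE (\<lambda>n. 1 / (real n + 1)) a b \<rho>"
  have k': "ereal (real k) > 0" "ereal (real k) \<noteq> \<infinity>" using k by auto
  have "ereal (real k) * ?E \<le> rel_entropy (bi_power a b k \<rho>) \<sigma>" if s: "\<sigma> \<in> sep (a ^ k) (b ^ k)" for \<sigma>
  proof (cases "supp (bi_power a b k \<rho>) \<subseteq> supp \<sigma>")
    case True
    then obtain c where c: "rel_entropy (bi_power a b k \<rho>) \<sigma> = ereal c" by (auto simp: rel_entropy_def)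
    have "?E \<le> rel_entropy (bi_power a b k \<rho>) \<sigma> / ereal (real k)"
      using cost_upper_bound_real[OF r k s c] k by (simp add: c)
    then show ?thesis unfolding ereal_le_divide_pos[OF k'] .
  qed (simp add: rel_entropy_def)
  then have "ereal (real k) * ?E \<le> rel_entropy_set (bi_power a b k \<rho>) (sep (a ^ k) (b ^ k))"
    unfolding rel_entropy_set_def by (rule INF_greatest)
  then show ?thesis unfolding rel_ent_rate_def ereal_le_divide_pos[OF k'] .
qed

theorem theorem2:
  fixes a b :: nat and \<rho> :: "complex mat"
  assumes "density (a * b) \<rho>"
  shows "ent_cost DNE a b \<rho> = ent_cost NE a b \<rho> \<and>
         asymp_ent_cost DNE a b \<rho> = asymp_ent_cost NE a b \<rho> \<and>
         asymp_ent_cost NE a b \<rho> = reg_rel_entropy a b \<rho>"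
proof (intro conjI)
  show "ent_cost DNE a b \<rho> = ent_cost NE a b \<rho>" unfolding ent_cost_def by (rule ent_cost_seq_DNE_NE)
  show "asymp_ent_cost DNE a b \<rho> = asymp_ent_cost NE a b \<rho>" unfolding asymp_ent_cost_def ent_cost_seq_DNE_NE ..
  let ?\<delta> = "\<lambda>n::nat. 1 / (real n + 1)"
  let ?E = "asymp_ent_cost NE a b \<rho>"
  have up: "limsup (rel_ent_rate a b \<rho>) \<le> ?E"
    unfolding asymp_ent_cost_def
  proof (rule INF_greatest)
    fix \<delta> :: "nat \<Rightarrow> real" assume "\<delta> \<in> {\<delta>. (\<forall>n. 0 \<le> \<delta> n) \<and> \<delta> \<longlonglongrightarrow> 0}"
    then show "limsup (rel_ent_rate a b \<rho>) \<le> ent_cost_seq NE \<delta> a b \<rho>"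
      by (intro cost_lower_bound[OF assms]) auto
  qed
  have "?\<delta> \<longlonglongrightarrow> 0" by real_asymp
  then have E: "?E \<le> ent_cost_seq NE ?\<delta> a b \<rho>" unfolding asymp_ent_cost_def by (intro INF_lower) auto
  \<comment> \<open>The upper bound holds for every single \<open>n > 0\<close>, so it passes to the
    lower limit.\<close>
  have "?E \<le> liminf (rel_ent_rate a b \<rho>)"
  proof (rule Liminf_bounded)
    show "\<forall>\<^sub>F n in sequentially. ?E \<le> rel_ent_rate a b \<rho> n"
      using eventually_gt_at_top[of 0]
    proof eventually_elim
      case (elim n)
      show ?case by (rule order_trans[OF E cost_upper_bound[OF assms elim]])
    qed
  qed
  moreover have "liminf (rel_ent_rate a b \<rho>) \<le> limsup (rel_ent_rate a b \<rho>)" by (rule Liminf_le_Limsup) simp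
  \<comment> \<open>\<open>reg_rel_entropy\<close> is written with \<open>lim\<close>, so actual
    convergence has to be shown before its value can be read off.\<close>
  ultimately have "rel_ent_rate a b \<rho> \<longlonglongrightarrow> ?E"
    using up by (subst tendsto_iff_Liminf_eq_Limsup) (auto intro: antisym order_trans)
  then have "lim (rel_ent_rate a b \<rho>) = ?E" by (rule limI)
  then show "?E = reg_rel_entropy a b \<rho>" by (simp add: reg_rel_entropy_def rel_ent_rate_def[abs_def])
qed

end
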